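(* Let $m\in H^\infty$ be inner, $H=H^2\ominus mH^2$ with $\dim H\ge2$, and $T=P_HS|_H$. Then $T^2$ is multiplicity free (has a cyclic vector) if and only if $m$ has no nonconstant inner divisor $p\in H^\infty$ satisfying $p(\lambda)=p(-\lambda)$ for all $\lambda\in\mathbb D$.
   Context: $S$ is the unilateral shift $(Sh)(z)=zh(z)$ on the Hardy space $H^2$ of the unit disc $\mathbb D$; $P_H$ is the orthogonal projection onto $H$. An inner divisor of $m$ is an inner function $p$ with $m/p\in H^\infty$. *)

theory Defs
  imports "HOL-Complex_Analysis.Complex_Analysis"
begin

abbreviation disc :: "complex set" where "disc \<equiv> ball 0 1"

definition tcoeff :: "(complex \<Rightarrow> complex) \<Rightarrow> nat \<Rightarrow> complex" where
  "tcoeff f n = (deriv ^^ n) f 0 / of_nat (fact n)"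

text \<open>Hardy space H^2: holomorphic functions on the disc with square-summable
  Taylor coefficients. Functions are normalised to vanish off the disc so that
  an element of H^2 is determined by its values on the disc.\<close>
definition hardy2 :: "(complex \<Rightarrow> complex) set" where
  "hardy2 = {f. f holomorphic_on disc \<and> (\<forall>z. z \<notin> disc \<longrightarrow> f z = 0)
               \<and> summable (\<lambda>n. (norm (tcoeff f n))\<^sup>2)}"

definition h2_inner :: "(complex \<Rightarrow> complex) \<Rightarrow> (complex \<Rightarrow> complex) \<Rightarrow> complex" where
  "h2_inner f g = (\<Sum>n. tcoeff f n * cnj (tcoeff g n))"

definition h2_norm :: "(complex \<Rightarrow> complex) \<Rightarrow> real" where
  "h2_norm f = sqrt (\<Sum>n. (norm (tcoeff f n))\<^sup>2)"

definition hinf :: "(complex \<Rightarrow> complex) set" where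
  "hinf = {f. f holomorphic_on disc \<and> bounded (f ` disc)}"

definition inner_fn :: "(complex \<Rightarrow> complex) \<Rightarrow> bool" where
  "inner_fn m \<longleftrightarrow> m \<in> hinf \<and>
     (AE t in lebesgue_on {0..2*pi}.
        (\<exists>w. norm w = 1 \<and> ((\<lambda>r. m (complex_of_real r * cis t)) \<longlongrightarrow> w) (at_left 1)))"

definition inner_divisor :: "(complex \<Rightarrow> complex) \<Rightarrow> (complex \<Rightarrow> complex) \<Rightarrow> bool" where
  "inner_divisor p m \<longleftrightarrow> inner_fn p \<and> (\<exists>q\<in>hinf. \<forall>z\<in>disc. m z = p z * q z)"

definition model_space :: "(complex \<Rightarrow> complex) \<Rightarrow> (complex \<Rightarrow> complex) set" where
  "model_space m = {f \<in> hardy2. \<forall>g\<in>hardy2.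
       h2_inner f (\<lambda>z. if z \<in> disc then m z * g z else 0) = 0}"

definition proj :: "(complex \<Rightarrow> complex) set \<Rightarrow> (complex \<Rightarrow> complex) \<Rightarrow> (complex \<Rightarrow> complex)" where
  "proj K h = (THE k. k \<in> K \<and> (\<forall>y\<in>K. h2_inner (\<lambda>z. h z - k z) y = 0))"

definition shift :: "(complex \<Rightarrow> complex) \<Rightarrow> (complex \<Rightarrow> complex)" where
  "shift f = (\<lambda>z. z * f z)"

definition compressed_shift :: "(complex \<Rightarrow> complex) \<Rightarrow> (complex \<Rightarrow> complex) \<Rightarrow> (complex \<Rightarrow> complex)" where
  "compressed_shift m f = proj (model_space m) (shift f)"

definition cyclic_vector :: "(complex \<Rightarrow> complex) set \<Rightarrow> ((complex \<Rightarrow> complex) \<Rightarrow> (complex \<Rightarrow> complex))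
     \<Rightarrow> (complex \<Rightarrow> complex) \<Rightarrow> bool" where
  "cyclic_vector K A x \<longleftrightarrow> x \<in> K \<and>
     (\<forall>y\<in>K. \<forall>e>0. \<exists>N c. h2_norm (\<lambda>z. y z - (\<Sum>k<N. c k * (A ^^ k) x z)) < e)"

definition multiplicity_free :: "(complex \<Rightarrow> complex) set \<Rightarrow> ((complex \<Rightarrow> complex) \<Rightarrow> (complex \<Rightarrow> complex)) \<Rightarrow> bool" where
  "multiplicity_free K A \<longleftrightarrow> (\<exists>x. cyclic_vector K A x)"

end

theory Submission
  imports Defs
begin

text \<open>
Let \<open>X\<^sup>~(z) = X(-z)\<close>. Modulo \<open>m H\<^sup>2\<close>, the operator \<open>T\<^sup>2\<close> is multiplication by \<open>z\<^sup>2\<close>, so \<open>T\<^sup>2\<close> is cyclic iff for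
some \<open>X\<close> the functions \<open>f X + m h\<close> (\<open>f\<close> an even polynomial, \<open>h \<in> H\<^sup>2\<close>) are dense in \<open>H\<^sup>2\<close>.

If \<open>p\<close> is an even inner divisor of \<open>m\<close>, choose \<open>F = f X + p h\<close> close to \<open>1\<close> and \<open>G = g X + p k\<close> close to \<open>z\<close>.
Then \<open>D = F G\<^sup>~ - F\<^sup>~ G\<close> is close to \<open>-2 z\<close> in the mean and is divisible by \<open>p\<close>. As \<open>\<bar>p\<bar> = 1\<close> on the circle,
\<open>K = D / p\<close> has the same mean modulus as \<open>D\<close>, and \<open>K(0) = 0\<close>; comparing \<open>D'(0) = p(0) K'(0)\<close> with these means
gives \<open>\<bar>p(0)\<bar> \<ge> 1\<close>, so \<open>p\<close> is constant.

Conversely the projection of \<open>1\<close> to the model space is cyclic unless the odd parts of the functions in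
\<open>m H\<^sup>2\<close> fail to be dense among the odd functions. Their closure \<open>M\<close> is invariant under \<open>z\<^sup>2\<close>, and Beurling's
argument gives \<open>M \<subseteq> \<phi> H\<^sup>2\<close> for an odd inner function \<open>\<phi> \<in> M\<close>. Since \<open>z m\<close> is the odd part of \<open>z m\<close> plus \<open>z\<close> times
the odd part of \<open>m\<close>, the even function \<open>\<phi>/z\<close> divides \<open>m\<close>. If it is constant, then \<open>M\<close> contains all odd functions.
Radial limits of \<open>\<phi>/z\<close> come from Fatou's theorem: a primitive is differentiable almost everywhere on the circle
by the Vitali covering theorem, and at such points its derivative has a radial limit by the maximum principle.
\<close>

section \<open>Fatou's theorem\<close>

text \<open>Why \<open>F G~ - F~ G\<close> is divisible by \<open>p\<close>: modulo \<open>p\<close>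
  both \<open>F\<close> and \<open>G\<close> are even multiples of the same \<open>X\<close>, and
  since \<open>p\<close> is even the reflected congruences hold modulo the same \<open>p\<close>, so
  the two products agree. The targets \<open>1\<close> and \<open>z\<close> keep the difference away
  from 0. The obstacle is that \<open>D\<close> and \<open>K\<close> are sums of products of two
  Hardy functions, so only first-order means are under control. All comparisons therefore use
  circles of radius below 1, and \<open>|p| = 1\<close> enters through two limit statements:
  multiplication by \<open>p\<close> is isometric, and the means of \<open>|u v| (1 - |p|)\<close>
  tend to 0. Acting isometrically on polynomials is the working form of being inner; Fatou's theorem
  is used to return from it to radial limits for the divisor found in the converse. Invariance under
  \<open>z^2\<close> alone would in general call for two generators. For odd functions one is
  enough: an odd power of \<open>z\<close> times an odd function is even, hence orthogonal to the
  odd generator.\<close>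

lemma cis_of_nat_diff_has_integral:
  fixes j k :: nat
  shows "((\<lambda>t. cis (real j * t) * cnj (cis (real k * t))) has_integral
           (if j = k then of_real (2 * pi) else 0)) {0..2*pi}"
proof (cases "j = k")
  case True
  have "((\<lambda>t::real. 1::complex) has_integral of_real (2 * pi)) {0..2*pi}"
    using has_integral_const_real[of "1::complex" 0 "2*pi"] by (simp add: scaleR_conv_of_real)
  moreover have "cis x * cnj (cis x) = 1" for x
    by (simp add: cis_cnj cis_mult)
  ultimately show ?thesis using True by simp
next
  case False
  define a where "a = real j - real k"
  have a: "a \<noteq> 0" using False by (simp add: a_def)
  have eq: "cis (real j * t) * cnj (cis (real k * t)) = cis (a * t)" for t
    by (simp add: cis_cnj cis_mult a_def algebra_simps)
  have "((\<lambda>t. cis (a * t)) has_integral (cis (a * (2*pi)) / (\<i> * a) - cis (a * 0) / (\<i> * a))) {0..2*pi}"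
  proof (rule fundamental_theorem_of_calculus)
    fix t :: real
    have "((\<lambda>t. exp (\<i> * of_real (a * t)) / (\<i> * a)) has_vector_derivative exp (\<i> * of_real (a * t))) (at t within {0..2*pi})"
      using a by (auto intro!: derivative_eq_intros has_vector_derivative_real_field simp: field_simps)
    then show "((\<lambda>t. cis (a * t) / (\<i> * a)) has_vector_derivative cis (a * t)) (at t within {0..2*pi})"
      by (simp add: cis_conv_exp)
  qed simp
  moreover have "cis (a * (2*pi)) = 1"
  proof -
    have "a * (2*pi) = 2 * pi * of_int (int j - int k)" by (simp add: a_def)
    then show ?thesis using cis_multiple_2pi[of "of_int (int j - int k)"] by (metis Ints_of_int)
  qed
  ultimately show ?thesis using False by (simp add: eq)
qed

lemma trig_parseval:
  fixes c :: "nat \<Rightarrow> complex"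
  assumes "finite A"
  shows "((\<lambda>t. (norm (\<Sum>n\<in>A. c n * cis (real n * t)))\<^sup>2) has_integral (2 * pi * (\<Sum>n\<in>A. (norm (c n))\<^sup>2))) {0..2*pi}"
proof -
  have "((\<lambda>t. \<Sum>j\<in>A. \<Sum>k\<in>A. (c j * cnj (c k)) * (cis (real j * t) * cnj (cis (real k * t)))) has_integral
         (\<Sum>j\<in>A. \<Sum>k\<in>A. (c j * cnj (c k)) * (if j = k then of_real (2 * pi) else 0))) {0..2*pi}"
    by (intro has_integral_sum has_integral_mult_right cis_of_nat_diff_has_integral assms)
  moreover have "(\<Sum>j\<in>A. \<Sum>k\<in>A. (c j * cnj (c k)) * (cis (real j * t) * cnj (cis (real k * t))))
      = of_real ((norm (\<Sum>n\<in>A. c n * cis (real n * t)))\<^sup>2)" for t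
    unfolding complex_norm_square by (simp add: sum_product cnj_sum ac_simps)
  moreover have "(\<Sum>j\<in>A. \<Sum>k\<in>A. (c j * cnj (c k)) * (if j = k then of_real (2 * pi) else 0)) =
      (of_real (2 * pi * (\<Sum>n\<in>A. (norm (c n))\<^sup>2)) :: complex)"
    using assms by (simp add: if_distrib[of "\<lambda>x. _ * x"] sum_distrib_left complex_norm_square mult.commute cong: if_cong
        del: of_real_power)
  ultimately have "((\<lambda>t. complex_of_real ((norm (\<Sum>n\<in>A. c n * cis (real n * t)))\<^sup>2)) has_integral
        of_real (2 * pi * (\<Sum>n\<in>A. (norm (c n))\<^sup>2))) {0..2*pi}" by simp
  from has_integral_linear[OF this bounded_linear_Re] show ?thesis
    by (simp add: o_def)
qed

text \<open>Let \<open>h\<close> be the first-order remainder of \<open>W\<close> at a boundary point \<open>\<zeta>\<close>. A power of the peak function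
  \<open>(1 + cnj \<zeta> z) / 2\<close> makes \<open>h\<close> small away from \<open>\<zeta>\<close>, so the maximum principle for the quotient by
  \<open>z - (1 + \<eta>) \<zeta>\<close> bounds \<open>h\<close> inside the disc; Cauchy's inequality then bounds its derivative.\<close>
lemma radial_derivative_limit:
  fixes W :: "complex \<Rightarrow> complex"
  assumes cont: "continuous_on (cball 0 1) W" and holo: "W holomorphic_on ball 0 1"
    and d: "((\<lambda>t. W (cis t)) has_vector_derivative D) (at t0)"
  shows "((\<lambda>r. deriv W (of_real r * cis t0)) \<longlongrightarrow> D / (\<i> * cis t0)) (at_left 1)"
proof -
  define \<zeta> where "\<zeta> = cis t0"
  have n\<zeta> [simp]: "norm \<zeta> = 1" "\<zeta> \<noteq> 0" by (auto simp: \<zeta>_def)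
  define D' where "D' = D / (\<i> * \<zeta>)"
  define h where "h z = W z - W \<zeta> - D' * (z - \<zeta>)" for z
  have hcont: "continuous_on (cball 0 1) h" unfolding h_def by (intro continuous_intros cont)
  have hholo: "h holomorphic_on ball 0 1" unfolding h_def by (intro holomorphic_intros holo)
  have "compact (h ` cball 0 1)" by (intro compact_continuous_image hcont) auto
  then have "bounded (h ` cball 0 1)" by (rule compact_imp_bounded)
  then obtain C where C: "\<And>z. norm z \<le> 1 \<Longrightarrow> norm (h z) \<le> C"
    by (force simp: bounded_iff)
  have C0: "C \<ge> 0" using C[of 0] norm_ge_zero[of "h 0"] by (simp add: order_trans[of 0 "norm (h 0)"])
  have dh: "((\<lambda>t. h (cis t)) has_vector_derivative 0) (at t0)"
  proof -
    have "((\<lambda>t. exp (\<i> * of_real t)) has_vector_derivative \<i> * exp (\<i> * of_real t0)) (at t0)"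
      by (auto intro!: derivative_eq_intros has_vector_derivative_real_field)
    then have c: "(cis has_vector_derivative \<i> * \<zeta>) (at t0)"
      by (simp add: cis_conv_exp [abs_def] \<zeta>_def)
    have "((\<lambda>t. W (cis t) - W \<zeta> - D' * (cis t - \<zeta>)) has_vector_derivative (D - 0 - D' * (\<i> * \<zeta> - 0))) (at t0)"
      by (intro has_vector_derivative_diff has_vector_derivative_mult_right d c has_vector_derivative_const)
    then show ?thesis by (simp add: h_def D'_def)
  qed
  have h\<zeta>: "h \<zeta> = 0" by (simp add: h_def)
  \<comment> \<open>The estimate along the circle is pushed into the whole disc. The factor 2 is the
    price for dividing by \<open>k z ^ N\<close>, which has modulus above \<open>1/2\<close> near
    \<open>\<zeta>\<close>.\<close>
  have key: "\<exists>c>0. \<forall>z\<in>ball 0 1. norm (z - \<zeta>) < c \<longrightarrow> norm (h z) \<le> 2 * \<epsilon> * norm (z - \<zeta>)"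
    if \<epsilon>: "\<epsilon> > 0" for \<epsilon>
  proof -
    have "\<exists>c>0. \<forall>z. norm z = 1 \<and> norm (z - \<zeta>) < c \<longrightarrow> norm (h z) \<le> \<epsilon> * norm (z - \<zeta>)"
    proof -
      have "((\<lambda>t. h (cis t)) has_derivative (\<lambda>x. x *\<^sub>R 0)) (at t0)"
        using dh by (simp add: has_vector_derivative_def)
      then obtain d where d: "d > 0" and
        dd: "\<And>t. norm (t - t0) < d \<Longrightarrow> norm (h (cis t)) \<le> \<epsilon> / 2 * norm (t - t0)"
        using \<epsilon> h\<zeta> unfolding has_derivative_at_alt \<zeta>_def
        by (smt (verit, del_insts) diff_zero half_gt_zero scaleR_zero_right)
      show ?thesis
      proof (intro exI[of _ "min (1/2) (d/2)"] conjI allI impI)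
        show "0 < min (1/2) (d/2)" using d by simp
        fix z assume z: "norm z = 1 \<and> norm (z - \<zeta>) < min (1/2) (d/2)"
        \<comment> \<open>Passing from the angle \<open>s\<close> to the chord
          \<open>z - \<zeta>\<close> costs at most a factor 2, which is why \<open>dd\<close> has
          \<open>\<epsilon> / 2\<close>. The bound \<open>1/2\<close> keeps \<open>u\<close> in the
          range of the logarithm estimate, and \<open>d/2\<close> keeps \<open>s\<close> below
          \<open>d\<close>.\<close>
        define u where "u = z / \<zeta> - 1"
        have nu: "norm u = norm (z - \<zeta>)"
          using n\<zeta> by (metis (no_types, lifting) diff_divide_distrib div_by_1 divide_self_if norm_divide u_def)
        have L: "norm (Ln (1 + u)) \<le> 2 * norm u"
          using z nu by (intro norm_Ln_le) auto
        define s where "s = Im (Ln (1 + u))"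
        have sb: "\<bar>s\<bar> \<le> 2 * norm u" using L abs_Im_le_cmod[of "Ln (1+u)"] by (simp add: s_def)
        have nz: "norm (1 + u) = 1" using z by (simp add: u_def norm_divide)
        then have "1 + u \<noteq> 0" by auto
        then have "Re (Ln (1+u)) = 0" using nz by (simp add: Re_Ln)
        then have "Ln (1 + u) = \<i> * of_real s" by (simp add: s_def complex_eq_iff)
        then have "1 + u = cis s" using \<open>1 + u \<noteq> 0\<close> by (metis cis_conv_exp exp_Ln)
        then have zs: "z = cis (t0 + s)"
          by (simp add: u_def \<zeta>_def field_simps cis_mult[symmetric])
        have "norm (h (cis (t0 + s))) \<le> \<epsilon> / 2 * norm (t0 + s - t0)"
          using sb nu z by (intro dd) auto
        also have "\<dots> \<le> \<epsilon> / 2 * (2 * norm u)" using sb \<epsilon> by (intro mult_left_mono) auto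
        finally show "norm (h z) \<le> \<epsilon> * norm (z - \<zeta>)" using nu zs by simp
      qed
    qed
    then obtain c where c: "c > 0"
      and near: "\<And>z. \<lbrakk>norm z = 1; norm (z - \<zeta>) < c\<rbrakk> \<Longrightarrow> norm (h z) \<le> \<epsilon> * norm (z - \<zeta>)" by blast
    define k where "k z = (1 + cnj \<zeta> * z) / 2" for z
    have k\<zeta>: "k \<zeta> = 1" by (simp add: k_def mult.commute[of "cnj \<zeta>"] complex_norm_square[symmetric])
    \<comment> \<open>The parallelogram law for 1 and a unimodular \<open>w\<close>:
      \<open>|1 + w|^2 + |1 - w|^2 = 4\<close>.\<close>
    have kle: "(norm (k z))\<^sup>2 = 1 - (norm (z - \<zeta>))\<^sup>2 / 4" if "norm z = 1" for z
    proof -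
      define w where "w = cnj \<zeta> * z"
      have "norm w = 1" using that by (simp add: w_def norm_mult)
      moreover have "norm (z - \<zeta>) = norm (w - 1)"
      proof -
        have "cnj \<zeta> * (z - \<zeta>) = w - 1"
          by (simp add: w_def algebra_simps complex_norm_square[symmetric])
        then show ?thesis using norm_mult[of "cnj \<zeta>" "z - \<zeta>"] by simp
      qed
      ultimately show ?thesis
        unfolding k_def w_def[symmetric] norm_divide cmod_power2 power_divide
        by (simp add: cmod_def power2_eq_square) (simp add: field_simps)
    qed
    \<comment> \<open>The maximum with 0 is for \<open>c > 2\<close>, where no point of the circle
      is at distance \<open>c\<close> from \<open>\<zeta>\<close>.\<close>
    define \<rho> where "\<rho> = sqrt (max 0 (1 - c\<^sup>2/4))"
    have \<rho>: "0 \<le> \<rho>" "\<rho> < 1" using c by (auto simp: \<rho>_def)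
    obtain N where N: "C * \<rho> ^ N \<le> \<epsilon> * c"
    proof -
      have "(\<lambda>N. C * \<rho> ^ N) \<longlonglongrightarrow> C * 0" by (intro tendsto_intros LIMSEQ_realpow_zero \<rho>)
      then have "\<forall>\<^sub>F N in sequentially. C * \<rho> ^ N < \<epsilon> * c"
        by (rule order_tendstoD) (use \<epsilon> c in auto)
      then show ?thesis using that by (auto simp: eventually_sequentially intro: less_imp_le)
    qed
    have circ: "norm (h z * k z ^ N) \<le> \<epsilon> * norm (z - \<zeta>)" if z: "norm z = 1" for z
    proof (cases "norm (z - \<zeta>) < c")
      case True
      have "norm (k z) \<le> 1" using kle[OF z] by (simp add: power2_le_imp_le)
      then have "norm (k z) ^ N \<le> 1" by (simp add: power_le_one)
      then have "norm (h z) * norm (k z) ^ N \<le> norm (h z)" by (simp add: mult_left_le)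
      then show ?thesis using near[OF z True] by (simp add: norm_mult norm_power)
    next
      case False
      have "(norm (k z))\<^sup>2 \<le> 1 - c\<^sup>2/4"
        using kle[OF z] False c by (simp add: power_mono)
      then have "norm (k z) \<le> \<rho>" unfolding \<rho>_def by (intro real_le_rsqrt) auto
      then have "norm (k z) ^ N \<le> \<rho> ^ N" by (intro power_mono) auto
      then have "norm (h z) * norm (k z) ^ N \<le> C * \<rho> ^ N" using C[of z] z C0 by (intro mult_mono) auto
      also have "\<dots> \<le> \<epsilon> * c" by (rule N)
      also have "\<dots> \<le> \<epsilon> * norm (z - \<zeta>)" using False \<epsilon> by simp
      finally show ?thesis by (simp add: norm_mult norm_power)
    qed
    \<comment> \<open>The zero of the denominator is moved to \<open>(1 + \<eta>) \<zeta>\<close>,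
      outside the closed disc, so the quotient is continuous up to the circle. Seen from the circle
      this point is farther away than \<open>\<zeta>\<close>, so \<open>circ\<close> still bounds
      the quotient; afterwards \<open>\<eta>\<close> tends to 0.\<close>
    have far: "norm (h z * k z ^ N) \<le> \<epsilon> * norm (z - (1 + of_real \<eta>) * \<zeta>)" if z: "z \<in> ball 0 1" and \<eta>: "\<eta> > 0" for z \<eta>
    proof -
      have nz: "z - (1 + of_real \<eta>) * \<zeta> \<noteq> 0" if "norm z \<le> 1" for z
      proof
        assume "z - (1 + of_real \<eta>) * \<zeta> = 0"
        then have "norm z = norm (of_real (1 + \<eta>) * \<zeta>)" by simp
        then have "norm z = 1 + \<eta>" using \<eta> unfolding norm_mult norm_of_real by simp
        then show False using that \<eta> by simp
      qed
      define v where "v z = h z * k z ^ N / (z - (1 + of_real \<eta>) * \<zeta>)" for z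
      have "norm (v z) \<le> \<epsilon>"
      proof (rule maximum_modulus_frontier[of v "ball 0 1"])
        show "v holomorphic_on interior (ball 0 1)"
          unfolding v_def k_def using nz by (auto intro!: holomorphic_intros hholo)
        show "continuous_on (closure (ball 0 1)) v"
          unfolding v_def k_def using nz by (auto intro!: continuous_intros hcont)
        fix y :: complex assume "y \<in> frontier (ball 0 1)"
        then have y: "norm y = 1" by simp
        have "norm (y - \<zeta>) \<le> norm (y - (1 + of_real \<eta>) * \<zeta>)"
        proof (rule power2_le_imp_le)
          have "Re (y * cnj \<zeta>) \<le> norm (y * cnj \<zeta>)" by (rule complex_Re_le_cmod)
          also have "\<dots> = 1" using y by (simp add: norm_mult)
          finally have R: "Re y * Re \<zeta> + Im y * Im \<zeta> \<le> 1" by simp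
          have z1: "(Re \<zeta>)\<^sup>2 + (Im \<zeta>)\<^sup>2 = 1" using n\<zeta>(1) cmod_power2[of \<zeta>] by simp
          have "(norm (y - (1 + of_real \<eta>) * \<zeta>))\<^sup>2 - (norm (y - \<zeta>))\<^sup>2 =
             ((1 + \<eta>)\<^sup>2 - 1) * ((Re \<zeta>)\<^sup>2 + (Im \<zeta>)\<^sup>2) - 2 * \<eta> * (Re y * Re \<zeta> + Im y * Im \<zeta>)"
            unfolding cmod_power2 by (simp add: power2_eq_square algebra_simps)
          also have "\<dots> = \<eta>\<^sup>2 + 2 * \<eta> * (1 - (Re y * Re \<zeta> + Im y * Im \<zeta>))"
            unfolding z1 by (simp add: power2_eq_square algebra_simps)
          also have "\<dots> \<ge> 0" using R \<eta> by simp
          finally show "(norm (y - \<zeta>))\<^sup>2 \<le> (norm (y - (1 + of_real \<eta>) * \<zeta>))\<^sup>2" by simp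
        qed simp
        then have "\<epsilon> * norm (y - \<zeta>) \<le> \<epsilon> * norm (y - (1 + of_real \<eta>) * \<zeta>)" using \<epsilon> by simp
        then have "norm (h y * k y ^ N) \<le> \<epsilon> * norm (y - (1 + of_real \<eta>) * \<zeta>)"
          using circ[OF y] by linarith
        then show "norm (v y) \<le> \<epsilon>" unfolding v_def norm_divide using nz[of y] y
          by (simp add: pos_divide_le_eq)
      qed (use z in auto)
      then show ?thesis unfolding v_def norm_divide using nz[of z] z
        by (simp add: pos_divide_le_eq)
    qed
    have far': "norm (h z * k z ^ N) \<le> \<epsilon> * norm (z - \<zeta>)" if z: "z \<in> ball 0 1" for z
    proof (rule tendsto_lowerbound)
      show "((\<lambda>\<eta>. \<epsilon> * norm (z - (1 + of_real \<eta>) * \<zeta>)) \<longlongrightarrow> \<epsilon> * norm (z - \<zeta>)) (at_right 0)"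
        by (auto intro!: tendsto_eq_intros)
      show "\<forall>\<^sub>F \<eta> in at_right 0. norm (h z * k z ^ N) \<le> \<epsilon> * norm (z - (1 + of_real \<eta>) * \<zeta>)"
        using far[OF z] by (auto simp: eventually_at_right_field intro!: exI[of _ 1])
    qed simp
    have "isCont (\<lambda>z. norm (k z ^ N)) \<zeta>" unfolding k_def by (intro continuous_intros) auto
    then have "\<forall>\<^sub>F z in at \<zeta>. norm (k z ^ N) > 1/2"
      unfolding isCont_def by (rule order_tendstoD) (simp add: k\<zeta>)
    then obtain c2 where c2: "c2 > 0" "\<And>z. z \<noteq> \<zeta> \<Longrightarrow> norm (z - \<zeta>) < c2 \<Longrightarrow> norm (k z ^ N) > 1/2"
      unfolding eventually_at dist_norm by blast
    show ?thesis
    proof (intro exI conjI ballI impI)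
      show "c2 > 0" by fact
      fix z :: complex assume z: "z \<in> ball 0 1" "norm (z - \<zeta>) < c2"
      have "z \<noteq> \<zeta>" using z by auto
      then have "norm (h z) * (1/2) \<le> norm (h z) * norm (k z ^ N)"
        using c2(2)[of z] z by (intro mult_left_mono) auto
      also have "\<dots> \<le> \<epsilon> * norm (z - \<zeta>)" using far'[OF z(1)] by (simp add: norm_mult)
      finally show "norm (h z) \<le> 2 * \<epsilon> * norm (z - \<zeta>)" by simp
    qed
  qed
  show ?thesis
    unfolding \<zeta>_def[symmetric] D'_def[symmetric] tendsto_iff
  proof (intro allI impI)
    fix e :: real assume e: "e > 0"
    \<comment> \<open>On the circle of radius \<open>R = (1 - r) / 2\<close> about
      \<open>r \<zeta>\<close> all points are within \<open>3 R\<close> of \<open>\<zeta>\<close>,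
      so \<open>h\<close> is at most \<open>2 * (e/12) * 3 R = e/2 * R\<close> there, and Cauchy's
      inequality divides by \<open>R\<close>.\<close>
    then obtain c where c: "c > 0"
      and cc: "\<And>z. \<lbrakk>z \<in> ball 0 1; norm (z - \<zeta>) < c\<rbrakk> \<Longrightarrow> norm (h z) \<le> 2 * (e/12) * norm (z - \<zeta>)"
      using key[of "e/12"] by auto
    have ev: "\<forall>\<^sub>F r in at_left 1. max 0 (1 - c/2) < (r::real) \<and> r < 1"
      unfolding eventually_at_left_field using c by (intro exI[of _ "max 0 (1 - c/2)"]) auto
    show "\<forall>\<^sub>F r in at_left 1. dist (deriv W (of_real r * \<zeta>)) D' < e"
      using ev
    proof eventually_elim
      case (elim r)
      define R where "R = (1 - r) / 2"
      define z where "z = of_real r * \<zeta>"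
      have R: "R > 0" using elim by (simp add: R_def)
      have nz: "norm z = r" using elim by (simp add: z_def norm_mult)
      have z\<zeta>: "norm (z - \<zeta>) = 1 - r"
      proof -
        have "z - \<zeta> = of_real (r - 1) * \<zeta>" by (simp add: z_def algebra_simps)
        then show ?thesis using elim by (simp only: norm_mult norm_of_real) simp
      qed
      have sub: "cball z R \<subseteq> ball 0 1"
      proof
        fix y assume "y \<in> cball z R"
        then have "norm (y - z) \<le> R" by (simp add: dist_norm norm_minus_commute)
        then show "y \<in> ball 0 1" using nz norm_triangle_ineq[of "y - z" z] elim by (simp add: R_def field_simps)
      qed
      have "norm ((deriv ^^ 1) h z) \<le> fact 1 * (e/2 * R) / R ^ 1"
      proof (rule Cauchy_inequality[OF _ _ R])
        show "h holomorphic_on ball z R"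
          using hholo sub by (meson ball_subset_cball holomorphic_on_subset subset_trans)
        show "continuous_on (cball z R) h"
          using hholo sub by (meson holomorphic_on_imp_continuous_on holomorphic_on_subset)
        fix y assume y: "norm (z - y) = R"
        have "y \<in> ball 0 1" using sub y by (auto simp: dist_norm)
        moreover have n3: "norm (y - \<zeta>) \<le> 3 * R"
          using norm_triangle_ineq[of "y - z" "z - \<zeta>"] y z\<zeta> by (simp add: norm_minus_commute R_def field_simps)
        ultimately have "norm (h y) \<le> 2 * (e/12) * norm (y - \<zeta>)"
          using elim by (intro cc) (auto simp: R_def)
        also have "\<dots> \<le> 2 * (e/12) * (3 * R)" using n3 e by (intro mult_left_mono) auto
        finally show "norm (h y) \<le> e/2 * R" by (simp add: mult.commute)
      qed
      then have dn: "norm (deriv h z) \<le> e/2" using R by simp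
      have "(W has_field_derivative deriv W z) (at z)"
        using holo nz elim by (intro holomorphic_derivI) auto
      then have "(h has_field_derivative (deriv W z - D')) (at z)"
        unfolding h_def by (auto intro!: derivative_eq_intros)
      then have "deriv h z = deriv W z - D'" by (rule DERIV_imp_deriv)
      then show ?case using dn e by (simp add: dist_norm z_def)
    qed
  qed
qed

section \<open>Almost everywhere differentiability by Vitali coverings\<close>

lemma has_vector_derivative_iff_quotient_tendsto:
  fixes w :: "real \<Rightarrow> 'a::real_normed_vector"
  shows "(w has_vector_derivative D) (at t) \<longleftrightarrow> ((\<lambda>x. (w x - w t) /\<^sub>R (x - t)) \<longlongrightarrow> D) (at t)"
proof -
  have "(w has_vector_derivative D) (at t) \<longleftrightarrow>
      ((\<lambda>x. norm (w x - w t - (x - t) *\<^sub>R D) / norm (x - t)) \<longlongrightarrow> 0) (at t)"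
    by (simp add: has_vector_derivative_def has_derivative_iff_norm bounded_linear_scaleR_left)
  also have "\<dots> \<longleftrightarrow> ((\<lambda>x. norm ((w x - w t) /\<^sub>R (x - t) - D)) \<longlongrightarrow> 0) (at t)"
  proof (rule tendsto_cong)
    have "norm (w x - w t - (x - t) *\<^sub>R D) / norm (x - t) = norm ((w x - w t) /\<^sub>R (x - t) - D)" if "x \<noteq> t" for x
    proof -
      have "(w x - w t) /\<^sub>R (x - t) - D = (w x - w t - (x - t) *\<^sub>R D) /\<^sub>R (x - t)"
        using that by (simp add: scaleR_diff_right)
      then show ?thesis by (simp add: divide_inverse mult.commute)
    qed
    then show "\<forall>\<^sub>F x in at t. norm (w x - w t - (x - t) *\<^sub>R D) / norm (x - t) = norm ((w x - w t) /\<^sub>R (x - t) - D)"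
      by (auto simp: eventually_at_filter)
  qed
  also have "\<dots> \<longleftrightarrow> ((\<lambda>x. (w x - w t) /\<^sub>R (x - t)) \<longlongrightarrow> D) (at t)"
    by (simp add: tendsto_norm_zero_iff LIM_zero_iff)
  finally show ?thesis .
qed

text \<open>The value of the derivative is found along the single sequence
  \<open>t + 1 / (n + 1)\<close>; the Cauchy condition then carries it to every approach to
  \<open>t\<close>.\<close>

lemma differentiable_if_quotients_Cauchy:
  fixes w :: "real \<Rightarrow> complex"
  assumes "\<And>e. e > 0 \<Longrightarrow> \<exists>d>0. \<forall>x y. x \<noteq> t \<and> y \<noteq> t \<and> \<bar>x - t\<bar> < d \<and> \<bar>y - t\<bar> < d \<longrightarrow>
             norm ((w x - w t) /\<^sub>R (x - t) - (w y - w t) /\<^sub>R (y - t)) \<le> e"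
  shows "\<exists>D. (w has_vector_derivative D) (at t)"
proof -
  define q where "q x = (w x - w t) /\<^sub>R (x - t)" for x
  define s where "s n = t + inverse (real (Suc n))" for n
  have st: "s n \<noteq> t" for n
    unfolding s_def using positive_imp_inverse_positive[of "real (Suc n)"] by (simp del: of_nat_Suc)
  have slim: "s \<longlonglongrightarrow> t"
    unfolding s_def using tendsto_add[OF tendsto_const[of t] LIMSEQ_inverse_real_of_nat] by simp
  have "Cauchy (\<lambda>n. q (s n))"
  proof (rule metric_CauchyI)
    fix e :: real assume "e > 0"
    then obtain d where d: "d > 0" and dd: "\<And>x y. \<lbrakk>x \<noteq> t; y \<noteq> t; \<bar>x - t\<bar> < d; \<bar>y - t\<bar> < d\<rbrakk> \<Longrightarrow> norm (q x - q y) \<le> e/2"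
      using assms[of "e/2"] unfolding q_def by (metis half_gt_zero)
    from slim d obtain N where "\<And>n. n \<ge> N \<Longrightarrow> \<bar>s n - t\<bar> < d"
      unfolding LIMSEQ_iff by (metis real_norm_def)
    then have "norm (q (s m) - q (s n)) \<le> e/2" if "m \<ge> N" "n \<ge> N" for m n
      using that by (intro dd st) auto
    then show "\<exists>M. \<forall>m\<ge>M. \<forall>n\<ge>M. dist (q (s m)) (q (s n)) < e"
      using \<open>e > 0\<close> unfolding dist_norm by (intro exI[of _ N]) force
  qed
  then obtain D where D: "(\<lambda>n. q (s n)) \<longlonglongrightarrow> D"
    using Cauchy_convergent_iff convergent_def by blast
  have "(q \<longlongrightarrow> D) (at t)"
    unfolding tendsto_iff
  proof (intro allI impI)
    fix e :: real assume "e > 0"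
    then obtain d where d: "d > 0" and dd: "\<And>x y. \<lbrakk>x \<noteq> t; y \<noteq> t; \<bar>x - t\<bar> < d; \<bar>y - t\<bar> < d\<rbrakk> \<Longrightarrow> norm (q x - q y) \<le> e/2"
      using assms[of "e/2"] unfolding q_def by (metis half_gt_zero)
    have "norm (q x - D) \<le> e/2" if x: "x \<noteq> t" "\<bar>x - t\<bar> < d" for x
    proof (rule tendsto_upperbound)
      show "(\<lambda>n. norm (q x - q (s n))) \<longlonglongrightarrow> norm (q x - D)" by (intro tendsto_intros D)
      from slim d obtain N where "\<And>n. n \<ge> N \<Longrightarrow> \<bar>s n - t\<bar> < d"
        unfolding LIMSEQ_iff by (metis real_norm_def)
      then show "\<forall>\<^sub>F n in sequentially. norm (q x - q (s n)) \<le> e/2"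
        using dd x st unfolding eventually_sequentially by blast
    qed simp
    then show "\<forall>\<^sub>F x in at t. dist (q x) D < e"
      unfolding eventually_at using d \<open>e > 0\<close> by (intro exI[of _ d]) (force simp: dist_norm)
  qed
  then show ?thesis unfolding q_def has_vector_derivative_iff_quotient_tendsto[symmetric] by blast
qed

text \<open>Closed intervals are stored as pairs of centre and radius, the form in which the Vitali
  covering theorem selects them.\<close>

abbreviation disjoint_balls_in :: "real set \<Rightarrow> (real \<times> real) set \<Rightarrow> bool" where
  "disjoint_balls_in S C \<equiv> finite C \<and> (\<forall>(x,r)\<in>C. 0 < r \<and> cball x r \<subseteq> S) \<and>
     pairwise (\<lambda>i j. disjnt (cball (fst i) (snd i)) (cball (fst j) (snd j))) C"

text \<open>Subtracting a differentiable \<open>g\<close> leaves the oscillation of the difference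
  quotients near a point unchanged up to a vanishing error, but makes the variation small. Where the
  oscillation stays large, arbitrarily short intervals carry an increment of \<open>w - g\<close>
  above a fixed multiple of their length. Disjoint ones cover almost all such points, and the
  variation bound limits their total length.\<close>

lemma negligible_not_differentiable:
  fixes w :: "real \<Rightarrow> complex"
  assumes approx: "\<And>e. e > 0 \<Longrightarrow> \<exists>g. (\<forall>t. \<exists>D. (g has_vector_derivative D) (at t)) \<and>
     (\<forall>C. disjoint_balls_in {a<..<b} C \<longrightarrow>
        (\<Sum>(x,r)\<in>C. norm ((w (x + r) - g (x + r)) - (w (x - r) - g (x - r)))) \<le> e)"
  shows "negligible {t \<in> {a<..<b}. \<nexists>D. (w has_vector_derivative D) (at t)}"
proof -
  define q where "q w t x = (w x - w t) /\<^sub>R (x - t)" for w :: "real \<Rightarrow> complex" and t x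
  \<comment> \<open>Of the gap \<open>3 * \<epsilon>\<close> the quotients of \<open>g\<close> can
    account for \<open>\<epsilon>\<close>; the remaining \<open>2 * \<epsilon>\<close> force one of
    the two quotients of \<open>w - g\<close> above \<open>\<epsilon>\<close>.\<close>
  define Z where "Z \<epsilon> = {t \<in> {a<..<b}. \<forall>d>0. \<exists>x y. x \<noteq> t \<and> y \<noteq> t \<and> \<bar>x - t\<bar> < d \<and> \<bar>y - t\<bar> < d \<and>
         norm (q w t x - q w t y) > 3 * \<epsilon>}" for \<epsilon> :: real
  have Z: "negligible (Z \<epsilon>)" if \<epsilon>: "\<epsilon> > 0" for \<epsilon>
    unfolding negligible_outer_le
  proof (intro allI impI)
    fix e :: real assume e: "e > 0"
    obtain g where gd: "\<And>t. \<exists>D. (g has_vector_derivative D) (at t)" and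
      var: "\<And>C. disjoint_balls_in {a<..<b} C \<Longrightarrow>
        (\<Sum>(x,r)\<in>C. norm ((w (x + r) - g (x + r)) - (w (x - r) - g (x - r)))) \<le> e * \<epsilon>"
      using approx[of "e * \<epsilon>"] e \<epsilon> by auto
    define K where "K = {(x,r). 0 < r \<and> cball x r \<subseteq> {a<..<b} \<and>
        norm ((w (x + r) - g (x + r)) - (w (x - r) - g (x - r))) > \<epsilon> * (2 * r)}"
    obtain C where C: "countable C" "C \<subseteq> K"
      "pairwise (\<lambda>i j. disjnt (cball (fst i) (snd i)) (cball (fst j) (snd j))) C"
      "negligible (Z \<epsilon> - (\<Union>i\<in>C. cball (fst i) (snd i)))"
    proof (rule Vitali_covering_theorem_cballs[of K snd "Z \<epsilon>" fst])
      show "0 < snd i" if "i \<in> K" for i using that by (auto simp: K_def)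
      fix t d :: real assume t: "t \<in> Z \<epsilon>" and d: "0 < d"
      obtain D where D: "(g has_vector_derivative D) (at t)" using gd by blast
      have "(q g t \<longlongrightarrow> D) (at t)"
        using D unfolding q_def has_vector_derivative_iff_quotient_tendsto .
      then have "\<forall>\<^sub>F x in at t. dist (q g t x) D < \<epsilon>/2" using \<epsilon> by (intro tendstoD) auto
      then obtain d1 where d1: "d1 > 0" "\<And>x. \<lbrakk>x \<noteq> t; \<bar>x - t\<bar> < d1\<rbrakk> \<Longrightarrow> norm (q g t x - D) < \<epsilon>/2"
        unfolding eventually_at dist_norm by auto
      define d' where "d' = min (min d d1) (min (t - a) (b - t))"
      have "d' > 0" using d d1 t by (auto simp: d'_def Z_def)
      then obtain x y where xy: "x \<noteq> t" "y \<noteq> t" "\<bar>x - t\<bar> < d'" "\<bar>y - t\<bar> < d'" "norm (q w t x - q w t y) > 3 * \<epsilon>"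
        using t unfolding Z_def by blast
      define f where "f x = w x - g x" for x
      have qf: "q f t x = q w t x - q g t x" for x by (simp add: q_def f_def algebra_simps)
      have "norm (q g t x - D) < \<epsilon>/2" "norm (q g t y - D) < \<epsilon>/2" using d1 xy by (auto simp: d'_def)
      then have "norm (q g t x - q g t y) < \<epsilon>" using norm_triangle_ineq4[of "q g t x - D" "q g t y - D"] by simp
      then have "norm (q f t x - q f t y) > 2 * \<epsilon>"
        using xy(5) norm_triangle_ineq[of "q f t x - q f t y" "q g t x - q g t y"] by (simp add: qf algebra_simps)
      then have "norm (q f t x) > \<epsilon> \<or> norm (q f t y) > \<epsilon>"
        using norm_triangle_ineq4[of "q f t x" "q f t y"] by linarith
      then obtain u where u: "u \<noteq> t" "\<bar>u - t\<bar> < d'" "norm (q f t u) > \<epsilon>" using xy by blast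
      have n: "norm (f u - f t) > \<epsilon> * \<bar>u - t\<bar>"
        using u by (simp add: q_def pos_less_divide_eq[symmetric] divide_inverse mult.commute)
      \<comment> \<open>The interval between \<open>t\<close> and \<open>u\<close>, in either order,
        written as a ball. It contains \<open>t\<close> as an endpoint.\<close>
      define c where "c = (u + t) / 2"
      define r where "r = \<bar>u - t\<bar> / 2"
      have cr: "(c + r = u \<and> c - r = t) \<or> (c + r = t \<and> c - r = u)"
        by (auto simp: c_def r_def field_simps abs_if)
      have r: "0 < r" "r < d" using u by (auto simp: r_def d'_def)
      have "norm (f (c + r) - f (c - r)) > \<epsilon> * (2 * r)"
        using cr n by (auto simp: r_def norm_minus_commute)
      moreover have "cball c r \<subseteq> {a<..<b}"
        using cr u by (auto simp: cball_eq_atLeastAtMost d'_def)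
      ultimately have "(c, r) \<in> K" using r by (simp add: K_def f_def)
      moreover have "t \<in> cball c r" using cr r by (auto simp: cball_eq_atLeastAtMost)
      ultimately show "\<exists>i. i \<in> K \<and> t \<in> cball (fst i) (snd i) \<and> snd i < d"
        using r by (intro exI[of _ "(c, r)"]) auto
    qed
    define T where "T = (\<Union>i\<in>C. cball (fst i) (snd i))"
    have b: "measure lebesgue (\<Union>i\<in>F. cball (fst i) (snd i)) \<le> e" if F: "F \<subseteq> C" "finite F" for F
    proof -
      have "measure lebesgue (\<Union>i\<in>F. cball (fst i) (snd i)) \<le> (\<Sum>i\<in>F. measure lebesgue (cball (fst i) (snd i)))"
        by (rule measure_UNION_le) (use F in auto)
      also have "\<dots> = (\<Sum>i\<in>F. 2 * snd i)"
        using F C(2) by (intro sum.cong) (auto simp: cball_eq_atLeastAtMost K_def)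
      also have "\<dots> \<le> (\<Sum>(x,r)\<in>F. norm ((w (x + r) - g (x + r)) - (w (x - r) - g (x - r))) / \<epsilon>)"
      proof (intro sum_mono)
        fix i assume "i \<in> F"
        then have "i \<in> K" using F C(2) by blast
        then show "2 * snd i \<le> (case i of (x, r) \<Rightarrow> norm ((w (x + r) - g (x + r)) - (w (x - r) - g (x - r))) / \<epsilon>)"
          using \<epsilon> by (auto simp: K_def pos_le_divide_eq mult.commute)
      qed
      also have "\<dots> = (\<Sum>(x,r)\<in>F. norm ((w (x + r) - g (x + r)) - (w (x - r) - g (x - r)))) / \<epsilon>"
        by (simp add: sum_divide_distrib case_prod_beta)
      also have "\<dots> \<le> e * \<epsilon> / \<epsilon>"
      proof (intro divide_right_mono var conjI)
        have "F \<subseteq> K" using F C(2) by blast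
        then show "\<forall>(x, r)\<in>F. 0 < r \<and> cball x r \<subseteq> {a<..<b}" unfolding K_def by blast
      qed (use F C \<epsilon> in \<open>auto intro: pairwise_subset\<close>)
      finally show ?thesis using \<epsilon> by simp
    qed
    have T: "T \<in> lmeasurable" "measure lebesgue T \<le> e"
      unfolding T_def
      using fmeasurable_UN_bound[OF C(1) _ b] measure_UN_bound[OF C(1) _ b] by (auto simp: lmeasurable_cball)
    have N: "Z \<epsilon> - T \<in> lmeasurable" "measure lebesgue (Z \<epsilon> - T) = 0"
      using C(4) by (auto simp: T_def negligible_iff_measure)
    show "\<exists>T. Z \<epsilon> \<subseteq> T \<and> T \<in> lmeasurable \<and> measure lebesgue T \<le> e"
    proof (intro exI conjI)
      show "Z \<epsilon> \<subseteq> (Z \<epsilon> - T) \<union> T" by auto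
      show "(Z \<epsilon> - T) \<union> T \<in> lmeasurable" using N T by (intro fmeasurable.Un)
      show "measure lebesgue ((Z \<epsilon> - T) \<union> T) \<le> e"
        using measure_Un_le[of "Z \<epsilon> - T" lebesgue T] N T by (auto simp: fmeasurableD)
    qed
  qed
  have "{t \<in> {a<..<b}. \<nexists>D. (w has_vector_derivative D) (at t)} \<subseteq> (\<Union>n. Z (inverse (real (Suc n))))"
  proof (rule subsetI, rule ccontr)
    fix t assume t: "t \<in> {t \<in> {a<..<b}. \<nexists>D. (w has_vector_derivative D) (at t)}"
      and nt: "t \<notin> (\<Union>n. Z (inverse (real (Suc n))))"
    have "\<exists>D. (w has_vector_derivative D) (at t)"
    proof (rule differentiable_if_quotients_Cauchy)
      fix e :: real assume "e > 0"
      then obtain n where n: "inverse (real (Suc n)) < e / 3" using reals_Archimedean[of "e/3"] by auto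
      have "t \<notin> Z (inverse (real (Suc n)))" using nt by blast
      then obtain d :: real where "d > 0" "\<forall>x y. x \<noteq> t \<and> y \<noteq> t \<and> \<bar>x - t\<bar> < d \<and> \<bar>y - t\<bar> < d \<longrightarrow> norm (q w t x - q w t y) \<le> 3 * inverse (real (Suc n))"
        using t unfolding Z_def mem_Collect_eq not_all not_imp not_ex not_less[symmetric] by blast
      moreover have "3 * inverse (real (Suc n)) \<le> e" using n by linarith
      ultimately show "\<exists>d>0. \<forall>x y. x \<noteq> t \<and> y \<noteq> t \<and> \<bar>x - t\<bar> < d \<and> \<bar>y - t\<bar> < d \<longrightarrow>
             norm ((w x - w t) /\<^sub>R (x - t) - (w y - w t) /\<^sub>R (y - t)) \<le> e"
        unfolding q_def by (meson order_trans)
    qed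
    then show False using t by blast
  qed
  moreover have "negligible (\<Union>n. Z (inverse (real (Suc n))))"
    by (intro negligible_Union_nat Z) simp
  ultimately show ?thesis by (rule negligible_subset[rotated])
qed

section \<open>Means and variation of trigonometric sums\<close>

lemma trig_mean_abs_le:
  fixes c :: "nat \<Rightarrow> complex"
  assumes A: "finite A" and l: "l > 0" and s: "(\<Sum>n\<in>A. (norm (c n))\<^sup>2) \<le> l\<^sup>2"
  shows "integral {0..2*pi} (\<lambda>t. norm (\<Sum>n\<in>A. c n * cis (real n * t))) \<le> 2 * pi * l"
proof -
  define u where "u t = norm (\<Sum>n\<in>A. c n * cis (real n * t))" for t
  have ucont: "continuous_on {0..2*pi} u" unfolding u_def by (intro continuous_intros)
  have i2: "((\<lambda>t. (u t)\<^sup>2) has_integral (2 * pi * (\<Sum>n\<in>A. (norm (c n))\<^sup>2))) {0..2*pi}"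
    unfolding u_def by (rule trig_parseval[OF A])
  \<comment> \<open>The arithmetic-geometric mean inequality with weight \<open>l\<close> stands in
    for Cauchy-Schwarz; the integral of its right side comes from Parseval.\<close>
  have "u t \<le> (l + (u t)\<^sup>2 / l) / 2" for t
  proof -
    have "0 \<le> (u t - l)\<^sup>2" by simp
    then have "2 * l * u t \<le> l\<^sup>2 + (u t)\<^sup>2" by (simp add: power2_eq_square algebra_simps)
    then show ?thesis using l by (simp add: field_simps power2_eq_square)
  qed
  moreover have "((\<lambda>t. (l + (u t)\<^sup>2 / l) / 2) has_integral ((2 * pi * l + (2 * pi * (\<Sum>n\<in>A. (norm (c n))\<^sup>2)) / l) / 2)) {0..2*pi}"
    using has_integral_const_real[of l 0 "2*pi"]
    by (intro has_integral_divide has_integral_add i2) simp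
  ultimately have "integral {0..2*pi} u \<le> (2 * pi * l + (2 * pi * (\<Sum>n\<in>A. (norm (c n))\<^sup>2)) / l) / 2"
    using has_integral_le[OF integrable_integral[OF integrable_continuous_real[OF ucont]]] by blast
  also have "\<dots> \<le> (2 * pi * l + (2 * pi * l\<^sup>2) / l) / 2"
    using s l by (intro divide_right_mono add_left_mono mult_left_mono) auto
  also have "\<dots> = 2 * pi * l" using l by (simp add: power2_eq_square)
  finally show ?thesis by (simp add: u_def [abs_def])
qed

text \<open>Increments are integrals of the derivative, and over disjoint intervals these add up to
  at most the integral of its modulus over the whole circle.\<close>

lemma trig_sum_variation_le:
  fixes c :: "nat \<Rightarrow> complex"
  assumes A: "finite A" and l: "l > 0" and s: "(\<Sum>n\<in>A. (norm (c n))\<^sup>2) \<le> l\<^sup>2"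
    and deriv: "\<And>t. (f has_vector_derivative (\<Sum>n\<in>A. c n * cis (real n * t))) (at t)"
    and disj: "disjoint_balls_in {0<..<2*pi} C"
  shows "(\<Sum>(x,r)\<in>C. norm (f (x + r) - f (x - r))) \<le> 2 * pi * l"
proof -
  have C: "finite C" "\<forall>(x,r)\<in>C. 0 < r \<and> cball x r \<subseteq> {0<..<2*pi}"
    "pairwise (\<lambda>i j. disjnt (cball (fst i) (snd i)) (cball (fst j) (snd j))) C" using disj by auto
  define u where "u t = (\<Sum>n\<in>A. c n * cis (real n * t))" for t
  have uc: "continuous_on S u" for S unfolding u_def by (intro continuous_intros)
  have uc': "continuous_on S (\<lambda>t. norm (u t))" for S by (intro continuous_intros uc)
  have "norm (f (x + r) - f (x - r)) \<le> integral (cball x r) (\<lambda>t. norm (u t))" if "(x, r) \<in> C" for x r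
  proof -
    have r: "r > 0" using C that by auto
    have "(u has_integral (f (x + r) - f (x - r))) {x - r..x + r}"
      using r deriv by (intro fundamental_theorem_of_calculus) (auto simp: u_def has_vector_derivative_at_within)
    then have "f (x + r) - f (x - r) = integral {x - r..x + r} u" by (simp add: integral_unique)
    also have "norm \<dots> \<le> integral {x - r..x + r} (\<lambda>t. norm (u t))"
      by (intro integral_norm_bound_integral integrable_continuous_real uc uc') auto
    finally show ?thesis by (simp add: cball_eq_atLeastAtMost)
  qed
  then have "(\<Sum>(x,r)\<in>C. norm (f (x + r) - f (x - r))) \<le> (\<Sum>i\<in>C. integral (cball (fst i) (snd i)) (\<lambda>t. norm (u t)))"
    by (intro sum_mono) (auto simp: case_prod_beta)
  also have "((\<lambda>t. norm (u t)) has_integral (\<Sum>i\<in>C. integral (cball (fst i) (snd i)) (\<lambda>t. norm (u t)))) (\<Union>i\<in>C. cball (fst i) (snd i))"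
  proof (rule has_integral_UN[OF C(1)])
    show "((\<lambda>t. norm (u t)) has_integral integral (cball (fst i) (snd i)) (\<lambda>t. norm (u t))) (cball (fst i) (snd i))" for i
      by (intro integrable_integral) (auto simp: cball_eq_atLeastAtMost intro!: integrable_continuous_real uc')
    show "pairwise (\<lambda>i i'. negligible (cball (fst i) (snd i) \<inter> cball (fst i') (snd i'))) C"
      using C(3) by (rule pairwise_mono) (auto simp: disjnt_def)
  qed
  then have "(\<Sum>i\<in>C. integral (cball (fst i) (snd i)) (\<lambda>t. norm (u t))) \<le> integral {0..2*pi} (\<lambda>t. norm (u t))"
  proof (rule has_integral_subset_le[rotated])
    show "((\<lambda>t. norm (u t)) has_integral integral {0..2*pi} (\<lambda>t. norm (u t))) {0..2*pi}"
      by (intro integrable_integral integrable_continuous_real uc')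
    show "(\<Union>i\<in>C. cball (fst i) (snd i)) \<subseteq> {0..2*pi}"
      using C(2) by (force simp: case_prod_beta)
  qed auto
  also have "\<dots> \<le> 2 * pi * l" unfolding u_def by (rule trig_mean_abs_le[OF A l s])
  finally show ?thesis .
qed

text \<open>The primitive \<open>W\<close> has absolutely summable coefficients, so it is continuous
  up to the circle, and its partial sums serve as the differentiable approximants. The derivative of
  a tail along the circle has the coefficients of \<open>f\<close>, shifted by one and times
  \<open>\<i>\<close>, so its mean square is a tail of the given series.\<close>

theorem fatou_radial_limit:
  fixes f :: "complex \<Rightarrow> complex"
  assumes a: "summable (\<lambda>n. (norm (a n))\<^sup>2)"
    and f: "\<And>z. norm z < 1 \<Longrightarrow> (\<lambda>n. a n * z ^ n) sums f z"
  shows "AE t in lebesgue_on {0..2*pi}. \<exists>w. ((\<lambda>r. f (of_real r * cis t)) \<longlongrightarrow> w) (at_left 1)"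
proof -
  define c where "c n = (case n of 0 \<Rightarrow> 0 | Suc k \<Rightarrow> a k / of_nat (Suc k))" for n
  have c0: "c 0 = 0" and cS: "c (Suc k) = a k / of_nat (Suc k)" for k by (simp_all add: c_def)
  have sc: "summable (\<lambda>n. norm (c n))"
  proof (subst summable_Suc_iff[symmetric], rule summable_comparison_test')
    have "summable (\<lambda>n. inverse (real (Suc n) ^ 2))"
      using inverse_power_summable[of 2, where 'a=real] by (subst summable_Suc_iff) auto
    then show "summable (\<lambda>n. (norm (a n))\<^sup>2 + inverse (real (Suc n) ^ 2))" using a by (rule summable_add[rotated])
    show "norm (norm (c (Suc n))) \<le> (norm (a n))\<^sup>2 + inverse (real (Suc n) ^ 2)" for n
    proof -
      define x y where "x = norm (a n)" and "y = inverse (real (Suc n))"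
      have "0 \<le> x" "0 \<le> y" by (auto simp: x_def y_def)
      moreover have "2 * (x * y) \<le> x\<^sup>2 + y\<^sup>2" using sum_squares_bound[of x y] by simp
      ultimately have "x * y \<le> x\<^sup>2 + y\<^sup>2" using mult_nonneg_nonneg[of x y] by linarith
      moreover have "norm (norm (c (Suc n))) = x * y"
        by (simp add: cS norm_mult norm_inverse norm_of_nat x_def y_def divide_inverse del: of_nat_Suc)
      ultimately show ?thesis by (simp add: x_def y_def power_inverse del: of_nat_Suc)
    qed
  qed
  define W where "W z = (\<Sum>n. c n * z ^ n)" for z
  have Wsum: "(\<lambda>n. c n * z ^ n) sums W z" if "norm z \<le> 1" for z
    unfolding W_def
  proof (intro summable_sums summable_comparison_test'[OF sc])
    show "norm (c n * z ^ n) \<le> norm (c n)" for n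
      using that by (simp add: norm_mult norm_power mult_left_le power_le_one)
  qed
  have Wcont: "continuous_on (cball 0 1) W"
  proof (rule uniform_limit_theorem)
    show "uniform_limit (cball 0 1) (\<lambda>n z. \<Sum>i<n. c i * z ^ i) W sequentially"
      unfolding W_def
      by (rule Weierstrass_m_test[OF _ sc]) (simp add: norm_mult norm_power mult_left_le power_le_one)
  qed (auto intro!: always_eventually continuous_intros)
  have Wder: "(W has_field_derivative f z) (at z)" if "norm z < 1" for z
  proof -
    have "(W has_field_derivative (\<Sum>n. diffs c n * z ^ n)) (at z)"
      unfolding W_def using Wsum that by (intro termdiffs_strong'[of 1]) (auto simp: sums_iff)
    moreover have "diffs c = a" by (rule ext) (simp add: diffs_def cS del: of_nat_Suc)
    ultimately show ?thesis using f[OF that] by (simp add: sums_iff)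
  qed
  have Wholo: "W holomorphic_on ball 0 1"
    using Wder by (auto simp: holomorphic_on_open) blast
  define g where "g N t = (\<Sum>n<N. c n * cis (real n * t))" for N t
  define u where "u A t = (\<Sum>n\<in>A. (\<i> * of_nat n * c n) * cis (real n * t))" for A t
  have cpow: "cis t ^ n = cis (real n * t)" for t n by (rule Complex.DeMoivre)
  have gder: "((\<lambda>t. g M t - g N t) has_vector_derivative u {N..<M} t) (at t)" if "N \<le> M" for N M t
  proof -
    have "g M t - g N t = (\<Sum>n\<in>{N..<M}. c n * cis (real n * t))" for t
      using sum_diff_nat_ivl[of 0 N M "\<lambda>n. c n * cis (real n * t)"] that by (simp add: g_def lessThan_atLeast0)
    moreover have "((\<lambda>t. cis (real n * t)) has_vector_derivative (\<i> * of_nat n * cis (real n * t))) (at t)" for n t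
    proof -
      have "((\<lambda>t. exp (\<i> * of_real (real n * t))) has_vector_derivative \<i> * of_nat n * exp (\<i> * of_real (real n * t))) (at t)"
        by (auto intro!: derivative_eq_intros has_vector_derivative_real_field)
      then show ?thesis by (simp add: cis_conv_exp)
    qed
    then have "((\<lambda>t. \<Sum>n\<in>{N..<M}. c n * cis (real n * t)) has_vector_derivative (\<Sum>n\<in>{N..<M}. c n * (\<i> * of_nat n * cis (real n * t)))) (at t)"
      by (intro has_vector_derivative_sum has_vector_derivative_mult_right)
    ultimately show ?thesis by (simp add: u_def ac_simps)
  qed
  have "negligible {t \<in> {0<..<2*pi}. \<nexists>D. ((\<lambda>t. W (cis t)) has_vector_derivative D) (at t)}"
  proof (rule negligible_not_differentiable)
    fix e :: real assume e: "e > 0"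
    \<comment> \<open>Makes the variation bound \<open>2 * pi * l\<close> equal to
      \<open>e\<close>.\<close>
    define l where "l = e / (2 * pi)"
    have l: "l > 0" using e by (simp add: l_def)
    define b where "b n = (norm (\<i> * of_nat n * c n))\<^sup>2" for n
    have b: "summable b"
    proof (subst summable_Suc_iff[symmetric])
      have "b (Suc n) = (norm (a n))\<^sup>2" for n by (simp add: b_def cS norm_mult norm_divide del: of_nat_Suc)
      then show "summable (\<lambda>n. b (Suc n))" using a by simp
    qed
    then obtain N where N: "\<And>m n. m \<ge> N \<Longrightarrow> norm (sum b {m..<n}) < l\<^sup>2"
      unfolding summable_Cauchy using l by (metis zero_less_power)
    show "\<exists>g. (\<forall>t. \<exists>D. (g has_vector_derivative D) (at t)) \<and>
     (\<forall>C. disjoint_balls_in {0<..<2*pi} C \<longrightarrow>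
        (\<Sum>(x,r)\<in>C. norm ((W (cis (x + r)) - g (x + r)) - (W (cis (x - r)) - g (x - r)))) \<le> e)"
    proof (intro exI[of _ "g N"] conjI allI impI)
      fix t
      show "\<exists>D. (g N has_vector_derivative D) (at t)"
        using gder[of 0 N t] by (auto simp: g_def [abs_def])
    next
      fix C :: "(real \<times> real) set" 
      assume C: "disjoint_balls_in {0<..<2*pi} C"
      have glim: "(\<lambda>M. g M t) \<longlonglongrightarrow> W (cis t)" for t
        using Wsum[of "cis t"] by (simp add: sums_def g_def cpow)
      show "(\<Sum>(x,r)\<in>C. norm ((W (cis (x + r)) - g N (x + r)) - (W (cis (x - r)) - g N (x - r)))) \<le> e"
      \<comment> \<open>The variation of \<open>g M - g N\<close> is bounded uniformly in
        \<open>M\<close>, and for a finite family of intervals the bound survives the limit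
        \<open>M\<close> to infinity, whether or not \<open>W\<close> is differentiable along the
        circle.\<close>
      proof (rule tendsto_upperbound)
        show "(\<lambda>M. \<Sum>(x,r)\<in>C. norm ((g M (x + r) - g N (x + r)) - (g M (x - r) - g N (x - r)))) \<longlonglongrightarrow>
           (\<Sum>(x,r)\<in>C. norm ((W (cis (x + r)) - g N (x + r)) - (W (cis (x - r)) - g N (x - r))))"
          unfolding case_prod_beta by (intro tendsto_intros glim)
        have "(\<Sum>(x,r)\<in>C. norm ((g M (x + r) - g N (x + r)) - (g M (x - r) - g N (x - r)))) \<le> 2 * pi * l" if "M \<ge> N" for M
        proof (rule trig_sum_variation_le)
          show "(\<Sum>n\<in>{N..<M}. (norm (\<i> * of_nat n * c n))\<^sup>2) \<le> l\<^sup>2"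
            using N[of N M] by (simp add: b_def)
          show "((\<lambda>t. g M t - g N t) has_vector_derivative (\<Sum>n\<in>{N..<M}. (\<i> * of_nat n * c n) * cis (real n * t))) (at t)" for t
            using gder[OF that, of t] by (simp add: u_def)
        qed (use C l in auto)
        then show "\<forall>\<^sub>F M in sequentially. (\<Sum>(x,r)\<in>C. norm ((g M (x + r) - g N (x + r)) - (g M (x - r) - g N (x - r)))) \<le> e"
          unfolding eventually_sequentially by (auto simp: l_def)
      qed simp
    qed
  qed
  moreover have "negligible {0, 2*pi}" by (intro negligible_finite) auto
  ultimately have "negligible ({t \<in> {0<..<2*pi}. \<nexists>D. ((\<lambda>t. W (cis t)) has_vector_derivative D) (at t)} \<union> {0, 2*pi})"
    by (rule negligible_Un)
  then have "AE t in lebesgue. t \<notin> {t \<in> {0<..<2*pi}. \<nexists>D. ((\<lambda>t. W (cis t)) has_vector_derivative D) (at t)} \<union> {0, 2*pi}"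
    unfolding negligible_iff_null_sets by (rule AE_not_in)
  then have "AE t in lebesgue. t \<in> {0..2*pi} \<longrightarrow> (\<exists>w. ((\<lambda>r. f (of_real r * cis t)) \<longlongrightarrow> w) (at_left 1))"
  proof (rule AE_mp, intro AE_I2 impI)
    fix t :: real
    assume "t \<notin> {t \<in> {0<..<2*pi}. \<nexists>D. ((\<lambda>t. W (cis t)) has_vector_derivative D) (at t)} \<union> {0, 2*pi}" "t \<in> {0..2*pi}"
    then obtain D where D: "((\<lambda>t. W (cis t)) has_vector_derivative D) (at t)" by auto
    have "((\<lambda>r. deriv W (of_real r * cis t)) \<longlongrightarrow> D / (\<i> * cis t)) (at_left 1)"
      by (rule radial_derivative_limit[OF Wcont Wholo D])
    moreover have "\<forall>\<^sub>F r in at_left 1. deriv W (of_real r * cis t) = f (of_real r * cis t)"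
      unfolding eventually_at_left_field
      by (intro exI[of _ 0]) (auto intro!: DERIV_imp_deriv Wder simp: norm_mult)
    ultimately have "((\<lambda>r. f (of_real r * cis t)) \<longlongrightarrow> D / (\<i> * cis t)) (at_left 1)"
      by (rule Lim_transform_eventually)
    then show "\<exists>w. ((\<lambda>r. f (of_real r * cis t)) \<longlongrightarrow> w) (at_left 1)" by blast
  qed
  then show ?thesis by (subst AE_restrict_space_iff) auto
qed

section \<open>The Hardy space as a real Hilbert space\<close>

lemma orthogonal_projection_exists:
  fixes M :: "'a::{real_inner,complete_space} set"
  assumes sub: "subspace M" and cl: "closed M"
  obtains p where "p \<in> M" "\<And>y. y \<in> M \<Longrightarrow> inner (x - p) y = 0"
proof -
  define d where "d = (INF y\<in>M. (norm (x - y))\<^sup>2)"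
  have bdd: "bdd_below ((\<lambda>y. (norm (x - y))\<^sup>2) ` M)" by (auto intro!: bdd_belowI[of _ 0])
  have ne: "M \<noteq> {}" using subspace_0[OF sub] by blast
  have dle: "d \<le> (norm (x - y))\<^sup>2" if "y \<in> M" for y
    unfolding d_def using bdd that by (rule cINF_lower)
  have "\<exists>y\<in>M. (norm (x - y))\<^sup>2 < d + inverse (real (Suc n))" for n
  proof -
    have "d < d + inverse (real (Suc n))" by simp
    then show ?thesis unfolding d_def using cINF_less_iff[OF ne bdd] by blast
  qed
  then obtain Y where Y: "\<And>n. Y n \<in> M" "\<And>n. (norm (x - Y n))\<^sup>2 < d + inverse (real (Suc n))" by metis
  \<comment> \<open>Parallelogram law: the midpoint of two almost minimisers lies in
    \<open>M\<close>, so its squared distance cannot fall below \<open>d\<close>.\<close>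
  have par: "(norm (Y m - Y n))\<^sup>2 \<le> 2 * inverse (real (Suc m)) + 2 * inverse (real (Suc n))" for m n
  proof -
    have "(1/2) *\<^sub>R (Y m + Y n) \<in> M" using Y sub by (intro subspace_scale subspace_add)
    from dle[OF this] have "4 * d \<le> (norm (2 *\<^sub>R x - (Y m + Y n)))\<^sup>2"
    proof -
      have "2 *\<^sub>R x - (Y m + Y n) = 2 *\<^sub>R (x - (1/2) *\<^sub>R (Y m + Y n))" by (simp add: algebra_simps)
      then have "(norm (2 *\<^sub>R x - (Y m + Y n)))\<^sup>2 = 4 * (norm (x - (1/2) *\<^sub>R (Y m + Y n)))\<^sup>2"
        by (simp only: norm_scaleR power_mult_distrib) simp
      then show ?thesis using dle[OF \<open>(1/2) *\<^sub>R (Y m + Y n) \<in> M\<close>] by simp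
    qed
    moreover have "(norm (Y m - Y n))\<^sup>2 + (norm (2 *\<^sub>R x - (Y m + Y n)))\<^sup>2 = 2 * (norm (x - Y m))\<^sup>2 + 2 * (norm (x - Y n))\<^sup>2"
      unfolding power2_norm_eq_inner inner_diff_left inner_diff_right inner_add_left inner_add_right
        inner_scaleR_left inner_scaleR_right
      using inner_commute[of x "Y m"] inner_commute[of x "Y n"] inner_commute[of "Y m" "Y n"] by simp
    ultimately show ?thesis using Y(2)[of m] Y(2)[of n] by linarith
  qed
  have "Cauchy Y"
  proof (rule metric_CauchyI)
    fix e :: real assume e: "e > 0"
    then obtain N where N: "inverse (real (Suc N)) < e\<^sup>2 / 4" using reals_Archimedean[of "e\<^sup>2/4"] by auto
    show "\<exists>M. \<forall>m\<ge>M. \<forall>n\<ge>M. dist (Y m) (Y n) < e"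
    proof (intro exI[of _ N] allI impI)
      fix m n assume mn: "N \<le> m" "N \<le> n"
      have "inverse (real (Suc m)) \<le> inverse (real (Suc N))" "inverse (real (Suc n)) \<le> inverse (real (Suc N))"
        using mn by (auto intro!: le_imp_inverse_le)
      then have "(norm (Y m - Y n))\<^sup>2 < e\<^sup>2" using par[of m n] N by linarith
      then show "dist (Y m) (Y n) < e" using e by (simp add: dist_norm power2_less_imp_less)
    qed
  qed
  then obtain p where p: "Y \<longlonglongrightarrow> p" using Cauchy_convergent convergent_def by blast
  have pM: "p \<in> M" using cl Y(1) p by (metis closed_sequential_limits)
  have "(norm (x - p))\<^sup>2 \<le> d"
  proof (rule LIMSEQ_le)
    show "(\<lambda>n. (norm (x - Y n))\<^sup>2) \<longlonglongrightarrow> (norm (x - p))\<^sup>2" by (intro tendsto_intros p)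
    show "(\<lambda>n. d + inverse (real (Suc n))) \<longlonglongrightarrow> d"
      using tendsto_add[OF tendsto_const LIMSEQ_inverse_real_of_nat] by simp
  qed (use Y(2) less_imp_le in blast)
  then have dp: "(norm (x - p))\<^sup>2 \<le> (norm (x - y))\<^sup>2" if "y \<in> M" for y using dle[OF that] by linarith
  have "inner (x - p) y = 0" if y: "y \<in> M" for y
  proof (cases "y = 0")
    case False
    \<comment> \<open>Minimises the squared distance from \<open>x\<close> to \<open>p + t y\<close>
      over real \<open>t\<close>; a nonzero inner product would beat the minimum.\<close>
    define t where "t = inner (x - p) y / inner y y"
    have yy: "inner y y > 0" using False by simp
    have "p + t *\<^sub>R y \<in> M" using pM y sub by (intro subspace_add subspace_scale)
    from dp[OF this] have "inner (x - p) (x - p) \<le> inner (x - p - t *\<^sub>R y) (x - p - t *\<^sub>R y)"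
      by (simp add: power2_norm_eq_inner diff_diff_eq)
    also have "\<dots> = inner (x - p) (x - p) - 2 * t * inner (x - p) y + t * t * inner y y"
      by (simp only: inner_diff_left inner_diff_right inner_scaleR_left inner_scaleR_right)
         (simp add: inner_commute algebra_simps)
    also have "\<dots> = inner (x - p) (x - p) - (inner (x - p) y)\<^sup>2 / inner y y"
      using yy by (simp add: t_def power2_eq_square)
    finally have "(inner (x - p) y)\<^sup>2 / inner y y \<le> 0" by linarith
    then show ?thesis using yy by (simp add: divide_le_0_iff)
  qed simp
  with pM that show thesis by blast
qed

section \<open>Taylor coefficients, and the Hardy space as a type\<close>

lemma tcoeff_eqI:
  assumes "\<And>z. z \<in> disc \<Longrightarrow> (\<lambda>n. a n * z ^ n) sums f z"
  shows "tcoeff f n = a n"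
proof -
  have "f has_fps_expansion Abs_fps a"
  proof (rule has_fps_expansionI)
    have "\<forall>\<^sub>F u in nhds 0. u \<in> disc" by (intro eventually_nhds_in_open) auto
    then show "\<forall>\<^sub>F u in nhds 0. (\<lambda>n. fps_nth (Abs_fps a) n * u ^ n) sums f u"
      by eventually_elim (use assms in auto)
  qed
  from fps_nth_fps_expansion[OF this, of n] show ?thesis by (simp add: tcoeff_def)
qed

lemma tcoeff_sums:
  assumes "f holomorphic_on disc" "z \<in> disc"
  shows "(\<lambda>n. tcoeff f n * z ^ n) sums f z"
  using holomorphic_power_series[OF assms] by (simp add: tcoeff_def)

lemma tcoeff_cong:
  assumes "f holomorphic_on disc" "\<And>z. z \<in> disc \<Longrightarrow> f z = g z"
  shows "tcoeff f n = tcoeff g n"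
proof (rule sym, rule tcoeff_eqI)
  fix z :: complex assume "z \<in> disc"
  then show "(\<lambda>n. tcoeff f n * z ^ n) sums g z"
    using tcoeff_sums[OF assms(1)] assms(2) by fastforce
qed

lemma square_summable_power_series:
  fixes a :: "nat \<Rightarrow> complex"
  assumes "summable (\<lambda>n. (norm (a n))\<^sup>2)" "norm z < 1"
  shows "summable (\<lambda>n. a n * z ^ n)"
proof (rule summable_comparison_test')
  have "summable (\<lambda>n. (norm z ^ 2) ^ n)"
    using assms(2) by (intro summable_geometric) (simp add: power_less_one_iff)
  then show "summable (\<lambda>n. (norm (a n))\<^sup>2 + (norm z ^ n)\<^sup>2)"
    using assms(1) by (intro summable_add) (simp_all add: power_mult[symmetric] mult.commute)
  show "norm (a n * z ^ n) \<le> (norm (a n))\<^sup>2 + (norm z ^ n)\<^sup>2" for n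
  proof -
    define x y where "x = norm (a n)" and "y = norm z ^ n"
    have "0 \<le> x * y" by (auto simp: x_def y_def)
    then show ?thesis
      using sum_squares_bound[of x y] unfolding x_def[symmetric] y_def[symmetric] norm_mult norm_power by linarith
  qed
qed

lemma power_series_holomorphic_disc:
  assumes "\<And>z. z \<in> disc \<Longrightarrow> (\<lambda>n. a n * z ^ n) sums f z"
  shows "f holomorphic_on disc"
  using power_series_holomorphic[of 0 1 a f] assms by simp

lemma hardy2I:
  assumes "summable (\<lambda>n. (norm (a n))\<^sup>2)" "\<And>z. z \<in> disc \<Longrightarrow> (\<lambda>n. a n * z ^ n) sums f z"
    "\<And>z. z \<notin> disc \<Longrightarrow> f z = 0"
  shows "f \<in> hardy2"
  using assms power_series_holomorphic_disc[OF assms(2)] tcoeff_eqI[OF assms(2)]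
  by (simp add: hardy2_def)

text \<open>As a type, the Hardy space can be made an instance of the classes of real inner product
  and complete spaces, which then supply closures, limits and continuity.\<close>

typedef h2 = hardy2
  morphisms hfun Abs_h2
proof
  show "(\<lambda>z. 0) \<in> hardy2" by (rule hardy2I[of "\<lambda>n. 0"]) auto
qed

definition hco :: "h2 \<Rightarrow> nat \<Rightarrow> complex" where "hco f = tcoeff (hfun f)"

lemma hfun_holo [simp]: "hfun f holomorphic_on disc"
  and hfun_outside: "z \<notin> disc \<Longrightarrow> hfun f z = 0"
  and hco_summable: "summable (\<lambda>n. (norm (hco f n))\<^sup>2)"
  using hfun[of f] by (auto simp: hardy2_def hco_def)

lemma hco_sums: "z \<in> disc \<Longrightarrow> (\<lambda>n. hco f n * z ^ n) sums hfun f z"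
  unfolding hco_def by (rule tcoeff_sums) auto

lemma hco_0: "hco f 0 = hfun f 0"
  using hco_sums[of 0 f] by simp

lemma h2_eqI: 
  assumes "\<And>z. z \<in> disc \<Longrightarrow> hfun f z = hfun g z"
  shows "f = g"
proof -
  have "hfun f z = hfun g z" for z
    using assms[of z] hfun_outside[of z f] hfun_outside[of z g] by (cases "z \<in> disc") auto
  then show ?thesis unfolding hfun_inject[symmetric] by (rule ext)
qed

lemma h2_coeff_eqI: 
  assumes "\<And>n. hco f n = hco g n"
  shows "f = g"
proof (rule h2_eqI)
  fix z assume "z \<in> disc"
  then show "hfun f z = hfun g z"
    using hco_sums[of z f] hco_sums[of z g] assms by (simp add: sums_iff)
qed

definition h2_of :: "(nat \<Rightarrow> complex) \<Rightarrow> h2" where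
  "h2_of a = Abs_h2 (\<lambda>z. if z \<in> disc then \<Sum>n. a n * z ^ n else 0)"

lemma hco_h2_of:
  assumes "summable (\<lambda>n. (norm (a n))\<^sup>2)"
  shows "hco (h2_of a) n = a n"
proof -
  have s: "(\<lambda>n. a n * z ^ n) sums (if z \<in> disc then \<Sum>n. a n * z ^ n else 0)" if "z \<in> disc" for z
    using square_summable_power_series[OF assms, of z] that by (simp add: summable_sums)
  have *: "hfun (h2_of a) = (\<lambda>z. if z \<in> disc then \<Sum>n. a n * z ^ n else 0)"
    unfolding h2_of_def by (rule Abs_h2_inverse, rule hardy2I[OF assms s]) auto
  show "hco (h2_of a) n = a n"
    unfolding hco_def * by (rule tcoeff_eqI) (use s in auto)
qed

lemma summable_norm_product:
  fixes a b :: "nat \<Rightarrow> complex"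
  assumes "summable (\<lambda>n. (norm (a n))\<^sup>2)" "summable (\<lambda>n. (norm (b n))\<^sup>2)"
  shows "summable (\<lambda>n. norm (a n * b n))"
proof (rule summable_comparison_test'[OF summable_add[OF assms]])
  fix n
  have "0 \<le> norm (a n) * norm (b n)" by simp
  then show "norm (norm (a n * b n)) \<le> (norm (a n))\<^sup>2 + (norm (b n))\<^sup>2"
    using sum_squares_bound[of "norm (a n)" "norm (b n)"] unfolding norm_mult real_norm_def by linarith
qed

lemma square_summable_add:
  fixes a b :: "nat \<Rightarrow> complex"
  assumes "summable (\<lambda>n. (norm (a n))\<^sup>2)" "summable (\<lambda>n. (norm (b n))\<^sup>2)"
  shows "summable (\<lambda>n. (norm (a n + b n))\<^sup>2)"
proof (rule summable_comparison_test'[OF summable_mult[OF summable_add[OF assms], of 2]])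
  fix n
  have "(norm (a n + b n))\<^sup>2 \<le> (norm (a n) + norm (b n))\<^sup>2"
    by (intro power_mono norm_triangle_ineq) auto
  also have "\<dots> \<le> 2 * ((norm (a n))\<^sup>2 + (norm (b n))\<^sup>2)"
    using sum_squares_bound[of "norm (a n)" "norm (b n)"] by (simp add: power2_sum)
  finally show "norm ((norm (a n + b n))\<^sup>2) \<le> 2 * ((norm (a n))\<^sup>2 + (norm (b n))\<^sup>2)" by simp
qed

lemma square_summable_cmult:
  fixes a :: "nat \<Rightarrow> complex"
  assumes "summable (\<lambda>n. (norm (a n))\<^sup>2)"
  shows "summable (\<lambda>n. (norm (c * a n))\<^sup>2)"
  using summable_mult[OF assms, of "(norm c)\<^sup>2"] by (simp add: norm_mult power_mult_distrib)

instantiation h2 :: real_vector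
begin

definition "0 = Abs_h2 (\<lambda>z. 0)"
definition "f + g = Abs_h2 (\<lambda>z. hfun f z + hfun g z)"
definition "- f = Abs_h2 (\<lambda>z. - hfun f z)"
definition "f - g = Abs_h2 (\<lambda>z. hfun f z - hfun g z)"
definition "scaleR r f = Abs_h2 (\<lambda>z. of_real r * hfun f z)"

lemma hfun_zero: "hfun 0 = (\<lambda>z. 0)"
  unfolding zero_h2_def by (rule Abs_h2_inverse, rule hardy2I[of "\<lambda>n. 0"]) auto

lemma hfun_plus: "hfun (f + g) = (\<lambda>z. hfun f z + hfun g z)"
  unfolding plus_h2_def
  by (rule Abs_h2_inverse, rule hardy2I[of "\<lambda>n. hco f n + hco g n"])
     (auto simp: distrib_right hfun_outside intro!: sums_add hco_sums square_summable_add hco_summable)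

lemma hfun_scale_in: "(\<lambda>z. c * hfun f z) \<in> hardy2"
  by (rule hardy2I[of "\<lambda>n. c * hco f n"])
     (auto simp: mult.assoc hfun_outside intro!: sums_mult hco_sums square_summable_cmult hco_summable)

lemma hfun_uminus: "hfun (- f) = (\<lambda>z. - hfun f z)"
  unfolding uminus_h2_def using hfun_scale_in[of "-1" f] by (simp add: Abs_h2_inverse)

lemma hfun_minus: "hfun (f - g) = (\<lambda>z. hfun f z - hfun g z)"
proof -
  have "(\<lambda>z. hfun f z - hfun g z) = hfun (f + (- g))" by (simp add: hfun_plus hfun_uminus)
  then show ?thesis unfolding minus_h2_def by (metis Abs_h2_inverse hfun)
qed

lemma hfun_scaleR: "hfun (r *\<^sub>R f) = (\<lambda>z. of_real r * hfun f z)"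
  unfolding scaleR_h2_def using hfun_scale_in by (simp add: Abs_h2_inverse)

lemma hco_zero: "hco 0 n = 0"
  unfolding hco_def by (rule tcoeff_eqI) (auto simp: hfun_zero)

lemma hco_plus: "hco (f + g) n = hco f n + hco g n"
  unfolding hco_def[of "f + g"] 
  by (rule tcoeff_eqI) (auto simp: hfun_plus distrib_right intro!: sums_add hco_sums)

lemma hco_scaleR: "hco (r *\<^sub>R f) n = of_real r * hco f n"
  unfolding hco_def[of "r *\<^sub>R f"] 
  by (rule tcoeff_eqI) (auto simp: hfun_scaleR mult.assoc intro!: sums_mult hco_sums)

instance
proof
  fix f g h :: h2 and r s :: real
  show "f + g + h = f + (g + h)" "f + g = g + f" "0 + f = f" "- f + f = 0" "f - g = f + - g"
    "r *\<^sub>R (f + g) = r *\<^sub>R f + r *\<^sub>R g" "(r + s) *\<^sub>R f = r *\<^sub>R f + s *\<^sub>R f" "r *\<^sub>R s *\<^sub>R f = (r * s) *\<^sub>R f" "1 *\<^sub>R f = f"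
    by (rule h2_eqI; simp add: hfun_plus hfun_zero hfun_uminus hfun_minus hfun_scaleR algebra_simps)+
qed

end

lemma hco_product_summable: "summable (\<lambda>n. hco f n * cnj (hco g n))"
  by (rule summable_norm_cancel, rule summable_norm_product) (auto simp: hco_summable)

text \<open>Only the real part of the inner product is kept. Complex orthogonality to a set closed under
  multiplication by \<open>\<i>\<close> is the same as real orthogonality.\<close>
instantiation h2 :: real_inner
begin

definition inner_h2_def: "inner f g = Re (\<Sum>n. hco f n * cnj (hco g n))"
definition norm_h2_def: "norm (f::h2) = sqrt (inner f f)"
definition sgn_h2_def: "sgn (f::h2) = f /\<^sub>R norm f"
definition dist_h2_def: "dist (f::h2) g = norm (f - g)"
definition uniformity_h2_def: "(uniformity :: (h2 \<times> h2) filter) = (INF e\<in>{0<..}. principal {(x, y). dist x y < e})"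
definition open_h2_def: "open (U :: h2 set) = (\<forall>x\<in>U. eventually (\<lambda>(x', y). x' = x \<longrightarrow> y \<in> U) uniformity)"

lemma inner_h2_self: "inner f f = (\<Sum>n. (norm (hco f n))\<^sup>2)" for f :: h2
  unfolding inner_h2_def complex_norm_square[symmetric] suminf_of_real[OF hco_summable, symmetric] by simp

instance
proof
  fix f g h :: h2 and r s :: real
  show "inner f g = inner g f"
  proof -
    have "cnj (\<Sum>n. hco f n * cnj (hco g n)) = (\<Sum>n. cnj (hco f n * cnj (hco g n)))"
      using sums_cnj[THEN iffD2, OF summable_sums[OF hco_product_summable[of f g]]] by (simp add: sums_iff)
    then have "Re (\<Sum>n. hco f n * cnj (hco g n)) = Re (\<Sum>n. cnj (hco f n * cnj (hco g n)))"
      by (metis complex_cnj_cnj cnj.simps(1))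
    then show ?thesis by (simp add: inner_h2_def mult.commute)
  qed
  show "inner (f + g) h = inner f h + inner g h"
    by (simp add: inner_h2_def hco_plus distrib_right suminf_add[symmetric] hco_product_summable)
  show "inner (r *\<^sub>R f) g = r * inner f g"
    by (simp add: inner_h2_def hco_scaleR mult.assoc suminf_mult hco_product_summable)
  show "0 \<le> inner f f" unfolding inner_h2_self by (intro suminf_nonneg hco_summable) auto
  show "inner f f = 0 \<longleftrightarrow> f = 0"
  proof
    assume "inner f f = 0"
    then have "\<forall>n. (norm (hco f n))\<^sup>2 = 0"
      unfolding inner_h2_self by (subst suminf_eq_zero_iff[symmetric, OF hco_summable]) auto
    then show "f = 0" by (intro h2_coeff_eqI) (simp add: hco_zero)
  qed (simp add: inner_h2_self hco_zero)
qed (rule sgn_h2_def dist_h2_def uniformity_h2_def open_h2_def norm_h2_def)+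

end

lemmas hfun_simps = hfun_zero hfun_plus hfun_uminus hfun_minus hfun_scaleR

lemma hco_minus: "hco (f - g) n = hco f n - hco g n"
  using hco_plus[of "f - g" g n] by simp

lemma norm_h2_power2: "(norm f)\<^sup>2 = (\<Sum>n. (norm (hco f n))\<^sup>2)"
  by (simp add: power2_norm_eq_inner inner_h2_self)

lemma sum_hco_le: "(\<Sum>n<N. (norm (hco f n))\<^sup>2) \<le> (norm f)\<^sup>2"
  unfolding norm_h2_power2 by (rule sum_le_suminf[OF hco_summable]) auto

lemma norm_hco_le: "norm (hco f n) \<le> norm f"
proof -
  have "(norm (hco f n))\<^sup>2 \<le> (\<Sum>k<Suc n. (norm (hco f k))\<^sup>2)" by (simp add: sum_nonneg)
  also have "\<dots> \<le> (norm f)\<^sup>2" by (rule sum_hco_le)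
  finally show ?thesis by (rule power2_le_imp_le) simp
qed

lemma norm_h2_leI:
  assumes "\<And>N. (\<Sum>n<N. (norm (hco f n))\<^sup>2) \<le> B\<^sup>2" "B \<ge> 0"
  shows "norm f \<le> B"
proof -
  have "(norm f)\<^sup>2 \<le> B\<^sup>2"
    unfolding norm_h2_power2 using assms by (intro suminf_le_const hco_summable)
  then show ?thesis using assms(2) by (rule power2_le_imp_le)
qed

instance h2 :: complete_space
proof
  fix X :: "nat \<Rightarrow> h2" assume X: "Cauchy X"
  have "Cauchy (\<lambda>k. hco (X k) n)" for n
  proof (rule metric_CauchyI)
    fix e :: real assume "e > 0"
    then obtain M where M: "\<And>j k. \<lbrakk>j \<ge> M; k \<ge> M\<rbrakk> \<Longrightarrow> norm (X j - X k) < e"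
      using X unfolding Cauchy_def dist_norm by metis
    then show "\<exists>M. \<forall>j\<ge>M. \<forall>k\<ge>M. dist (hco (X j) n) (hco (X k) n) < e"
      unfolding dist_norm hco_minus[symmetric] by (meson norm_hco_le le_less_trans)
  qed
  then have "\<exists>a. (\<lambda>k. hco (X k) n) \<longlonglongrightarrow> a" for n
    using Cauchy_convergent_iff convergent_def by blast
  then obtain a where a: "\<And>n. (\<lambda>k. hco (X k) n) \<longlonglongrightarrow> a n" by metis
  \<comment> \<open>Stated for finite sums with \<open>M\<close> independent of \<open>N\<close>, so
    that the limit over \<open>j\<close> can be taken term by term. It yields both the square
    summability of the limit coefficients and convergence in norm.\<close>
  have tail: "\<exists>M. \<forall>k\<ge>M. \<forall>N. (\<Sum>n<N. (norm (a n - hco (X k) n))\<^sup>2) \<le> e\<^sup>2" if e: "e > 0" for e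
  proof -
    obtain M where M: "\<And>j k. \<lbrakk>j \<ge> M; k \<ge> M\<rbrakk> \<Longrightarrow> norm (X j - X k) < e"
      using X e unfolding Cauchy_def dist_norm by metis
    show ?thesis
    proof (intro exI[of _ M] allI impI)
      fix k N assume k: "k \<ge> M"
      show "(\<Sum>n<N. (norm (a n - hco (X k) n))\<^sup>2) \<le> e\<^sup>2"
      proof (rule tendsto_upperbound)
        show "(\<lambda>j. \<Sum>n<N. (norm (hco (X j) n - hco (X k) n))\<^sup>2) \<longlonglongrightarrow> (\<Sum>n<N. (norm (a n - hco (X k) n))\<^sup>2)"
          by (intro tendsto_intros a)
        have "(\<Sum>n<N. (norm (hco (X j) n - hco (X k) n))\<^sup>2) \<le> e\<^sup>2" if "j \<ge> M" for j
        proof -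
          have "(\<Sum>n<N. (norm (hco (X j) n - hco (X k) n))\<^sup>2) \<le> (norm (X j - X k))\<^sup>2"
            unfolding hco_minus[symmetric] by (rule sum_hco_le)
          also have "\<dots> \<le> e\<^sup>2" using M[OF that k] by (intro power_mono) auto
          finally show ?thesis .
        qed
        then show "\<forall>\<^sub>F j in sequentially. (\<Sum>n<N. (norm (hco (X j) n - hco (X k) n))\<^sup>2) \<le> e\<^sup>2"
          by (auto simp: eventually_sequentially)
      qed simp
    qed
  qed
  obtain k where k: "\<And>N. (\<Sum>n<N. (norm (a n - hco (X k) n))\<^sup>2) \<le> 1\<^sup>2" using tail[of 1] by auto
  have "summable (\<lambda>n. (norm (a n - hco (X k) n))\<^sup>2)"
    by (rule summableI_nonneg_bounded[of _ "1\<^sup>2"]) (use k in auto)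
  from square_summable_add[OF this hco_summable[of "X k"]]
  have sa: "summable (\<lambda>n. (norm (a n))\<^sup>2)" by simp
  have "X \<longlonglongrightarrow> h2_of a"
    unfolding LIMSEQ_iff
  proof (intro allI impI)
    fix e :: real assume e: "e > 0"
    obtain M where M: "\<And>k N. k \<ge> M \<Longrightarrow> (\<Sum>n<N. (norm (a n - hco (X k) n))\<^sup>2) \<le> (e/2)\<^sup>2"
      using tail[of "e/2"] e by auto
    have "norm (h2_of a - X k) \<le> e/2" if "k \<ge> M" for k
      using M[OF that] e by (intro norm_h2_leI) (auto simp: hco_minus hco_h2_of[OF sa])
    then show "\<exists>M. \<forall>k\<ge>M. norm (X k - h2_of a) < e"
      using e by (intro exI[of _ M]) (force simp: norm_minus_commute)
  qed
  then show "convergent X" by (auto simp: convergent_def)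
qed

section \<open>Circle means\<close>

abbreviation circle_measure :: "real measure" where "circle_measure \<equiv> lebesgue_on {0..2*pi}"

definition circle_mean :: "real \<Rightarrow> (complex \<Rightarrow> real) \<Rightarrow> real" where
  "circle_mean r g = (\<integral>t. g (of_real r * cis t) \<partial>circle_measure) / (2 * pi)"

abbreviation square_mean :: "real \<Rightarrow> (complex \<Rightarrow> complex) \<Rightarrow> real" where
  "square_mean r f \<equiv> circle_mean r (\<lambda>z. (norm (f z))\<^sup>2)"

lemma circle_integrable:
  fixes g :: "complex \<Rightarrow> 'b::euclidean_space"
  assumes "continuous_on disc g" "0 \<le> r" "r < 1"
  shows "integrable circle_measure (\<lambda>t. g (of_real r * cis t))"
proof (rule continuous_imp_integrable_real)
  show "continuous_on {0..2*pi} (\<lambda>t. g (of_real r * cis t))"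
    by (rule continuous_on_compose2[OF assms(1)]) (use assms in \<open>auto intro!: continuous_intros simp: norm_mult\<close>)
qed

lemma circle_mean_mono:
  assumes "continuous_on disc g" "continuous_on disc h" "0 \<le> r" "r < 1" "\<And>z. z \<in> disc \<Longrightarrow> g z \<le> h z"
  shows "circle_mean r g \<le> circle_mean r h"
  unfolding circle_mean_def
  by (intro divide_right_mono integral_mono circle_integrable assms) (use assms in \<open>auto simp: norm_mult\<close>)

lemma circle_mean_add:
  assumes "continuous_on disc g" "continuous_on disc h" "0 \<le> r" "r < 1"
  shows "circle_mean r (\<lambda>z. g z + h z) = circle_mean r g + circle_mean r h"
  unfolding circle_mean_def using assms by (simp add: circle_integrable add_divide_distrib)

lemma circle_mean_diff:
  assumes "continuous_on disc g" "continuous_on disc h" "0 \<le> r" "r < 1"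
  shows "circle_mean r (\<lambda>z. g z - h z) = circle_mean r g - circle_mean r h"
  unfolding circle_mean_def using assms by (simp add: circle_integrable diff_divide_distrib)

lemma circle_mean_cmult: "circle_mean r (\<lambda>z. c * g z) = c * circle_mean r g"
  unfolding circle_mean_def by simp

lemma circle_mean_const: "circle_mean r (\<lambda>z. c) = c"
  unfolding circle_mean_def by (simp add: measure_restrict_space)

lemma circle_mean_nonneg:
  assumes "\<And>z. z \<in> disc \<Longrightarrow> 0 \<le> g z" "0 \<le> r" "r < 1"
  shows "0 \<le> circle_mean r g"
  unfolding circle_mean_def using assms by (intro divide_nonneg_pos integral_nonneg) (auto simp: norm_mult)

text \<open>The mean of \<open>(s u - v)^2\<close> is a nonnegative quadratic in \<open>s\<close>,
  which bounds its discriminant.\<close>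

lemma circle_mean_Cauchy_Schwarz:
  assumes u: "continuous_on disc u" and v: "continuous_on disc v" and r: "0 \<le> r" "r < 1"
  shows "circle_mean r (\<lambda>z. u z * v z) \<le> sqrt (circle_mean r (\<lambda>z. (u z)\<^sup>2)) * sqrt (circle_mean r (\<lambda>z. (v z)\<^sup>2))"
proof -
  define A B C where "A = circle_mean r (\<lambda>z. (u z)\<^sup>2)" and "B = circle_mean r (\<lambda>z. u z * v z)"
    and "C = circle_mean r (\<lambda>z. (v z)\<^sup>2)"
  have A0: "A \<ge> 0" and C0: "C \<ge> 0" unfolding A_def C_def by (rule circle_mean_nonneg; use r in simp)+
  have q: "0 \<le> s\<^sup>2 * A - 2 * s * B + C" for s
  proof -
    have "0 \<le> circle_mean r (\<lambda>z. (s * u z - v z)\<^sup>2)" by (rule circle_mean_nonneg) (use r in auto)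
    also have "(\<lambda>z. (s * u z - v z)\<^sup>2) = (\<lambda>z. (s\<^sup>2 * (u z)\<^sup>2 - (2 * s) * (u z * v z)) + (v z)\<^sup>2)"
      by (auto simp: power2_eq_square algebra_simps)
    also have "circle_mean r \<dots> = s\<^sup>2 * A - 2 * s * B + C"
      unfolding A_def B_def C_def
      by (subst circle_mean_add circle_mean_diff | intro continuous_intros u v r | simp add: circle_mean_cmult)+
    finally show ?thesis .
  qed
  have "B \<le> sqrt A * sqrt C"
  proof (cases "A = 0")
    case True
    have "B \<le> 0"
    proof (rule ccontr)
      assume "\<not> B \<le> 0"
      \<comment> \<open>With \<open>A = 0\<close> the quadratic is linear in \<open>s\<close>, and
        this \<open>s\<close> gives it the value \<open>-1\<close>.\<close>
      then show False using q[of "(C + 1) / (2 * B)"] True by (simp add: field_simps)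
    qed
    then show ?thesis using True by simp
  next
    case False
    then have "A > 0" using A0 by simp
    then have "B\<^sup>2 \<le> A * C" using q[of "B / A"] by (simp add: field_simps power2_eq_square)
    then have "B \<le> sqrt (A * C)" by (rule real_le_rsqrt)
    then show ?thesis by (simp add: real_sqrt_mult)
  qed
  then show ?thesis by (simp add: A_def B_def C_def)
qed

section \<open>Fourier series on circles inside the disc\<close>

lemma radial_power_series:
  assumes f: "f holomorphic_on disc" and r: "0 \<le> r" "r < 1"
  shows "summable (\<lambda>n. norm (tcoeff f n * of_real r ^ n))"
    and "(\<lambda>N. \<Sum>n<N. (tcoeff f n * of_real r ^ n) * cis (real n * t)) \<longlonglongrightarrow> f (of_real r * cis t)"
proof -
  have sums: "(\<lambda>n. tcoeff f n * z ^ n) sums f z" if "z \<in> disc" for z using tcoeff_sums[OF f that] .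
  \<comment> \<open>Convergence at a radius beyond \<open>r\<close> gives absolute convergence at
    \<open>r\<close>.\<close>
  define s where "s = (r + 1) / 2"
  have s: "r < s" "s < 1" using r by (auto simp: s_def)
  show "summable (\<lambda>n. norm (tcoeff f n * of_real r ^ n))"
    using sums[of "of_real s"] r s by (intro powser_insidea[of _ "of_real s"]) (auto simp: sums_iff)
  have "(\<lambda>n. tcoeff f n * (of_real r * cis t) ^ n) sums f (of_real r * cis t)"
    using r by (intro sums) (auto simp: norm_mult)
  then show "(\<lambda>N. \<Sum>n<N. (tcoeff f n * of_real r ^ n) * cis (real n * t)) \<longlonglongrightarrow> f (of_real r * cis t)"
    by (simp add: sums_def power_mult_distrib Complex.DeMoivre mult.assoc)
qed

lemma norm_trig_sum_le:
  assumes "summable (\<lambda>n. norm (c n))"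
  shows "norm (\<Sum>n<N. c n * cis (real n * t)) \<le> (\<Sum>n. norm (c n))"
proof -
  have "norm (\<Sum>n<N. c n * cis (real n * t)) \<le> (\<Sum>n<N. norm (c n))"
    by (rule order_trans[OF norm_sum]) (simp add: norm_mult)
  also have "\<dots> \<le> (\<Sum>n. norm (c n))" by (rule sum_le_suminf[OF assms]) auto
  finally show ?thesis .
qed

text \<open>Parseval for the partial sums passes to the limit: for \<open>r < 1\<close> the
  coefficients are absolutely summable, and the square of their sum dominates all
  integrands.\<close>

lemma circle_parseval:
  assumes f: "f holomorphic_on disc" and r: "0 \<le> r" "r < 1"
  shows "(\<lambda>n. (norm (tcoeff f n))\<^sup>2 * r ^ (2 * n)) sums square_mean r f"
proof -
  define c where "c n = tcoeff f n * of_real r ^ n" for n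
  define S where "S N t = (norm (\<Sum>n<N. c n * cis (real n * t)))\<^sup>2" for N t
  note rp = radial_power_series[OF f r, folded c_def]
  have Sc: "continuous_on A (S N)" for A N unfolding S_def by (intro continuous_intros)
  have Si: "integrable circle_measure (S N)" for N by (rule continuous_imp_integrable_real[OF Sc])
  have "(\<lambda>N. integral\<^sup>L circle_measure (S N)) \<longlonglongrightarrow> (\<integral>t. (norm (f (of_real r * cis t)))\<^sup>2 \<partial>circle_measure)"
  proof (rule integral_dominated_convergence)
    show "(\<lambda>t. (norm (f (of_real r * cis t)))\<^sup>2) \<in> borel_measurable circle_measure"
      by (intro borel_measurable_integrable circle_integrable r continuous_intros holomorphic_on_imp_continuous_on f)
    show "S N \<in> borel_measurable circle_measure" for N using Si by (rule borel_measurable_integrable)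
    show "integrable circle_measure (\<lambda>t. (\<Sum>n. norm (c n))\<^sup>2)" 
      by (rule continuous_imp_integrable_real) (intro continuous_intros)
    show "AE t in circle_measure. (\<lambda>N. S N t) \<longlonglongrightarrow> (norm (f (of_real r * cis t)))\<^sup>2"
      unfolding S_def by (intro AE_I2 tendsto_intros rp)
    show "AE t in circle_measure. norm (S N t) \<le> (\<Sum>n. norm (c n))\<^sup>2" for N
      unfolding S_def by (intro AE_I2) (simp add: power_mono norm_trig_sum_le rp)
  qed
  moreover have "integral\<^sup>L circle_measure (S N) = 2 * pi * (\<Sum>n<N. (norm (c n))\<^sup>2)" for N
    using trig_parseval[of "{..<N}" c] Si[of N]
    by (subst lebesgue_integral_eq_integral) (auto simp: S_def [abs_def] integral_unique)
  ultimately have "(\<lambda>N. 2 * pi * (\<Sum>n<N. (norm (c n))\<^sup>2) / (2 * pi)) \<longlonglongrightarrow> square_mean r f"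
    unfolding circle_mean_def by (intro tendsto_divide) auto
  moreover have "(norm (c n))\<^sup>2 = (norm (tcoeff f n))\<^sup>2 * r ^ (2 * n)" for n
    using r by (simp add: c_def norm_mult norm_power power_mult_distrib power_mult[symmetric] mult.commute[of 2])
  ultimately show ?thesis by (simp add: sums_def)
qed

lemma sum_tcoeff_le_circle_mean:
  assumes "f holomorphic_on disc" "0 \<le> r" "r < 1"
  shows "(\<Sum>n<N. (norm (tcoeff f n))\<^sup>2 * r ^ (2 * n)) \<le> square_mean r f"
  unfolding sums_unique[OF circle_parseval[OF assms]]
  using assms by (intro sum_le_suminf sums_summable[OF circle_parseval]) auto

text \<open>\<open>tcoeff f k * r ^ k\<close> is a Fourier coefficient of \<open>f\<close> on the
  circle of radius \<open>r\<close>. The mean is of first order because the bound will be applied to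
  products of two Hardy functions, whose squares need not have bounded means.\<close>

lemma norm_tcoeff_le_circle_mean:
  assumes f: "f holomorphic_on disc" and r: "0 \<le> r" "r < 1"
  shows "norm (tcoeff f k) * r ^ k \<le> circle_mean r (\<lambda>z. norm (f z))"
proof -
  define c where "c n = tcoeff f n * of_real r ^ n" for n
  define S where "S N t = (\<Sum>n<N. c n * cis (real n * t)) * cnj (cis (real k * t))" for N t
  note rp = radial_power_series[OF f r, folded c_def]
  have Sc: "continuous_on A (S N)" for A N unfolding S_def by (intro continuous_intros)
  have Si: "integrable circle_measure (S N)" for N by (rule continuous_imp_integrable_real[OF Sc])
  have fm: "integrable circle_measure (\<lambda>t. f (of_real r * cis t))"
    by (intro circle_integrable r holomorphic_on_imp_continuous_on f)
  have "(\<lambda>N. integral\<^sup>L circle_measure (S N)) \<longlonglongrightarrow> (\<integral>t. f (of_real r * cis t) * cnj (cis (real k * t)) \<partial>circle_measure)"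
  proof (rule integral_dominated_convergence)
    show "(\<lambda>t. f (of_real r * cis t) * cnj (cis (real k * t))) \<in> borel_measurable circle_measure"
      by (intro borel_measurable_times borel_measurable_integrable fm continuous_imp_integrable_real continuous_intros)
    show "S N \<in> borel_measurable circle_measure" for N using Si by (rule borel_measurable_integrable)
    show "integrable circle_measure (\<lambda>t. \<Sum>n. norm (c n))" 
      by (rule continuous_imp_integrable_real) (intro continuous_intros)
    show "AE t in circle_measure. (\<lambda>N. S N t) \<longlonglongrightarrow> f (of_real r * cis t) * cnj (cis (real k * t))"
      unfolding S_def by (intro AE_I2 tendsto_intros rp)
    show "AE t in circle_measure. norm (S N t) \<le> (\<Sum>n. norm (c n))" for N
      unfolding S_def by (intro AE_I2) (simp add: norm_mult norm_trig_sum_le rp)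
  qed
  moreover have "integral\<^sup>L circle_measure (S N) = 2 * pi * c k" if "k < N" for N
  proof -
    have "(S N has_integral (\<Sum>n<N. c n * (if n = k then of_real (2 * pi) else 0))) {0..2*pi}"
      unfolding S_def sum_distrib_right mult.assoc
      by (intro has_integral_sum has_integral_mult_right cis_of_nat_diff_has_integral) auto
    also have "(\<Sum>n<N. c n * (if n = k then of_real (2 * pi) else 0)) = 2 * pi * c k"
      using that by (simp add: if_distrib[of "\<lambda>x. _ * x"] mult.commute cong: if_cong)
    finally show ?thesis using Si[of N] by (subst lebesgue_integral_eq_integral) (auto simp: integral_unique)
  qed
  then have "(\<lambda>N. integral\<^sup>L circle_measure (S N)) \<longlonglongrightarrow> 2 * pi * c k"
    by (intro tendsto_eventually) (auto simp: eventually_sequentially intro!: exI[of _ "Suc k"])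
  ultimately have eq: "(\<integral>t. f (of_real r * cis t) * cnj (cis (real k * t)) \<partial>circle_measure) = 2 * pi * c k"
    by (rule LIMSEQ_unique)
  have "norm (2 * pi * c k) \<le> (\<integral>t. norm (f (of_real r * cis t) * cnj (cis (real k * t))) \<partial>circle_measure)"
    unfolding eq[symmetric] by (rule integral_norm_bound)
  then have "2 * pi * norm (c k) \<le> 2 * pi * circle_mean r (\<lambda>z. norm (f z))"
    by (simp add: norm_mult circle_mean_def)
  then show ?thesis using r by (simp add: c_def norm_mult norm_power)
qed

text \<open>Starts at \<open>1/2\<close>, so that all radii are positive. A fixed sequence suits
  dominated convergence and the measurability of limit functions.\<close>

definition radius :: "nat \<Rightarrow> real" where "radius k = 1 - inverse (real (Suc (Suc k)))"

lemma radius_bounds: "0 \<le> radius k" "0 < radius k" "radius k < 1"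
  unfolding radius_def by (simp_all add: field_simps)

lemma radius_tendsto: "radius \<longlonglongrightarrow> 1"
proof -
  have "(\<lambda>k. inverse (real (Suc (Suc k)))) \<longlonglongrightarrow> 0"
    using LIMSEQ_inverse_real_of_nat by (rule LIMSEQ_Suc)
  from tendsto_diff[OF tendsto_const[of 1] this] show ?thesis by (simp add: radius_def [abs_def])
qed

lemma radius_filterlim: "filterlim radius (at_left 1) sequentially"
  unfolding filterlim_at using radius_tendsto radius_bounds by (auto intro!: always_eventually simp: less_imp_neq)

lemma circle_mean_h2_le:
  assumes "0 \<le> r" "r < 1"
  shows "square_mean r (hfun f) \<le> (norm f)\<^sup>2"
  unfolding norm_h2_power2
proof (rule sums_le[OF _ circle_parseval[OF hfun_holo assms] summable_sums[OF hco_summable]])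
  fix n
  show "(norm (tcoeff (hfun f) n))\<^sup>2 * r ^ (2 * n) \<le> (norm (hco f n))\<^sup>2"
    using assms by (simp add: hco_def mult_left_le power_le_one)
qed

text \<open>The means never exceed the limit, by \<open>circle_mean_h2_le\<close>. Finitely many
  coefficients already give a lower bound close to it, and in a finite sum the radius can tend to
  1.\<close>

lemma circle_mean_h2_tendsto:
  "(\<lambda>k. square_mean (radius k) (hfun f)) \<longlonglongrightarrow> (norm f)\<^sup>2"
proof (rule LIMSEQ_I)
  fix e :: real assume e: "e > 0"
  have "(\<lambda>N. \<Sum>n<N. (norm (hco f n))\<^sup>2) \<longlonglongrightarrow> (norm f)\<^sup>2"
    unfolding norm_h2_power2 using summable_sums[OF hco_summable] by (simp add: sums_def)
  then have "\<forall>\<^sub>F N in sequentially. (\<Sum>n<N. (norm (hco f n))\<^sup>2) > (norm f)\<^sup>2 - e"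
    by (rule order_tendstoD) (use e in auto)
  then obtain N where N: "(\<Sum>n<N. (norm (hco f n))\<^sup>2) > (norm f)\<^sup>2 - e"
    by (auto simp: eventually_sequentially)
  have "(\<lambda>k. \<Sum>n<N. (norm (hco f n))\<^sup>2 * radius k ^ (2 * n)) \<longlonglongrightarrow> (\<Sum>n<N. (norm (hco f n))\<^sup>2 * 1 ^ (2 * n))"
    by (intro tendsto_intros radius_tendsto)
  then have "\<forall>\<^sub>F k in sequentially. (\<Sum>n<N. (norm (hco f n))\<^sup>2 * radius k ^ (2 * n)) > (norm f)\<^sup>2 - e"
    by (rule order_tendstoD) (use N in simp)
  then obtain K where K: "\<And>k. k \<ge> K \<Longrightarrow> (\<Sum>n<N. (norm (hco f n))\<^sup>2 * radius k ^ (2 * n)) > (norm f)\<^sup>2 - e"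
    by (auto simp: eventually_sequentially)
  have S: "(\<Sum>n<N. (norm (hco f n))\<^sup>2 * radius k ^ (2 * n)) \<le> square_mean (radius k) (hfun f)" for k
    unfolding hco_def by (intro sum_tcoeff_le_circle_mean hfun_holo radius_bounds)
  have "\<bar>square_mean (radius k) (hfun f) - (norm f)\<^sup>2\<bar> < e" if "k \<ge> K" for k
    using K[OF that] circle_mean_h2_le[OF radius_bounds(1,3), of k f] e S[of k] by linarith
  then show "\<exists>K. \<forall>k\<ge>K. norm (square_mean (radius k) (hfun f) - (norm f)\<^sup>2) < e"
    by auto
qed

text \<open>A finite sum of squared coefficients is a limit of sums dominated by the means, so one
  bound serves all partial sums.\<close>

lemma hardy2_if_circle_means_bounded:
  assumes g: "g holomorphic_on disc" and b: "\<And>k. square_mean (radius k) g \<le> B\<^sup>2" and B: "B \<ge> 0"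
  shows "(\<lambda>z. if z \<in> disc then g z else 0) \<in> hardy2"
    and "norm (Abs_h2 (\<lambda>z. if z \<in> disc then g z else 0)) \<le> B"
proof -
  have le: "(\<Sum>n<N. (norm (tcoeff g n))\<^sup>2) \<le> B\<^sup>2" for N
  proof (rule tendsto_upperbound)
    have "(\<lambda>k. \<Sum>n<N. (norm (tcoeff g n))\<^sup>2 * radius k ^ (2 * n)) \<longlonglongrightarrow> (\<Sum>n<N. (norm (tcoeff g n))\<^sup>2 * 1 ^ (2 * n))"
      by (intro tendsto_intros radius_tendsto)
    then show "(\<lambda>k. \<Sum>n<N. (norm (tcoeff g n))\<^sup>2 * radius k ^ (2 * n)) \<longlonglongrightarrow> (\<Sum>n<N. (norm (tcoeff g n))\<^sup>2)" by simp
    have "(\<Sum>n<N. (norm (tcoeff g n))\<^sup>2 * radius k ^ (2 * n)) \<le> B\<^sup>2" for k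
    proof -
      have "(\<Sum>n<N. (norm (tcoeff g n))\<^sup>2 * radius k ^ (2 * n)) \<le> square_mean (radius k) g"
        by (intro sum_tcoeff_le_circle_mean g radius_bounds)
      then show ?thesis using b[of k] by linarith
    qed
    then show "\<forall>\<^sub>F k in sequentially. (\<Sum>n<N. (norm (tcoeff g n))\<^sup>2 * radius k ^ (2 * n)) \<le> B\<^sup>2" by simp
  qed simp
  have "summable (\<lambda>n. (norm (tcoeff g n))\<^sup>2)"
    by (rule summableI_nonneg_bounded[of _ "B\<^sup>2"]) (use le in auto)
  moreover have sums: "(\<lambda>n. tcoeff g n * z ^ n) sums (if z \<in> disc then g z else 0)" if "z \<in> disc" for z
    using tcoeff_sums[OF g that] that by simp
  ultimately show in_h2: "(\<lambda>z. if z \<in> disc then g z else 0) \<in> hardy2" by (rule hardy2I) auto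
  show "norm (Abs_h2 (\<lambda>z. if z \<in> disc then g z else 0)) \<le> B"
  proof (rule norm_h2_leI[OF _ B])
    have "hco (Abs_h2 (\<lambda>z. if z \<in> disc then g z else 0)) n = tcoeff g n" for n
      unfolding hco_def Abs_h2_inverse[OF in_h2] by (rule tcoeff_eqI) (rule sums)
    then show "(\<Sum>n<N. (norm (hco (Abs_h2 (\<lambda>z. if z \<in> disc then g z else 0)) n))\<^sup>2) \<le> B\<^sup>2" for N
      using le by simp
  qed
qed

section \<open>Multipliers\<close>

lemma hinfI:
  assumes "f holomorphic_on disc" "\<And>z. z \<in> disc \<Longrightarrow> norm (f z) \<le> C"
  shows "f \<in> hinf"
  unfolding hinf_def bounded_iff using assms by blast

lemma hinf_holo: "f \<in> hinf \<Longrightarrow> f holomorphic_on disc"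
  by (simp add: hinf_def)

lemma hinf_bound:
  assumes "f \<in> hinf"
  obtains C where "C \<ge> 0" "\<And>z. z \<in> disc \<Longrightarrow> norm (f z) \<le> C"
proof -
  obtain C where C: "\<And>z. z \<in> disc \<Longrightarrow> norm (f z) \<le> C"
    using assms unfolding hinf_def bounded_iff by blast
  moreover have "C \<ge> 0" using C[of 0] norm_ge_zero[of "f 0"] by (simp only: centre_in_ball) linarith
  ultimately show ?thesis using that by blast
qed

lemma hinf_const [simp]: "(\<lambda>z. c) \<in> hinf"
  by (rule hinfI[of _ "norm c"]) auto

lemma hinf_ident [simp]: "(\<lambda>z. z) \<in> hinf"
  by (rule hinfI[of _ 1]) auto

lemma hinf_mult [simp]:
  assumes "f \<in> hinf" "g \<in> hinf"
  shows "(\<lambda>z. f z * g z) \<in> hinf"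
proof -
  obtain C D where C: "C \<ge> 0" "\<And>z. z \<in> disc \<Longrightarrow> norm (f z) \<le> C" and D: "D \<ge> 0" "\<And>z. z \<in> disc \<Longrightarrow> norm (g z) \<le> D"
    using hinf_bound[OF assms(1)] hinf_bound[OF assms(2)] by metis
  show ?thesis
  proof (rule hinfI)
    show "(\<lambda>z. f z * g z) holomorphic_on disc" using assms by (intro holomorphic_intros hinf_holo)
    show "norm (f z * g z) \<le> C * D" if "z \<in> disc" for z
      unfolding norm_mult using C D that by (intro mult_mono) auto
  qed
qed

lemma hinf_add [simp]:
  assumes "f \<in> hinf" "g \<in> hinf"
  shows "(\<lambda>z. f z + g z) \<in> hinf"
proof -
  obtain C D where C: "C \<ge> 0" "\<And>z. z \<in> disc \<Longrightarrow> norm (f z) \<le> C" and D: "D \<ge> 0" "\<And>z. z \<in> disc \<Longrightarrow> norm (g z) \<le> D"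
    using hinf_bound[OF assms(1)] hinf_bound[OF assms(2)] by metis
  show ?thesis
  proof (rule hinfI)
    show "(\<lambda>z. f z + g z) holomorphic_on disc" using assms by (intro holomorphic_intros hinf_holo)
    show "norm (f z + g z) \<le> C + D" if "z \<in> disc" for z
      using C D that by (intro norm_triangle_mono) auto
  qed
qed

lemma hinf_power [simp]: "f \<in> hinf \<Longrightarrow> (\<lambda>z. f z ^ n) \<in> hinf"
  by (induction n) auto

lemma hinf_poly [simp]: "poly P \<in> hinf"
  by (induction P) (auto simp: poly_pCons [abs_def])

lemma hinf_hfun:
  assumes "\<And>z. z \<in> disc \<Longrightarrow> norm (hfun f z) \<le> C"
  shows "hfun f \<in> hinf"
  using assms by (intro hinfI) auto

text \<open>The truncation to \<open>disc\<close> restores the normalisation of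
  \<open>hardy2\<close>. The value is meaningful whenever the product is a Hardy function, in
  particular for \<open>\<psi>\<close> in \<open>hinf\<close>.\<close>

definition hmul :: "(complex \<Rightarrow> complex) \<Rightarrow> h2 \<Rightarrow> h2" where
  "hmul \<psi> f = Abs_h2 (\<lambda>z. if z \<in> disc then \<psi> z * hfun f z else 0)"

lemma
  assumes holo: "\<psi> holomorphic_on disc" and C: "\<And>z. z \<in> disc \<Longrightarrow> norm (\<psi> z) \<le> C"
  shows hmul_in_hardy2: "(\<lambda>z. if z \<in> disc then \<psi> z * hfun f z else 0) \<in> hardy2"
    and norm_hmul_le: "norm (hmul \<psi> f) \<le> C * norm f"
proof -
  have C0: "C \<ge> 0" using C[of 0] norm_ge_zero[of "\<psi> 0"] by (simp only: centre_in_ball) linarith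
  have holo': "(\<lambda>z. \<psi> z * hfun f z) holomorphic_on disc" by (intro holomorphic_intros holo hfun_holo)
  have bound: "circle_mean (radius k) (\<lambda>z. (norm (\<psi> z * hfun f z))\<^sup>2) \<le> (C * norm f)\<^sup>2" for k
  proof -
    have "circle_mean (radius k) (\<lambda>z. (norm (\<psi> z * hfun f z))\<^sup>2) \<le> circle_mean (radius k) (\<lambda>z. C\<^sup>2 * (norm (hfun f z))\<^sup>2)"
    proof (rule circle_mean_mono[OF _ _ radius_bounds(1,3)])
      fix z :: complex assume "z \<in> disc"
      then show "(norm (\<psi> z * hfun f z))\<^sup>2 \<le> C\<^sup>2 * (norm (hfun f z))\<^sup>2"
        using C unfolding norm_mult power_mult_distrib by (intro mult_right_mono power_mono) auto
    qed (intro continuous_intros holomorphic_on_imp_continuous_on holo hfun_holo)+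
    also have "\<dots> \<le> C\<^sup>2 * (norm f)\<^sup>2"
      unfolding circle_mean_cmult by (intro mult_left_mono circle_mean_h2_le radius_bounds) auto
    finally show ?thesis by (simp add: power_mult_distrib)
  qed
  show "(\<lambda>z. if z \<in> disc then \<psi> z * hfun f z else 0) \<in> hardy2"
    by (rule hardy2_if_circle_means_bounded[OF holo' bound]) (use C0 in simp)
  show "norm (hmul \<psi> f) \<le> C * norm f"
    unfolding hmul_def by (rule hardy2_if_circle_means_bounded[OF holo' bound]) (use C0 in simp)
qed

lemma hfun_hmul:
  assumes "\<psi> \<in> hinf"
  shows "hfun (hmul \<psi> f) = (\<lambda>z. if z \<in> disc then \<psi> z * hfun f z else 0)"
  unfolding hmul_def using hmul_in_hardy2[OF hinf_holo[OF assms]] hinf_bound[OF assms]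
  by (metis (no_types, lifting) Abs_h2_inverse)

lemma hmul_add: "\<psi> \<in> hinf \<Longrightarrow> hmul \<psi> (f + g) = hmul \<psi> f + hmul \<psi> g"
  and hmul_diff: "\<psi> \<in> hinf \<Longrightarrow> hmul \<psi> (f - g) = hmul \<psi> f - hmul \<psi> g"
  and hmul_scaleR: "\<psi> \<in> hinf \<Longrightarrow> hmul \<psi> (r *\<^sub>R f) = r *\<^sub>R hmul \<psi> f"
  by (rule h2_eqI; simp add: hfun_hmul hfun_simps algebra_simps)+

lemma hmul_zero [simp]: "\<psi> \<in> hinf \<Longrightarrow> hmul \<psi> 0 = 0"
  by (rule h2_eqI) (simp add: hfun_hmul hfun_zero)

lemma hmul_hmul: "\<psi> \<in> hinf \<Longrightarrow> \<theta> \<in> hinf \<Longrightarrow> hmul \<psi> (hmul \<theta> f) = hmul (\<lambda>z. \<psi> z * \<theta> z) f"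
  by (rule h2_eqI) (simp add: hfun_hmul)

lemma hmul_commute: "\<psi> \<in> hinf \<Longrightarrow> \<theta> \<in> hinf \<Longrightarrow> hmul \<psi> (hmul \<theta> f) = hmul \<theta> (hmul \<psi> f)"
  by (simp add: hmul_hmul mult.commute)

lemma hmul_cong: "(\<And>z. z \<in> disc \<Longrightarrow> \<psi> z = \<theta> z) \<Longrightarrow> hmul \<psi> f = hmul \<theta> f"
  unfolding hmul_def by (rule arg_cong[of _ _ Abs_h2]) auto

lemma hmul_1 [simp]: "hmul (\<lambda>z. 1) f = f"
  by (rule h2_eqI) (simp add: hfun_hmul)

lemma hmul_0_left [simp]: "hmul (\<lambda>z. 0) f = 0"
  by (rule h2_eqI) (simp add: hfun_hmul hfun_zero)

lemma bounded_linear_hmul: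
  assumes "\<psi> \<in> hinf"
  shows "bounded_linear (hmul \<psi>)"
proof -
  obtain C where C: "\<And>z. z \<in> disc \<Longrightarrow> norm (\<psi> z) \<le> C" using hinf_bound[OF assms] by metis
  show ?thesis
    by (rule bounded_linear_intro[of _ C])
       (use norm_hmul_le[OF hinf_holo[OF assms] C] in \<open>auto simp: hmul_add hmul_scaleR assms mult.commute\<close>)
qed

lemmas tendsto_hmul = bounded_linear.tendsto[OF bounded_linear_hmul]

lemma continuous_on_hmul [continuous_intros]:
  "\<psi> \<in> hinf \<Longrightarrow> continuous_on S f \<Longrightarrow> continuous_on S (\<lambda>x. hmul \<psi> (f x))"
  by (rule bounded_linear.continuous_on[OF bounded_linear_hmul])

lemma hco_eqI:
  assumes "\<And>z. z \<in> disc \<Longrightarrow> (\<lambda>n. a n * z ^ n) sums hfun f z"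
  shows "hco f n = a n"
  unfolding hco_def by (rule tcoeff_eqI) (rule assms)

lemma hco_const: "hco (hmul (\<lambda>z. c) f) n = c * hco f n"
  by (rule hco_eqI) (auto simp: hfun_hmul mult.assoc intro!: sums_mult hco_sums)

lemma hco_shift: "hco (hmul (\<lambda>z. z) f) n = (case n of 0 \<Rightarrow> 0 | Suc k \<Rightarrow> hco f k)"
proof (rule hco_eqI)
  fix z assume z: "z \<in> disc"
  have "(\<lambda>n. z * (hco f n * z ^ n)) sums (z * hfun f z)" by (intro sums_mult hco_sums z)
  then have "(\<lambda>n. (case Suc n of 0 \<Rightarrow> 0 | Suc k \<Rightarrow> hco f k) * z ^ Suc n) sums (z * hfun f z)"
    by (simp add: mult_ac)
  from sums_Suc[OF this] show "(\<lambda>n. (case n of 0 \<Rightarrow> 0 | Suc k \<Rightarrow> hco f k) * z ^ n) sums hfun (hmul (\<lambda>z. z) f) z"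
    using z by (simp add: hfun_hmul)
qed

text \<open>The constant 1 on the disc; applying \<open>hmul \<psi>\<close> to it turns a bounded
  holomorphic function into an element of \<open>h2\<close>.\<close>

definition hone :: h2 where "hone = h2_of (\<lambda>n. if n = 0 then 1 else 0)"

lemma hfun_hone: "z \<in> disc \<Longrightarrow> hfun hone z = 1"
  and hco_hone: "hco hone n = (if n = 0 then 1 else 0)"
proof -
  have s: "summable (\<lambda>n. (norm (if n = 0 then 1 else 0 :: complex))\<^sup>2)"
    by (rule summable_finite[of "{0}"]) auto
  show h: "hco hone n = (if n = 0 then 1 else 0)" for n unfolding hone_def by (rule hco_h2_of[OF s])
  show "hfun hone z = 1" if "z \<in> disc"
    using hco_sums[OF that, of hone] sums_single[of 0 "\<lambda>n. z ^ n"]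
    by (simp add: h if_distrib[of "\<lambda>x. x * _"] sums_iff cong: if_cong)
qed

abbreviation hpoly :: "complex poly \<Rightarrow> h2" where "hpoly P \<equiv> hmul (poly P) hone"

lemma hco_hpoly: "hco (hpoly P) n = coeff P n"
proof (rule hco_eqI)
  fix z assume z: "z \<in> disc"
  have "(\<lambda>n. coeff P n * z ^ n) sums (\<Sum>n\<le>degree P. coeff P n * z ^ n)"
    by (rule sums_finite) (auto simp: coeff_eq_0)
  then show "(\<lambda>n. coeff P n * z ^ n) sums hfun (hpoly P) z"
    using z by (simp add: hfun_hmul hfun_hone poly_altdef)
qed

lemma norm_hpoly: "(norm (hpoly P))\<^sup>2 = (\<Sum>n\<le>degree P. (norm (coeff P n))\<^sup>2)"
  unfolding norm_h2_power2 hco_hpoly by (rule suminf_finite) (auto simp: coeff_eq_0)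

section \<open>The shift as an isometry, and complex scalars under the real inner product\<close>

abbreviation hshift :: "h2 \<Rightarrow> h2" where "hshift \<equiv> hmul (\<lambda>z. z)"

lemma inner_shift: "inner (hshift f) (hshift g) = inner f g"
proof -
  have "(\<Sum>n. hco (hshift f) n * cnj (hco (hshift g) n)) = (\<Sum>n. hco f n * cnj (hco g n))"
    using suminf_split_head[OF hco_product_summable[of "hshift f" "hshift g"]]
    by (simp add: hco_shift)
  then show ?thesis by (simp add: inner_h2_def)
qed

lemma norm_shift: "norm (hshift f) = norm f"
  by (simp add: norm_eq_sqrt_inner inner_shift)

lemma shift_eq_iff: "hshift f = hshift g \<longleftrightarrow> f = g"
proof
  assume "hshift f = hshift g"
  then have "hshift (f - g) = 0" by (simp add: hmul_diff)
  then have "norm (f - g) = 0" using norm_shift[of "f - g"] by simp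
  then show "f = g" by simp
qed simp

lemma shift_exists:
  assumes "hfun f 0 = 0"
  obtains g where "f = hshift g"
proof
  have s: "summable (\<lambda>n. (norm (hco f (Suc n)))\<^sup>2)" using hco_summable[of f] by (subst summable_Suc_iff)
  show "f = hshift (h2_of (\<lambda>n. hco f (Suc n)))"
    by (rule h2_coeff_eqI) (use assms in \<open>auto simp: hco_shift hco_h2_of[OF s] hco_0 split: nat.splits\<close>)
qed

lemma inner_const: "inner (hmul (\<lambda>z. c) f) g = inner f (hmul (\<lambda>z. cnj c) g)"
  by (simp add: inner_h2_def hco_const mult_ac)

lemma norm_const: "norm (hmul (\<lambda>z. c) f) = norm c * norm f"
proof -
  have "(norm (hmul (\<lambda>z. c) f))\<^sup>2 = (norm c * norm f)\<^sup>2"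
    by (simp add: norm_h2_power2 hco_const norm_mult power_mult_distrib suminf_mult hco_summable)
  then show ?thesis by (simp add: power2_eq_iff_nonneg)
qed

text \<open>Conjugate linearity in the second argument turns the imaginary part of the complex inner
  product into the real inner product with \<open>\<i> g\<close>.\<close>

lemma h2_inner_conv: "h2_inner (hfun f) (hfun g) = Complex (inner f g) (inner f (hmul (\<lambda>z. \<i>) g))"
proof -
  define w where "w = (\<Sum>n. hco f n * cnj (hco g n))"
  have "(\<Sum>n. hco f n * cnj (hco (hmul (\<lambda>z. \<i>) g) n)) = (\<Sum>n. - \<i> * (hco f n * cnj (hco g n)))"
    by (simp add: hco_const mult_ac)
  also have "\<dots> = - \<i> * w" unfolding w_def by (rule suminf_mult[OF hco_product_summable])
  finally show ?thesis by (simp add: inner_h2_def h2_inner_def hco_def[symmetric] w_def complex_eq_iff)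
qed

lemma h2_norm_conv: "h2_norm (hfun f) = norm f"
  by (simp add: h2_norm_def norm_eq_sqrt_inner inner_h2_self hco_def)

text \<open>Density of the polynomials as a proof rule: the squared distance to a Taylor truncation
  is a tail of the coefficient series.\<close>

lemma h2_closed_dense:
  assumes "closed A" "\<And>P. hpoly P \<in> A"
  shows "f \<in> A"
proof -
  define P where "P N = (\<Sum>n<N. monom (hco f n) n)" for N
  have cP: "coeff (P N) n = (if n < N then hco f n else 0)" for N n
    by (simp add: P_def coeff_sum if_distrib cong: if_cong)
  have "(norm (f - hpoly (P N)))\<^sup>2 = (norm f)\<^sup>2 - (\<Sum>n<N. (norm (hco f n))\<^sup>2)" for N
  proof -
    have "(\<Sum>n. (norm (hco (f - hpoly (P N)) n))\<^sup>2) = (\<Sum>n. (norm (hco (f - hpoly (P N)) (n + N)))\<^sup>2) + (\<Sum>n<N. (norm (hco (f - hpoly (P N)) n))\<^sup>2)"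
      by (rule suminf_split_initial_segment[OF hco_summable])
    also have "\<dots> = (\<Sum>n. (norm (hco f (n + N)))\<^sup>2)"
      by (simp add: hco_minus hco_hpoly cP)
    also have "\<dots> = (\<Sum>n. (norm (hco f n))\<^sup>2) - (\<Sum>n<N. (norm (hco f n))\<^sup>2)"
      by (rule suminf_minus_initial_segment[OF hco_summable])
    finally show ?thesis by (simp add: norm_h2_power2)
  qed
  moreover have "(\<lambda>N. (norm f)\<^sup>2 - (\<Sum>n<N. (norm (hco f n))\<^sup>2)) \<longlonglongrightarrow> (norm f)\<^sup>2 - (norm f)\<^sup>2"
    using summable_sums[OF hco_summable[of f]] unfolding norm_h2_power2 sums_def by (intro tendsto_diff tendsto_const)
  ultimately have "(\<lambda>N. (norm (f - hpoly (P N)))\<^sup>2) \<longlonglongrightarrow> 0" by simp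
  then have "(\<lambda>N. sqrt ((norm (f - hpoly (P N)))\<^sup>2)) \<longlonglongrightarrow> sqrt 0" by (rule tendsto_real_sqrt)
  then have "(\<lambda>N. norm (hpoly (P N) - f)) \<longlonglongrightarrow> 0"
    unfolding real_sqrt_abs abs_norm_cancel real_sqrt_zero norm_minus_commute[of f] .
  then have "(\<lambda>N. hpoly (P N)) \<longlonglongrightarrow> f" by (rule LIM_zero_cancel[OF tendsto_norm_zero_cancel])
  then show ?thesis using closed_sequentially[OF assms(1), of "\<lambda>N. hpoly (P N)"] assms(2) by blast
qed

text \<open>Cauchy-Schwarz against the reproducing kernel at \<open>w\<close>, whose squared norm is
  \<open>1 / (1 - |w|^2)\<close>. Replacing coefficients by their moduli lets the real inner product
  bound the absolutely convergent series.\<close>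

lemma h2_eval_bound:
  assumes w: "w \<in> disc"
  shows "norm (hfun f w) * sqrt (1 - (norm w)\<^sup>2) \<le> norm f"
proof -
  have w1: "(norm w)\<^sup>2 < 1" using w by (simp add: power_less_one_iff)
  define a b where "a n = complex_of_real (norm (hco f n))" and "b n = complex_of_real (norm w ^ n)" for n
  have sa: "summable (\<lambda>n. (norm (a n))\<^sup>2)" using hco_summable[of f] by (simp add: a_def)
  have "(\<lambda>n. ((norm w)\<^sup>2) ^ n) sums (1 / (1 - (norm w)\<^sup>2))" using w1 by (intro geometric_sums) auto
  then have bs: "(\<lambda>n. (norm (b n))\<^sup>2) sums (1 / (1 - (norm w)\<^sup>2))"
    by (simp add: b_def norm_power power_mult[symmetric] mult.commute)
  then have sb: "summable (\<lambda>n. (norm (b n))\<^sup>2)" by (simp add: sums_iff)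
  have nb: "norm (h2_of b) = 1 / sqrt (1 - (norm w)\<^sup>2)"
  proof -
    have "(norm (h2_of b))\<^sup>2 = 1 / (1 - (norm w)\<^sup>2)"
      unfolding norm_h2_power2 hco_h2_of[OF sb] using bs by (simp add: sums_iff)
    then show ?thesis by (metis norm_ge_zero real_sqrt_abs abs_of_nonneg real_sqrt_divide real_sqrt_one)
  qed
  have na: "norm (h2_of a) = norm f"
  proof -
    have "(norm (h2_of a))\<^sup>2 = (norm f)\<^sup>2"
      unfolding norm_h2_power2 hco_h2_of[OF sa] by (simp add: a_def)
    then show ?thesis by (simp add: power2_eq_iff_nonneg)
  qed
  have "inner (h2_of a) (h2_of b) = (\<Sum>n. norm (hco f n * w ^ n))"
  proof -
    have sm: "summable (\<lambda>n. norm (hco f n * w ^ n))"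
      using summable_norm_product[OF sa sb] by (simp add: a_def b_def norm_mult norm_power)
    have "(\<Sum>n. a n * cnj (b n)) = (\<Sum>n. complex_of_real (norm (hco f n * w ^ n)))"
      by (simp add: a_def b_def norm_mult norm_power)
    also have "\<dots> = of_real (\<Sum>n. norm (hco f n * w ^ n))" by (rule suminf_of_real[OF sm, symmetric])
    finally show ?thesis by (simp add: inner_h2_def hco_h2_of[OF sa] hco_h2_of[OF sb])
  qed
  moreover have "norm (hfun f w) \<le> (\<Sum>n. norm (hco f n * w ^ n))"
    using summable_norm[of "\<lambda>n. hco f n * w ^ n"] summable_norm_product[OF sa sb] hco_sums[OF w, of f]
    by (simp add: a_def b_def norm_mult norm_power sums_iff)
  ultimately have "norm (hfun f w) \<le> norm f * (1 / sqrt (1 - (norm w)\<^sup>2))"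
    using norm_cauchy_schwarz[of "h2_of a" "h2_of b"] by (simp add: na nb)
  then show ?thesis using w1 by (simp add: field_simps)
qed

text \<open>Testing the multiplier on truncations of the reproducing kernel at \<open>w\<close>.\<close>
lemma multiplier_bounded:
  assumes mult: "\<And>P. norm (hmul (poly P) f) \<le> C * norm (hpoly P)" and w: "w \<in> disc"
  shows "norm (hfun f w) \<le> C"
proof -
  have w1: "(norm w)\<^sup>2 < 1" using w by (simp add: power_less_one_iff)
  define P where "P N = (\<Sum>n<Suc N. monom (cnj w ^ n) n)" for N
  define \<sigma> where "\<sigma> N = (\<Sum>n<Suc N. ((norm w)\<^sup>2) ^ n)" for N
  have cP: "coeff (P N) n = (if n < Suc N then cnj w ^ n else 0)" for N n
    unfolding P_def coeff_sum coeff_monom by simp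
  have \<sigma>0: "\<sigma> N > 0" for N
    unfolding \<sigma>_def sum.lessThan_Suc_shift by (simp add: add_pos_nonneg sum_nonneg)
  have nP: "(norm (hpoly (P N)))\<^sup>2 = \<sigma> N" for N
  proof -
    have "(norm (hpoly (P N)))\<^sup>2 = (\<Sum>n. (norm (coeff (P N) n))\<^sup>2)" by (simp add: norm_h2_power2 hco_hpoly)
    also have "\<dots> = (\<Sum>n<Suc N. (norm (coeff (P N) n))\<^sup>2)" by (rule suminf_finite) (auto simp: cP)
    also have "\<dots> = \<sigma> N" unfolding \<sigma>_def
      by (intro sum.cong) (auto simp: cP norm_power power_mult[symmetric] mult.commute)
    finally show ?thesis .
  qed
  have eP: "poly (P N) w = of_real (\<sigma> N)" for N
  proof -
    have "cnj w ^ n * w ^ n = of_real (((norm w)\<^sup>2) ^ n)" for n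
      unfolding of_real_power[of "(norm w)\<^sup>2"] complex_norm_square power_mult_distrib by (rule mult.commute)
    then show ?thesis unfolding P_def \<sigma>_def poly_sum poly_monom of_real_sum by (intro sum.cong refl)
  qed
  define s where "s = sqrt (1 - (norm w)\<^sup>2)"
  have s: "s > 0" using w1 by (simp add: s_def)
  \<comment> \<open>The value of \<open>P N\<close> at \<open>w\<close> equals its squared norm
    \<open>\<sigma> N\<close>, so evaluating at \<open>w\<close> leaves one factor
    \<open>sqrt (\<sigma> N)\<close>. It tends to \<open>1 / s\<close>, which cancels the factor
    \<open>s\<close> lost in \<open>h2_eval_bound\<close>.\<close>
  have "norm (hfun f w) * sqrt (\<sigma> N) * s \<le> C" for N
  proof -
    have "norm (hfun (hmul (poly (P N)) f) w) * s \<le> norm (hmul (poly (P N)) f)"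
      unfolding s_def by (rule h2_eval_bound[OF w])
    also have "\<dots> \<le> C * norm (hpoly (P N))" by (rule mult)
    also have "norm (hpoly (P N)) = sqrt (\<sigma> N)" using nP[of N] by (metis norm_ge_zero real_sqrt_abs abs_of_nonneg)
    finally have "\<sigma> N * norm (hfun f w) * s \<le> C * sqrt (\<sigma> N)"
      using w \<sigma>0[of N] by (simp add: hfun_hmul eP norm_mult)
    moreover have "\<sigma> N = sqrt (\<sigma> N) * sqrt (\<sigma> N)" using \<sigma>0[of N] by simp
    ultimately have "sqrt (\<sigma> N) * (norm (hfun f w) * sqrt (\<sigma> N) * s) \<le> sqrt (\<sigma> N) * C"
      by (metis mult.assoc mult.commute)
    then show ?thesis using \<sigma>0[of N] by simp
  qed
  moreover have "(\<lambda>N. norm (hfun f w) * sqrt (\<sigma> N) * s) \<longlonglongrightarrow> norm (hfun f w) * (1 / s) * s"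
  proof -
    have "(\<lambda>n. ((norm w)\<^sup>2) ^ n) sums (1 / (1 - (norm w)\<^sup>2))" using w1 by (intro geometric_sums) auto
    then have "(\<lambda>N. \<sigma> N) \<longlonglongrightarrow> 1 / (1 - (norm w)\<^sup>2)"
      unfolding sums_def \<sigma>_def by (rule LIMSEQ_Suc)
    then have "(\<lambda>N. sqrt (\<sigma> N)) \<longlonglongrightarrow> sqrt (1 / (1 - (norm w)\<^sup>2))" by (rule tendsto_real_sqrt)
    then show ?thesis by (intro tendsto_intros) (simp add: s_def real_sqrt_divide)
  qed
  ultimately have "norm (hfun f w) * (1 / s) * s \<le> C" by (intro LIMSEQ_le_const2) auto
  then show ?thesis using s by simp
qed

section \<open>Inner functions\<close>

lemma circle_mean_tendsto_AE:
  assumes g: "continuous_on disc g" and B: "\<And>z. z \<in> disc \<Longrightarrow> \<bar>g z\<bar> \<le> B"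
    and u: "u \<in> borel_measurable circle_measure"
    and lim: "AE t in circle_measure. (\<lambda>k. g (of_real (radius k) * cis t)) \<longlonglongrightarrow> u t"
  shows "integrable circle_measure u"
    and "(\<lambda>k. circle_mean (radius k) g) \<longlonglongrightarrow> integral\<^sup>L circle_measure u / (2 * pi)"
proof -
  have m: "(\<lambda>t. g (of_real (radius k) * cis t)) \<in> borel_measurable circle_measure" for k
    by (intro borel_measurable_integrable circle_integrable g radius_bounds)
  have i: "integrable circle_measure (\<lambda>t. B)"
    by (rule continuous_imp_integrable_real) (intro continuous_intros)
  have b: "AE t in circle_measure. norm (g (of_real (radius k) * cis t)) \<le> B" for k
    using B radius_bounds by (intro AE_I2) (simp add: norm_mult)
  show "integrable circle_measure u"
    by (rule integrable_dominated_convergence[OF u m i lim b])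
  show "(\<lambda>k. circle_mean (radius k) g) \<longlonglongrightarrow> integral\<^sup>L circle_measure u / (2 * pi)"
    unfolding circle_mean_def by (intro tendsto_divide tendsto_const integral_dominated_convergence[OF u m i lim b]) simp
qed

lemma circle_mean_hmul_tendsto:
  assumes "\<psi> \<in> hinf"
  shows "(\<lambda>k. circle_mean (radius k) (\<lambda>z. (norm (\<psi> z * hfun f z))\<^sup>2)) \<longlonglongrightarrow> (norm (hmul \<psi> f))\<^sup>2"
proof -
  have "circle_mean (radius k) (\<lambda>z. (norm (\<psi> z * hfun f z))\<^sup>2) =
        square_mean (radius k) (hfun (hmul \<psi> f))" for k
    unfolding circle_mean_def using radius_bounds[of k] by (simp add: hfun_hmul[OF assms] norm_mult)
  then show ?thesis using circle_mean_h2_tendsto[of "hmul \<psi> f"] by simp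
qed

lemma hmul_isometry_if_poly:
  assumes \<psi>: "\<psi> \<in> hinf" and P: "\<And>P. norm (hmul \<psi> (hpoly P)) = norm (hpoly P)"
  shows "norm (hmul \<psi> f) = norm f"
proof -
  have "f \<in> {f. norm (hmul \<psi> f) = norm f}"
    by (rule h2_closed_dense) (use P in \<open>auto intro!: closed_Collect_eq continuous_intros \<psi>\<close>)
  then show ?thesis by simp
qed

lemma inner_fn_hinf: "inner_fn p \<Longrightarrow> p \<in> hinf"
  by (simp add: inner_fn_def)

text \<open>For a polynomial \<open>P\<close> the function \<open>|P|^2 - |p P|^2\<close> is bounded
  with radial limit 0 almost everywhere, so its means tend to 0; they also tend to the difference of
  the squared norms. Boundedness is the reason for starting with polynomials.\<close>

lemma inner_fn_isometry:
  assumes p: "inner_fn p"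
  shows "norm (hmul p f) = norm f"
proof (rule hmul_isometry_if_poly)
  show ph: "p \<in> hinf" using p by (rule inner_fn_hinf)
  fix P
  define g where "g z = (norm (poly P z))\<^sup>2 - (norm (p z * poly P z))\<^sup>2" for z
  have pc: "continuous_on disc p" by (intro holomorphic_on_imp_continuous_on hinf_holo ph)
  obtain C where C: "C \<ge> 0" "\<And>z. z \<in> disc \<Longrightarrow> norm (poly P z) \<le> C" using hinf_bound[OF hinf_poly] by metis
  obtain D where D: "D \<ge> 0" "\<And>z. z \<in> disc \<Longrightarrow> norm (p z) \<le> D" using hinf_bound[OF ph] by metis
  have "(\<lambda>k. circle_mean (radius k) g) \<longlonglongrightarrow> integral\<^sup>L circle_measure (\<lambda>t. 0) / (2 * pi)"
  proof (rule circle_mean_tendsto_AE)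
    show "continuous_on disc g" unfolding g_def by (intro continuous_intros pc)
    show "\<bar>g z\<bar> \<le> C\<^sup>2 + (D * C)\<^sup>2" if "z \<in> disc" for z
    proof -
      have "(norm (poly P z))\<^sup>2 \<le> C\<^sup>2" using C that by (intro power_mono) auto
      moreover have "norm (p z) * norm (poly P z) \<le> D * C" using C D that by (intro mult_mono) auto
      then have "(norm (p z * poly P z))\<^sup>2 \<le> (D * C)\<^sup>2" unfolding norm_mult by (intro power_mono) auto
      ultimately show ?thesis unfolding g_def
        using zero_le_power2[of "norm (poly P z)"] zero_le_power2[of "norm (p z * poly P z)"] by linarith
    qed
    have "AE t in circle_measure. \<exists>w. norm w = 1 \<and> ((\<lambda>r. p (of_real r * cis t)) \<longlongrightarrow> w) (at_left 1)"
      using p by (simp add: inner_fn_def)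
    then show "AE t in circle_measure. (\<lambda>k. g (of_real (radius k) * cis t)) \<longlonglongrightarrow> 0"
    proof eventually_elim
      case (elim t)
      then obtain w where w: "norm w = 1" "((\<lambda>r. p (of_real r * cis t)) \<longlongrightarrow> w) (at_left 1)" by blast
      have pl: "(\<lambda>k. p (of_real (radius k) * cis t)) \<longlonglongrightarrow> w"
        using filterlim_compose[OF w(2) radius_filterlim] .
      have Pl: "(\<lambda>k. poly P (of_real (radius k) * cis t)) \<longlonglongrightarrow> poly P (of_real 1 * cis t)"
        by (intro tendsto_intros radius_tendsto)
      have "(\<lambda>k. g (of_real (radius k) * cis t)) \<longlonglongrightarrow> (norm (poly P (of_real 1 * cis t)))\<^sup>2 - (norm (w * poly P (of_real 1 * cis t)))\<^sup>2"
        unfolding g_def by (intro tendsto_intros pl Pl)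
      then show ?case using w by (simp add: norm_mult)
    qed
  qed auto
  moreover have "(\<lambda>k. circle_mean (radius k) g) \<longlonglongrightarrow> (norm (hpoly P))\<^sup>2 - (norm (hmul p (hpoly P)))\<^sup>2"
  proof -
    have "circle_mean (radius k) g = circle_mean (radius k) (\<lambda>z. (norm (poly P z * hfun hone z))\<^sup>2) -
        circle_mean (radius k) (\<lambda>z. (norm ((p z * poly P z) * hfun hone z))\<^sup>2)" for k
    proof -
      have "circle_mean (radius k) g = circle_mean (radius k) (\<lambda>z. (norm (poly P z * hfun hone z))\<^sup>2 - (norm ((p z * poly P z) * hfun hone z))\<^sup>2)"
        unfolding circle_mean_def using radius_bounds[of k] by (simp add: g_def norm_mult hfun_hone)
      also have "\<dots> = circle_mean (radius k) (\<lambda>z. (norm (poly P z * hfun hone z))\<^sup>2) -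
        circle_mean (radius k) (\<lambda>z. (norm ((p z * poly P z) * hfun hone z))\<^sup>2)"
        by (intro circle_mean_diff continuous_intros pc holomorphic_on_imp_continuous_on[OF hfun_holo] radius_bounds)
      finally show ?thesis .
    qed
    moreover have "hmul p (hpoly P) = hmul (\<lambda>z. p z * poly P z) hone" by (simp add: hmul_hmul ph)
    ultimately show ?thesis
      using tendsto_diff[OF circle_mean_hmul_tendsto[of "poly P" hone] circle_mean_hmul_tendsto[of "\<lambda>z. p z * poly P z" hone]]
      by (simp add: ph)
  qed
  ultimately have "(norm (hpoly P))\<^sup>2 - (norm (hmul p (hpoly P)))\<^sup>2 = 0" using LIMSEQ_unique by fastforce
  then show "norm (hmul p (hpoly P)) = norm (hpoly P)" by (simp add: power2_eq_iff_nonneg)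
qed

text \<open>Multiplications commute, so \<open>hmul p hone\<close> meets the hypothesis of
  \<open>multiplier_bounded\<close> with constant 1.\<close>

lemma isometry_norm_le_1:
  assumes p: "p \<in> hinf" "\<And>f. norm (hmul p f) = norm f" and z: "z \<in> disc"
  shows "norm (p z) \<le> 1"
proof -
  have "norm (hfun (hmul p hone) z) \<le> 1"
  proof (rule multiplier_bounded[OF _ z])
    show "norm (hmul (poly P) (hmul p hone)) \<le> 1 * norm (hpoly P)" for P
      using p by (simp add: hmul_commute[of "poly P" p])
  qed
  then show ?thesis using z p by (simp add: hfun_hmul hfun_hone)
qed

lemma isometry_inner:
  assumes p: "p \<in> hinf" "\<And>f. norm (hmul p f) = norm f"
  shows "inner (hmul p f) (hmul p g) = inner f g"
  by (simp add: dot_norm hmul_add[OF p(1), symmetric] p(2))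

lemma isometry_range:
  assumes p: "p \<in> hinf" "\<And>f. norm (hmul p f) = norm f"
  shows "subspace (range (hmul p))" "closed (range (hmul p))"
proof -
  have "linear (hmul p)" using bounded_linear_hmul[OF p(1)] by (rule bounded_linear.linear)
  then show "subspace (range (hmul p))" by (intro linear_subspace_image) auto
  have "complete (range (hmul p))"
    by (rule complete_isometric_image[of 1]) (use p bounded_linear_hmul in \<open>auto simp: complete_UNIV\<close>)
  then show "closed (range (hmul p))" by (rule complete_imp_closed)
qed

text \<open>Radial limits \<open>L\<close> exist by Fatou's theorem and have modulus at most 1,
  while the mean of \<open>1 - |L|^2\<close> is \<open>1 - (norm f)^2 = 0\<close>. A nonnegative
  function with zero integral vanishes almost everywhere.\<close>

lemma inner_fnI:
  assumes P: "\<And>P. norm (hmul (poly P) f) = norm (hpoly P)"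
  shows "inner_fn (hfun f)"
proof -
  have le1: "norm (hfun f z) \<le> 1" if "z \<in> disc" for z
    by (rule multiplier_bounded[OF _ that]) (use P in simp)
  have fh: "hfun f \<in> hinf" using le1 by (rule hinf_hfun)
  have "poly 1 = (\<lambda>z. 1 :: complex)" by auto
  then have "(norm f)\<^sup>2 = 1\<^sup>2" using P[of 1] norm_hpoly[of 1] by simp
  then have n1: "norm f = 1" by (subst (asm) power2_eq_iff_nonneg) auto
  have "AE t in circle_measure. \<exists>w. ((\<lambda>r. hfun f (of_real r * cis t)) \<longlongrightarrow> w) (at_left 1)"
    by (rule fatou_radial_limit[OF hco_summable]) (use hco_sums in auto)
  \<comment> \<open>Taken along the sequence \<open>radius\<close>, which makes it measurable; it
    agrees with the radial limit wherever that exists.\<close>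
  define L where "L t = lim (\<lambda>k. hfun f (of_real (radius k) * cis t))" for t
  define u where "u t = 1 - (norm (L t))\<^sup>2" for t
  have fc: "continuous_on disc (hfun f)" by (intro holomorphic_on_imp_continuous_on) simp
  have [measurable]: "(\<lambda>t. hfun f (of_real (radius k) * cis t)) \<in> borel_measurable circle_measure" for k
    by (intro borel_measurable_integrable circle_integrable fc radius_bounds)
  have [measurable]: "L \<in> borel_measurable circle_measure" unfolding L_def by measurable
  have um: "u \<in> borel_measurable circle_measure" unfolding u_def by measurable
  have lim: "AE t in circle_measure. ((\<lambda>r. hfun f (of_real r * cis t)) \<longlongrightarrow> L t) (at_left 1) \<and>
      (\<lambda>k. hfun f (of_real (radius k) * cis t)) \<longlonglongrightarrow> L t"
    using \<open>AE t in circle_measure. \<exists>w. _ t w\<close>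
  proof eventually_elim
    case (elim t)
    then obtain w where w: "((\<lambda>r. hfun f (of_real r * cis t)) \<longlongrightarrow> w) (at_left 1)" by blast
    have l: "(\<lambda>k. hfun f (of_real (radius k) * cis t)) \<longlonglongrightarrow> w"
      using filterlim_compose[OF w radius_filterlim] .
    then have "L t = w" unfolding L_def by (rule limI)
    then show ?case using w l by simp
  qed
  have "AE t in circle_measure. 0 \<le> u t"
    using lim
  proof eventually_elim
    case (elim t)
    have "norm (L t) \<le> 1"
      by (rule LIMSEQ_le_const2[OF tendsto_norm[OF conjunct2[OF elim]]])
         (use le1 radius_bounds in \<open>auto simp: norm_mult\<close>)
    then show ?case unfolding u_def by (simp add: power_le_one)
  qed
  moreover have lim': "AE t in circle_measure. (\<lambda>k. 1 - (norm (hfun f (of_real (radius k) * cis t)))\<^sup>2) \<longlonglongrightarrow> u t"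
    using lim unfolding u_def by eventually_elim (auto intro!: tendsto_intros)
  have c: "continuous_on disc (\<lambda>z. 1 - (norm (hfun f z))\<^sup>2)" by (intro continuous_intros fc)
  have b: "\<bar>1 - (norm (hfun f z))\<^sup>2\<bar> \<le> 1" if "z \<in> disc" for z
    using le1[OF that] by (simp add: power_le_one)
  have "integral\<^sup>L circle_measure u = 0"
  proof -
    have "(\<lambda>k. circle_mean (radius k) (\<lambda>z. 1) - square_mean (radius k) (hfun f)) \<longlonglongrightarrow> 1 - (norm f)\<^sup>2"
      unfolding circle_mean_const by (intro tendsto_diff tendsto_const circle_mean_h2_tendsto)
    moreover have "circle_mean (radius k) (\<lambda>z. 1) - square_mean (radius k) (hfun f) = circle_mean (radius k) (\<lambda>z. 1 - (norm (hfun f z))\<^sup>2)" for k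
      by (intro circle_mean_diff[symmetric] continuous_intros fc radius_bounds)
    ultimately have "(\<lambda>k. circle_mean (radius k) (\<lambda>z. 1 - (norm (hfun f z))\<^sup>2)) \<longlonglongrightarrow> 0" using n1 by simp
    from LIMSEQ_unique[OF this circle_mean_tendsto_AE(2)[OF c b um lim']] show ?thesis by simp
  qed
  ultimately have "AE t in circle_measure. u t = 0"
    using integral_nonneg_eq_0_iff_AE[OF circle_mean_tendsto_AE(1)[OF c b um lim']] by blast
  then have "AE t in circle_measure. (\<exists>w. norm w = 1 \<and> ((\<lambda>r. hfun f (of_real r * cis t)) \<longlongrightarrow> w) (at_left 1))"
    using lim
  proof eventually_elim
    case (elim t)
    then have "(norm (L t))\<^sup>2 = 1\<^sup>2" by (simp add: u_def)
    then have "norm (L t) = 1" by (subst (asm) power2_eq_iff_nonneg) auto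
    then show ?case using elim by blast
  qed
  then show ?thesis using fh by (simp add: inner_fn_def)
qed

text \<open>By the uniform bound on the operators, one point of the set close to \<open>x\<close>
  controls all \<open>T k x\<close> simultaneously.\<close>

lemma closed_bounded_tendsto_zero:
  fixes T :: "nat \<Rightarrow> 'a::real_normed_vector \<Rightarrow> 'b::real_normed_vector"
  assumes diff: "\<And>k x y. T k (x - y) = T k x - T k y" and c: "\<And>k x. norm (T k x) \<le> c * norm x"
  shows "closed {x. (\<lambda>k. T k x) \<longlonglongrightarrow> 0}"
  unfolding closed_sequential_limits
proof (intro allI impI, elim conjE)
  fix X x assume X: "\<forall>n. X n \<in> {x. (\<lambda>k. T k x) \<longlonglongrightarrow> 0}" and l: "X \<longlonglongrightarrow> x"
  define C where "C = \<bar>c\<bar> + 1"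
  have C: "C > 0" "\<And>k x. norm (T k x) \<le> C * norm x"
  proof -
    fix k and x :: 'a
    have "c * norm x \<le> C * norm x" unfolding C_def by (intro mult_right_mono) auto
    then show "norm (T k x) \<le> C * norm x" using c[of k x] by linarith
  qed (simp add: C_def)
  show "x \<in> {x. (\<lambda>k. T k x) \<longlonglongrightarrow> 0}"
  proof (clarify, rule LIMSEQ_I)
    fix e :: real assume e: "e > 0"
    then obtain n where n: "norm (X n - x) < e / (2 * C)"
      using l C unfolding LIMSEQ_iff by (metis divide_pos_pos mult_pos_pos order_refl zero_less_numeral)
    have "(\<lambda>k. T k (X n)) \<longlonglongrightarrow> 0" using X by blast
    then obtain K where K: "\<And>k. k \<ge> K \<Longrightarrow> norm (T k (X n)) < e / 2"
      unfolding LIMSEQ_iff using e by (metis diff_zero half_gt_zero)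
    show "\<exists>K. \<forall>k\<ge>K. norm (T k x - 0) < e"
    proof (intro exI[of _ K] allI impI)
      fix k assume "k \<ge> K"
      have "norm (T k (X n - x)) \<le> C * norm (X n - x)" by (rule C)
      also have "\<dots> < e / 2" using n C(1) by (simp add: field_simps)
      finally have "norm (T k (X n) - T k x) < e / 2" by (simp add: diff)
      then show "norm (T k x - 0) < e"
        using K[OF \<open>k \<ge> K\<close>] norm_triangle_ineq4[of "T k (X n)" "T k (X n) - T k x"] by simp
    qed
  qed
qed

text \<open>Approximate \<open>\<psi>\<close> by its dilations, which are uniform limits of polynomials.\<close>
lemma hmul_in_closure_poly:
  assumes \<psi>: "\<psi> \<in> hinf"
  shows "hmul \<psi> g \<in> closure (range (\<lambda>P. hmul (poly P) g))"
proof -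
  obtain C where C: "C \<ge> 0" "\<And>z. z \<in> disc \<Longrightarrow> norm (\<psi> z) \<le> C" using hinf_bound[OF \<psi>] by metis
  define \<delta> where "\<delta> k z = \<psi> (of_real (radius k) * z)" for k z
  have rz: "of_real (radius k) * z \<in> disc" if "z \<in> disc" for k z
  proof -
    have "radius k * norm z \<le> 1 * norm z" using radius_bounds[of k] by (intro mult_right_mono) auto
    then show ?thesis using that radius_bounds[of k] by (simp add: norm_mult)
  qed
  have \<delta>s: "(\<lambda>n. (tcoeff \<psi> n * of_real (radius k) ^ n) * z ^ n) sums \<delta> k z" if "z \<in> disc" for k z
    using tcoeff_sums[OF hinf_holo[OF \<psi>] rz[OF that, of k]] by (simp add: \<delta>_def power_mult_distrib mult.assoc)
  have \<delta>h: "\<delta> k \<in> hinf" for k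
    by (rule hinfI[OF power_series_holomorphic_disc[OF \<delta>s]]) (auto simp: \<delta>_def intro!: C(2) rz)
  define \<eta> where "\<eta> k z = \<delta> k z + (- 1) * \<psi> z" for k z
  have \<eta>h: "\<eta> k \<in> hinf" for k unfolding \<eta>_def [abs_def] by (intro hinf_add hinf_mult hinf_const \<delta>h \<psi>)
  have \<eta>C: "norm (hmul (\<eta> k) x) \<le> (2 * C) * norm x" for k x
  proof (rule norm_hmul_le[OF hinf_holo[OF \<eta>h]])
    fix z assume "z \<in> disc"
    then show "norm (\<eta> k z) \<le> 2 * C"
      unfolding \<eta>_def \<delta>_def using norm_triangle_ineq4[of "\<psi> (of_real (radius k) * z)" "\<psi> z"] C(2)[of z] C(2)[OF rz, of z k] by simp
  qed
  \<comment> \<open>Dilation multiplies coefficient \<open>n\<close> by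
    \<open>x = radius k ^ n\<close>, and \<open>(x - 1)^2 \<le> 1 - x^2\<close> on the unit
    interval. Hence the squared norm is at most the gap between \<open>(norm f)^2\<close> and the
    square mean at that radius, which closes.\<close>
  have one: "(\<lambda>k. hmul (\<eta> k) hone) \<longlonglongrightarrow> 0"
  proof -
    define f where "f = hmul \<psi> hone"
    have ff: "hfun f z = \<psi> z" if "z \<in> disc" for z using that \<psi> by (simp add: f_def hfun_hmul hfun_hone)
    have hf: "hco f n = tcoeff \<psi> n" for n
    proof (rule hco_eqI[of "tcoeff \<psi>"])
      fix z assume "z \<in> disc"
      then show "(\<lambda>n. tcoeff \<psi> n * z ^ n) sums hfun f z"
        unfolding ff[OF \<open>z \<in> disc\<close>] by (rule tcoeff_sums[OF hinf_holo[OF \<psi>]])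
    qed
    have h\<eta>: "hco (hmul (\<eta> k) hone) n = hco f n * of_real (radius k) ^ n - hco f n" for k n
    proof (rule hco_eqI)
      fix z assume z: "z \<in> disc"
      have "(\<lambda>n. hco f n * of_real (radius k) ^ n * z ^ n - hco f n * z ^ n) sums (\<delta> k z - hfun f z)"
        unfolding hf using z by (intro sums_diff \<delta>s hco_sums[of z f, unfolded hf])
      then show "(\<lambda>n. (hco f n * of_real (radius k) ^ n - hco f n) * z ^ n) sums hfun (hmul (\<eta> k) hone) z"
        using z \<eta>h by (simp add: hfun_hmul hfun_hone ff left_diff_distrib) (simp add: \<eta>_def)
    qed
    have "(norm (hmul (\<eta> k) hone))\<^sup>2 \<le> (norm f)\<^sup>2 - square_mean (radius k) (hfun f)" for k
    proof -
      have cs: "(\<lambda>n. (norm (hco f n))\<^sup>2 * radius k ^ (2 * n)) sums square_mean (radius k) (hfun f)"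
        unfolding hco_def by (rule circle_parseval[OF hfun_holo radius_bounds(1,3)])
      have "(\<Sum>n. (norm (hco (hmul (\<eta> k) hone) n))\<^sup>2) \<le> (\<Sum>n. (norm (hco f n))\<^sup>2 - (norm (hco f n))\<^sup>2 * radius k ^ (2 * n))"
      proof (rule suminf_le)
        fix n
        define x where "x = radius k ^ n"
        have x: "0 \<le> x" "x \<le> 1" using radius_bounds[of k] by (auto simp: x_def power_le_one)
        have "hco f n * of_real x - hco f n = hco f n * of_real (x - 1)" by (simp add: algebra_simps)
        then have "(norm (hco (hmul (\<eta> k) hone) n))\<^sup>2 = (norm (hco f n))\<^sup>2 * (x - 1)\<^sup>2"
          by (simp only: h\<eta> of_real_power[symmetric] x_def norm_mult norm_of_real power_mult_distrib power2_abs)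
        also have "\<dots> \<le> (norm (hco f n))\<^sup>2 * (1 - x\<^sup>2)"
        proof (intro mult_left_mono)
          have "0 \<le> 2 * (x * (1 - x))" using x by simp
          then show "(x - 1)\<^sup>2 \<le> 1 - x\<^sup>2" by (simp add: power2_eq_square algebra_simps)
        qed simp
        finally show "(norm (hco (hmul (\<eta> k) hone) n))\<^sup>2 \<le> (norm (hco f n))\<^sup>2 - (norm (hco f n))\<^sup>2 * radius k ^ (2 * n)"
          by (simp add: x_def power_mult[symmetric] mult.commute[of 2] right_diff_distrib)
      qed (use cs hco_summable in \<open>auto intro!: summable_diff simp: sums_iff\<close>)
      also have "\<dots> = (norm f)\<^sup>2 - square_mean (radius k) (hfun f)"
        using cs by (simp add: suminf_diff[symmetric] hco_summable norm_h2_power2 sums_iff)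
      finally show ?thesis by (simp add: norm_h2_power2)
    qed
    moreover have "(\<lambda>k. (norm f)\<^sup>2 - square_mean (radius k) (hfun f)) \<longlonglongrightarrow> (norm f)\<^sup>2 - (norm f)\<^sup>2"
      by (intro tendsto_diff tendsto_const circle_mean_h2_tendsto)
    ultimately have "(\<lambda>k. (norm (hmul (\<eta> k) hone))\<^sup>2) \<longlonglongrightarrow> 0"
      by (intro tendsto_sandwich[of "\<lambda>k. 0" "\<lambda>k. (norm (hmul (\<eta> k) hone))\<^sup>2" _ "\<lambda>k. (norm f)\<^sup>2 - square_mean (radius k) (hfun f)"]) auto
    from tendsto_real_sqrt[OF this] have "(\<lambda>k. norm (hmul (\<eta> k) hone)) \<longlonglongrightarrow> 0" by simp
    then show ?thesis by (rule tendsto_norm_zero_cancel)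
  qed
  \<comment> \<open>From 1 to polynomials by commuting the multipliers, from polynomials to
    \<open>g\<close> by the uniform bound \<open>2 * C\<close>.\<close>
  have "g \<in> {x. (\<lambda>k. hmul (\<eta> k) x) \<longlonglongrightarrow> 0}"
  proof (rule h2_closed_dense)
    show "closed {x. (\<lambda>k. hmul (\<eta> k) x) \<longlonglongrightarrow> 0}"
      by (rule closed_bounded_tendsto_zero[OF hmul_diff[OF \<eta>h] \<eta>C])
    show "hpoly P \<in> {x. (\<lambda>k. hmul (\<eta> k) x) \<longlonglongrightarrow> 0}" for P
      using tendsto_hmul[OF hinf_poly one, of P] by (simp add: hmul_commute[OF \<eta>h hinf_poly])
  qed
  then have lim0: "(\<lambda>k. hmul (\<eta> k) g) \<longlonglongrightarrow> 0" by simp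
  have "hmul (\<eta> k) g = hmul (\<delta> k) g - hmul \<psi> g" for k
    by (rule h2_eqI) (use \<eta>h \<delta>h \<psi> in \<open>simp add: hfun_hmul hfun_simps left_diff_distrib \<eta>_def\<close>)
  with lim0 have lim: "(\<lambda>k. hmul (\<delta> k) g) \<longlonglongrightarrow> hmul \<psi> g" by (simp add: LIM_zero_iff)
  \<comment> \<open>For fixed \<open>k\<close> the dilated series has absolutely summable
    coefficients, so its Taylor polynomials converge uniformly on the disc. The added 1 in
    \<open>d\<close> avoids a division by zero for \<open>g = 0\<close>.\<close>
  have "hmul (\<delta> k) g \<in> closure (range (\<lambda>P. hmul (poly P) g))" for k
    unfolding closure_approachable
  proof (intro allI impI)
    fix e :: real assume e: "e > 0"
    define c where "c n = tcoeff \<psi> n * of_real (radius k) ^ n" for n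
    have sc: "summable (\<lambda>n. norm (c n))"
      unfolding c_def by (rule radial_power_series(1)[OF hinf_holo[OF \<psi>] radius_bounds(1,3)])
    define d where "d = e / (norm g + 1)"
    have d: "d > 0" using e by (simp add: d_def add_nonneg_pos)
    obtain N where N: "norm (\<Sum>n. norm (c (n + N))) < d"
      using suminf_exist_split[OF d sc] by blast
    define P where "P = (\<Sum>n<N. monom (c n) n)"
    have "norm (hmul (\<lambda>z. poly P z + (-1) * \<delta> k z) g) \<le> d * norm g"
    proof (rule norm_hmul_le)
      show "(\<lambda>z. poly P z + (-1) * \<delta> k z) holomorphic_on disc"
        by (intro holomorphic_intros hinf_holo hinf_poly \<delta>h)
      fix z assume z: "z \<in> disc"
      have s: "(\<lambda>n. c n * z ^ n) sums \<delta> k z" using \<delta>s[OF z] by (simp add: c_def)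
      have sn: "summable (\<lambda>n. norm (c (n + N)))" using sc by (simp add: summable_iff_shift[of "\<lambda>n. norm (c n)"])
      have le: "norm (c (n + N) * z ^ (n + N)) \<le> norm (c (n + N))" for n
        using z by (simp add: norm_mult norm_power mult_left_le power_le_one)
      have "\<delta> k z - poly P z = (\<Sum>n. c (n + N) * z ^ (n + N))"
        using suminf_minus_initial_segment[OF sums_summable[OF s], of N] s
        by (simp add: P_def poly_sum poly_monom sums_iff)
      also have "norm \<dots> \<le> (\<Sum>n. norm (c (n + N)))"
        by (rule norm_suminf_le[OF le sn])
      also have "\<dots> \<le> d" using N by simp
      finally show "norm (poly P z + (-1) * \<delta> k z) \<le> d" by (simp add: norm_minus_commute)
    qed
    also have "d * norm g < d * (norm g + 1)" using d by simp
    also have "\<dots> = e" using norm_ge_zero[of g] unfolding d_def by (simp add: add_nonneg_eq_0_iff)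
    also have "hmul (\<lambda>z. poly P z + (-1) * \<delta> k z) g = hmul (poly P) g - hmul (\<delta> k) g"
      by (rule h2_eqI) (subst hfun_hmul, intro hinf_add hinf_mult hinf_poly hinf_const \<delta>h,
          simp add: hfun_hmul \<delta>h hfun_simps left_diff_distrib)
    finally show "\<exists>y\<in>range (\<lambda>P. hmul (poly P) g). dist y (hmul (\<delta> k) g) < e" by (auto simp: dist_norm)
  qed
  then show ?thesis using closed_sequentially[OF closed_closure _ lim] by blast
qed

section \<open>The model space\<close>

lemma hfun_sum: "hfun (\<Sum>k\<in>A. f k) z = (\<Sum>k\<in>A. hfun (f k) z)"
  by (induction A rule: infinite_finite_induct) (auto simp: hfun_zero hfun_plus)

text \<open>The linear combinations occurring in \<open>cyclic_vector\<close> for the square of the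
  shift, as a multiplier.\<close>

definition even_poly :: "nat \<Rightarrow> (nat \<Rightarrow> complex) \<Rightarrow> complex \<Rightarrow> complex" where
  "even_poly N c z = (\<Sum>k<N. c k * z ^ (2 * k))"

lemma hinf_sum [simp]: "(\<And>k. k \<in> A \<Longrightarrow> f k \<in> hinf) \<Longrightarrow> (\<lambda>z. \<Sum>k\<in>A. f k z) \<in> hinf"
  by (induction A rule: infinite_finite_induct) auto

lemma even_poly_hinf [simp]: "even_poly N c \<in> hinf"
  unfolding even_poly_def [abs_def] by (intro hinf_sum hinf_mult hinf_const hinf_power hinf_ident)

lemma even_poly_minus: "even_poly N c (- z) = even_poly N c z"
  by (simp add: even_poly_def)

context
  fixes m :: "complex \<Rightarrow> complex"
  assumes m: "inner_fn m"
begin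

lemmas m_hinf = inner_fn_hinf[OF m]
lemmas m_norm = inner_fn_isometry[OF m]

definition mspace :: "h2 set" where
  "mspace = {f. \<forall>g. inner f (hmul m g) = 0}"

lemma mspace_hmul_const: "f \<in> mspace \<Longrightarrow> hmul (\<lambda>z. c) f \<in> mspace"
  by (simp add: mspace_def inner_const hmul_commute[OF hinf_const m_hinf])

lemma mspace_diff: "f \<in> mspace \<Longrightarrow> g \<in> mspace \<Longrightarrow> f - g \<in> mspace"
  by (simp add: mspace_def inner_diff_left)

lemma mspace_add: "f \<in> mspace \<Longrightarrow> g \<in> mspace \<Longrightarrow> f + g \<in> mspace"
  by (simp add: mspace_def inner_add_left)

lemma model_space_eq: "model_space m = hfun ` mspace"
proof -
  have eq: "(\<lambda>z. if z \<in> disc then m z * hfun G z else 0) = hfun (hmul m G)" for G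
    by (simp add: hfun_hmul[OF m_hinf])
  have iff: "(\<forall>g\<in>hardy2. h2_inner (hfun F) (\<lambda>z. if z \<in> disc then m z * g z else 0) = 0) \<longleftrightarrow> F \<in> mspace" for F
  proof
    assume L: "\<forall>g\<in>hardy2. h2_inner (hfun F) (\<lambda>z. if z \<in> disc then m z * g z else 0) = 0"
    have "inner F (hmul m G) = 0" for G
      using L[rule_format, OF hfun, of G] unfolding eq h2_inner_conv by (simp add: complex_eq_iff)
    then show "F \<in> mspace" by (simp add: mspace_def)
  next
    assume F: "F \<in> mspace"
    show "\<forall>g\<in>hardy2. h2_inner (hfun F) (\<lambda>z. if z \<in> disc then m z * g z else 0) = 0"
    proof
      fix g assume "g \<in> hardy2"
      then obtain G where G: "g = hfun G" by (rule hfun_cases)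
      show "h2_inner (hfun F) (\<lambda>z. if z \<in> disc then m z * g z else 0) = 0"
        unfolding G eq h2_inner_conv using F
        by (simp add: mspace_def hmul_commute[OF hinf_const m_hinf] complex_eq_iff)
    qed
  qed
  have "f \<in> model_space m \<longleftrightarrow> f \<in> hfun ` mspace" for f
  proof (cases "f \<in> hardy2")
    case True
    then obtain F where "f = hfun F" by (rule hfun_cases)
    then show ?thesis
      using iff[of F] unfolding model_space_def
      by (auto simp only: mem_Collect_eq hfun hfun_inject image_iff)
  qed (auto simp: model_space_def hfun)
  then show ?thesis by blast
qed

text \<open>Encoded through the splitting \<open>u = k + m g\<close>, because for cyclicity only the
  class of \<open>u\<close> modulo multiples of \<open>m\<close> matters.\<close>

definition mproj :: "h2 \<Rightarrow> h2" where
  "mproj u = (SOME k. k \<in> mspace \<and> (\<exists>g. u = k + hmul m g))"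

lemma mproj: "mproj u \<in> mspace" "\<exists>g. u = mproj u + hmul m g"
proof -
  obtain p where p: "p \<in> range (hmul m)" "\<And>y. y \<in> range (hmul m) \<Longrightarrow> inner (u - p) y = 0"
    using orthogonal_projection_exists[OF isometry_range[OF m_hinf m_norm]] by metis
  then have "u - p \<in> mspace" by (simp add: mspace_def)
  moreover obtain g where "p = hmul m g" using p(1) by blast
  ultimately have "\<exists>k. k \<in> mspace \<and> (\<exists>g. u = k + hmul m g)"
    by (intro exI[of _ "u - p"]) auto
  from someI_ex[OF this] show "mproj u \<in> mspace" "\<exists>g. u = mproj u + hmul m g" unfolding mproj_def by auto
qed

lemma mproj_eqI:
  assumes "k \<in> mspace" "u = k + hmul m g"
  shows "mproj u = k"
proof -
  obtain g' where g': "u = mproj u + hmul m g'" using mproj(2) by blast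
  have "mproj u - k = hmul m (g - g')" using g' assms(2) by (simp add: hmul_diff m_hinf algebra_simps)
  moreover have "mproj u - k \<in> mspace" using mproj(1) assms(1) by (rule mspace_diff)
  ultimately have "inner (mproj u - k) (mproj u - k) = 0" by (simp add: mspace_def)
  then show ?thesis by simp
qed

lemma mproj_id: "k \<in> mspace \<Longrightarrow> mproj k = k"
  by (rule mproj_eqI[of _ _ 0]) (auto simp: m_hinf)

lemma mproj_add: "mproj (u + v) = mproj u + mproj v"
proof -
  obtain g h where "u = mproj u + hmul m g" "v = mproj v + hmul m h" using mproj(2) by metis
  then have "u + v = mproj u + mproj v + hmul m (g + h)" by (simp add: hmul_add m_hinf algebra_simps)
  then show ?thesis by (intro mproj_eqI) (auto simp: mproj mspace_add)
qed

lemma mproj_m: "mproj (u + hmul m h) = mproj u"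
proof -
  obtain g where "u = mproj u + hmul m g" using mproj(2) by metis
  then have "u + hmul m h = mproj u + hmul m (g + h)" by (simp add: hmul_add m_hinf algebra_simps)
  then show ?thesis by (intro mproj_eqI) (auto simp: mproj)
qed

lemma mproj_const: "mproj (hmul (\<lambda>z. c) u) = hmul (\<lambda>z. c) (mproj u)"
proof -
  obtain g where "u = mproj u + hmul m g" using mproj(2) by metis
  then have "hmul (\<lambda>z. c) u = hmul (\<lambda>z. c) (mproj u) + hmul (\<lambda>z. c) (hmul m g)" by (metis hmul_add hinf_const)
  also have "hmul (\<lambda>z. c) (hmul m g) = hmul m (hmul (\<lambda>z. c) g)" by (rule hmul_commute[OF hinf_const m_hinf])
  finally show ?thesis by (intro mproj_eqI) (auto simp: mproj mspace_hmul_const)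
qed

lemma mproj_diff: "mproj (u - v) = mproj u - mproj v"
  using mproj_add[of "u - v" v] by simp

lemma mproj_zero: "mproj 0 = 0"
  using mproj_diff[of 0 0] by simp

lemma mproj_sum: "mproj (\<Sum>k\<in>A. f k) = (\<Sum>k\<in>A. mproj (f k))"
  by (induction A rule: infinite_finite_induct) (auto simp: mproj_zero mproj_add)

lemma mproj_norm: "norm (mproj u) \<le> norm u"
proof -
  obtain g where g: "u = mproj u + hmul m g" using mproj(2) by metis
  have "inner (mproj u) (hmul m g) = 0" using mproj(1)[of u] by (simp add: mspace_def)
  then have "inner (mproj u) u = (norm (mproj u))\<^sup>2"
    by (subst (2) g) (simp add: inner_add_right power2_norm_eq_inner)
  then have "norm (mproj u) * norm (mproj u) \<le> norm (mproj u) * norm u"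
    using norm_cauchy_schwarz[of "mproj u" u] by (simp add: power2_eq_square)
  then show ?thesis by (cases "norm (mproj u) = 0") auto
qed

text \<open>Uniqueness of the projection: a second candidate \<open>K\<close> differs from
  \<open>mproj u\<close> by an element of \<open>mspace\<close> that is orthogonal to
  itself.\<close>

lemma proj_model_space: "proj (model_space m) (hfun u) = hfun (mproj u)"
  unfolding proj_def
proof (rule the_equality)
  show "hfun (mproj u) \<in> model_space m \<and> (\<forall>y\<in>model_space m. h2_inner (\<lambda>z. hfun u z - hfun (mproj u) z) y = 0)"
    unfolding model_space_eq
  proof (intro conjI ballI imageI mproj)
    fix y assume "y \<in> hfun ` mspace"
    then obtain Y where Y: "Y \<in> mspace" "y = hfun Y" by blast
    obtain g where g: "u = mproj u + hmul m g" using mproj(2) by metis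
    then have "u - mproj u = hmul m g" by (metis add_diff_cancel_left')
    then have "inner (u - mproj u) Z = 0" if "Z \<in> mspace" for Z
      using that by (simp add: mspace_def inner_commute)
    then show "h2_inner (\<lambda>z. hfun u z - hfun (mproj u) z) y = 0"
      unfolding Y(2) hfun_minus[symmetric] h2_inner_conv using Y(1) mspace_hmul_const[OF Y(1)] by (simp add: complex_eq_iff)
  qed
next
  fix k assume k: "k \<in> model_space m \<and> (\<forall>y\<in>model_space m. h2_inner (\<lambda>z. hfun u z - k z) y = 0)"
  then obtain K where K: "K \<in> mspace" "k = hfun K" unfolding model_space_eq by blast
  have o: "inner (u - K) Y = 0" if "Y \<in> mspace" for Y
  proof -
    have "h2_inner (\<lambda>z. hfun u z - k z) (hfun Y) = 0" using k that unfolding model_space_eq by blast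
    then show ?thesis unfolding K(2) hfun_minus[symmetric] h2_inner_conv by (simp add: complex_eq_iff)
  qed
  obtain g where g: "u = mproj u + hmul m g" using mproj(2) by metis
  have "mproj u - K \<in> mspace" using mproj(1) K(1) by (rule mspace_diff)
  moreover have "inner (hmul m g) (mproj u - K) = 0"
    using \<open>mproj u - K \<in> mspace\<close> by (simp add: mspace_def inner_commute)
  moreover have "inner (u - K) (mproj u - K) = inner (mproj u - K) (mproj u - K) + inner (hmul m g) (mproj u - K)"
    unfolding inner_add_left[symmetric] using g by (metis add_diff_eq add.commute)
  ultimately have "inner (mproj u - K) (mproj u - K) = 0" using o[of "mproj u - K"] by simp
  then show "k = hfun (mproj u)" using K(2) by simp
qed

lemma compressed_shift_h2: "compressed_shift m (hfun F) = hfun (mproj (hshift F))"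
proof -
  have "shift (hfun F) = hfun (hshift F)"
    by (rule ext) (auto simp: shift_def hfun_hmul hfun_outside)
  then show ?thesis by (simp add: compressed_shift_def proj_model_space)
qed

text \<open>Multiplication preserves the multiples of \<open>m\<close>, so intermediate projections
  may be dropped: a power of the compressed shift becomes one projection after multiplication by a
  power of \<open>z\<close>.\<close>

lemma mproj_hmul_mproj: 
  assumes "\<psi> \<in> hinf"
  shows "mproj (hmul \<psi> (mproj f)) = mproj (hmul \<psi> f)"
proof -
  obtain g where "f = mproj f + hmul m g" using mproj(2) by metis
  then have "hmul \<psi> f = hmul \<psi> (mproj f) + hmul \<psi> (hmul m g)" by (metis hmul_add assms)
  also have "hmul \<psi> (hmul m g) = hmul m (hmul \<psi> g)" by (rule hmul_commute[OF assms m_hinf])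
  finally show ?thesis by (simp add: mproj_m)
qed

lemma compressed_shift_power: "(compressed_shift m ^^ n) (hfun (mproj f)) = hfun (mproj (hmul (\<lambda>z. z ^ n) f))"
proof (induction n)
  case (Suc n)
  then show ?case by (simp add: compressed_shift_h2 mproj_hmul_mproj hmul_hmul)
qed simp

lemma compressed_shift_even_combination:
  assumes "X \<in> mspace"
  shows "(\<lambda>z. hfun Y z - (\<Sum>k<N. c k * ((compressed_shift m ^^ 2) ^^ k) (hfun X) z)) =
    hfun (Y - mproj (hmul (even_poly N c) X))"
proof
  fix z
  have "((compressed_shift m ^^ 2) ^^ k) (hfun X) = hfun (mproj (hmul (\<lambda>z. z ^ (2 * k)) X))" for k
    using compressed_shift_power[of "2 * k" X] mproj_id[OF assms] by (simp add: funpow_mult mult.commute)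
  then have "(\<Sum>k<N. c k * ((compressed_shift m ^^ 2) ^^ k) (hfun X) z) =
      (\<Sum>k<N. hfun (hmul (\<lambda>z. c k) (mproj (hmul (\<lambda>z. z ^ (2 * k)) X))) z)"
    by (intro sum.cong refl) (auto simp: hfun_hmul hfun_outside)
  also have "\<dots> = hfun (mproj (\<Sum>k<N. hmul (\<lambda>z. c k) (hmul (\<lambda>z. z ^ (2 * k)) X))) z"
    by (simp add: hfun_sum mproj_sum mproj_const)
  also have "(\<Sum>k<N. hmul (\<lambda>z. c k) (hmul (\<lambda>z. z ^ (2 * k)) X)) = hmul (even_poly N c) X"
    by (rule h2_eqI) (simp add: hfun_sum hfun_hmul even_poly_def sum_distrib_right mult.assoc)
  finally show "hfun Y z - (\<Sum>k<N. c k * ((compressed_shift m ^^ 2) ^^ k) (hfun X) z) =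
    hfun (Y - mproj (hmul (even_poly N c) X)) z" by (simp add: hfun_minus)
qed

text \<open>On the right all projections are gone and \<open>X\<close> ranges over the whole Hardy
  space. Since \<open>mproj\<close> annihilates multiples of \<open>m\<close> and does not increase
  norms, an approximation there projects to one in the model space, with cyclic vector
  \<open>mproj X\<close>. Conversely, a vector and its projection differ by a multiple of
  \<open>m\<close>.\<close>

lemma multiplicity_free_iff:
  "multiplicity_free (model_space m) (compressed_shift m ^^ 2) \<longleftrightarrow>
   (\<exists>X. \<forall>u e. e > 0 \<longrightarrow> (\<exists>N c g. norm (u - hmul (even_poly N c) X - hmul m g) < e))"
proof
  assume "multiplicity_free (model_space m) (compressed_shift m ^^ 2)"
  then obtain X where X: "X \<in> mspace" "\<And>Y e. \<lbrakk>Y \<in> mspace; e > 0\<rbrakk> \<Longrightarrow> \<exists>N c. norm (Y - mproj (hmul (even_poly N c) X)) < e"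
    unfolding multiplicity_free_def cyclic_vector_def model_space_eq
    by (auto simp: compressed_shift_even_combination h2_norm_conv)
  show "\<exists>X. \<forall>u e. e > 0 \<longrightarrow> (\<exists>N c g. norm (u - hmul (even_poly N c) X - hmul m g) < e)"
  proof (rule exI[of _ X], intro allI impI)
    fix u and e :: real assume "e > 0"
    then obtain N c where Nc: "norm (mproj u - mproj (hmul (even_poly N c) X)) < e" using X(2)[OF mproj(1)] by blast
    obtain g h where gh: "u = mproj u + hmul m g" "hmul (even_poly N c) X = mproj (hmul (even_poly N c) X) + hmul m h"
      using mproj(2) by metis
    have "mproj u - mproj (hmul (even_poly N c) X) = u - hmul (even_poly N c) X - hmul m (g - h)"
      using gh by (simp add: hmul_diff m_hinf algebra_simps)
    then show "\<exists>N c g. norm (u - hmul (even_poly N c) X - hmul m g) < e" using Nc by metis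
  qed
next
  assume "\<exists>X. \<forall>u e. e > 0 \<longrightarrow> (\<exists>N c g. norm (u - hmul (even_poly N c) X - hmul m g) < e)"
  then obtain X where X: "\<And>u e. e > 0 \<Longrightarrow> \<exists>N c g. norm (u - hmul (even_poly N c) X - hmul m g) < e" by blast
  have "\<exists>N c. norm (Y - mproj (hmul (even_poly N c) (mproj X))) < e" if Y: "Y \<in> mspace" and e: "e > 0" for Y e
  proof -
    obtain N c g where g: "norm (Y - hmul (even_poly N c) X - hmul m g) < e" using X[OF e] by blast
    have "mproj (Y - hmul (even_poly N c) X - hmul m g) = mproj Y - mproj (hmul (even_poly N c) X)"
      using mproj_m[of "Y - hmul (even_poly N c) X - hmul m g" g] by (simp add: mproj_diff)
    then have "norm (Y - mproj (hmul (even_poly N c) (mproj X))) \<le> norm (Y - hmul (even_poly N c) X - hmul m g)"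
      using mproj_norm[of "Y - hmul (even_poly N c) X - hmul m g"] Y by (simp add: mproj_id mproj_hmul_mproj)
    then show ?thesis using g by (meson le_less_trans)
  qed
  then have "cyclic_vector (model_space m) (compressed_shift m ^^ 2) (hfun (mproj X))"
    unfolding cyclic_vector_def model_space_eq
    by (auto simp: compressed_shift_even_combination[OF mproj(1)] h2_norm_conv mproj(1))
  then show "multiplicity_free (model_space m) (compressed_shift m ^^ 2)"
    unfolding multiplicity_free_def by blast
qed

end

section \<open>Even inner divisors obstruct cyclicity\<close>

definition href :: "h2 \<Rightarrow> h2" where "href f = Abs_h2 (\<lambda>z. hfun f (- z))"

lemma hfun_href: "hfun (href f) = (\<lambda>z. hfun f (- z))"
  and hco_href: "hco (href f) n = (- 1) ^ n * hco f n"
proof -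
  have s: "(\<lambda>n. ((- 1) ^ n * hco f n) * z ^ n) sums hfun f (- z)" if "z \<in> disc" for z
  proof -
    have "(\<lambda>n. hco f n * (- z) ^ n) sums hfun f (- z)" using that by (intro hco_sums) simp
    moreover have "hco f n * (- z) ^ n = ((- 1) ^ n * hco f n) * z ^ n" for n
      by (subst power_minus) (simp add: mult_ac)
    ultimately show ?thesis by simp
  qed
  show eq: "hfun (href f) = (\<lambda>z. hfun f (- z))"
    unfolding href_def
  proof (rule Abs_h2_inverse, rule hardy2I[OF _ s])
    show "summable (\<lambda>n. (norm ((- 1) ^ n * hco f n))\<^sup>2)"
      using hco_summable[of f] by (simp add: norm_mult norm_power)
  qed (auto simp: hfun_outside)
  show "hco (href f) n = (- 1) ^ n * hco f n"
    by (rule hco_eqI[of "\<lambda>n. (- 1) ^ n * hco f n"]) (use s eq in simp)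
qed

lemma norm_href [simp]: "norm (href f) = norm f"
proof -
  have "(norm (href f))\<^sup>2 = (norm f)\<^sup>2" by (simp add: norm_h2_power2 hco_href norm_mult norm_power)
  then show ?thesis by (simp add: power2_eq_iff_nonneg)
qed

lemma hfun_cont: "continuous_on disc (hfun f)"
  by (intro holomorphic_on_imp_continuous_on) simp

lemma norm_hone: "norm hone = 1"
proof -
  have "(norm hone)\<^sup>2 = 1\<^sup>2"
    unfolding norm_h2_power2 using suminf_finite[of "{0}" "\<lambda>n. (norm (hco hone n))\<^sup>2"] by (simp add: hco_hone)
  then show ?thesis by (subst (asm) power2_eq_iff_nonneg) auto
qed

lemma circle_mean_product_le:
  assumes r: "0 \<le> r" "r < 1"
  shows "circle_mean r (\<lambda>z. norm (hfun u z) * norm (hfun v z)) \<le> norm u * norm v"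
proof -
  have "circle_mean r (\<lambda>z. norm (hfun u z) * norm (hfun v z)) \<le>
      sqrt (square_mean r (hfun u)) * sqrt (square_mean r (hfun v))"
    by (intro circle_mean_Cauchy_Schwarz continuous_intros hfun_cont r)
  also have "\<dots> \<le> norm u * norm v"
    by (intro mult_mono real_le_lsqrt circle_mean_h2_le r real_sqrt_ge_zero circle_mean_nonneg) auto
  finally show ?thesis .
qed

lemma circle_mean_hfun_le:
  assumes r: "0 \<le> r" "r < 1"
  shows "circle_mean r (\<lambda>z. norm (hfun u z)) \<le> norm u"
proof -
  have "circle_mean r (\<lambda>z. norm (hfun u z)) = circle_mean r (\<lambda>z. norm (hfun u z) * norm (hfun hone z))"
    unfolding circle_mean_def using r by (simp add: hfun_hone norm_mult)
  then show ?thesis using circle_mean_product_le[OF r, of u hone] by (simp add: norm_hone)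
qed

text \<open>The loss of modulus of \<open>u v\<close> under multiplication by \<open>p\<close>; its
  smallness near the circle replaces \<open>|p| = 1\<close> on it.\<close>

abbreviation defect :: "(complex \<Rightarrow> complex) \<Rightarrow> h2 \<Rightarrow> h2 \<Rightarrow> complex \<Rightarrow> real" where
  "defect p u v \<equiv> \<lambda>z. norm (hfun u z) * norm (hfun v z) * (1 - norm (p z))"

text \<open>By Cauchy-Schwarz and \<open>(1 - |p|)^2 \<le> 1 - |p|^2\<close>, the mean is at most
  \<open>norm u\<close> times the square root of the mean of \<open>|v|^2 - |p v|^2\<close>. The
  latter tends to 0 because multiplication by \<open>p\<close> is isometric.\<close>

lemma circle_mean_defect_tendsto:
  assumes p: "inner_fn p"
  shows "(\<lambda>k. circle_mean (radius k) (defect p u v)) \<longlonglongrightarrow> 0"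
proof -
  have ph: "p \<in> hinf" and pn: "norm (hmul p f) = norm f" for f
    using p by (auto simp: inner_fn_hinf inner_fn_isometry)
  have p1: "norm (p z) \<le> 1" if "z \<in> disc" for z by (rule isometry_norm_le_1[OF ph pn that])
  have pc: "continuous_on disc p" by (intro holomorphic_on_imp_continuous_on hinf_holo ph)
  define A where "A k = square_mean (radius k) (hfun v) - circle_mean (radius k) (\<lambda>z. (norm (p z * hfun v z))\<^sup>2)" for k
  have "A \<longlonglongrightarrow> (norm v)\<^sup>2 - (norm (hmul p v))\<^sup>2"
    unfolding A_def by (intro tendsto_diff circle_mean_h2_tendsto circle_mean_hmul_tendsto ph)
  then have "A \<longlonglongrightarrow> 0" by (simp add: pn)
  then have "(\<lambda>k. norm u * sqrt (A k)) \<longlonglongrightarrow> norm u * sqrt 0" by (intro tendsto_intros)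
  then have lim: "(\<lambda>k. norm u * sqrt (A k)) \<longlonglongrightarrow> 0" by simp
  show ?thesis
  proof (rule tendsto_sandwich[OF _ _ tendsto_const lim]; intro always_eventually allI)
    fix k
    note r = radius_bounds(1,3)[of k]
    show "0 \<le> circle_mean (radius k) (defect p u v)"
      using p1 by (intro circle_mean_nonneg r) auto
    have "circle_mean (radius k) (defect p u v) \<le>
      sqrt (square_mean (radius k) (hfun u)) * sqrt (circle_mean (radius k) (\<lambda>z. (norm (hfun v z) * (1 - norm (p z)))\<^sup>2))"
      unfolding mult.assoc by (intro circle_mean_Cauchy_Schwarz continuous_intros hfun_cont pc r)
    also have "\<dots> \<le> norm u * sqrt (A k)"
    proof (rule mult_mono[OF _ real_sqrt_le_mono])
      show "sqrt (square_mean (radius k) (hfun u)) \<le> norm u"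
        by (intro real_le_lsqrt circle_mean_h2_le r) auto
      show "0 \<le> sqrt (circle_mean (radius k) (\<lambda>z. (norm (hfun v z) * (1 - norm (p z)))\<^sup>2))"
        by (intro real_sqrt_ge_zero circle_mean_nonneg r) auto
      have "circle_mean (radius k) (\<lambda>z. (norm (hfun v z) * (1 - norm (p z)))\<^sup>2) \<le>
          circle_mean (radius k) (\<lambda>z. (norm (hfun v z))\<^sup>2 - (norm (p z * hfun v z))\<^sup>2)"
      proof (intro circle_mean_mono continuous_intros hfun_cont pc r)
        fix z assume z: "z \<in> disc"
        have "0 \<le> 2 * (norm (p z) * (1 - norm (p z)))" using p1[OF z] by simp
        then have "(1 - norm (p z))\<^sup>2 \<le> 1 - (norm (p z))\<^sup>2" by (simp add: power2_eq_square algebra_simps)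
        then have "(norm (hfun v z))\<^sup>2 * (1 - norm (p z))\<^sup>2 \<le> (norm (hfun v z))\<^sup>2 * (1 - (norm (p z))\<^sup>2)"
          by (intro mult_left_mono) auto
        then show "(norm (hfun v z) * (1 - norm (p z)))\<^sup>2 \<le> (norm (hfun v z))\<^sup>2 - (norm (p z * hfun v z))\<^sup>2"
          unfolding norm_mult power_mult_distrib by (simp add: right_diff_distrib mult.commute)
      qed
      also have "\<dots> = A k" unfolding A_def by (intro circle_mean_diff continuous_intros hfun_cont pc r)
      finally show "circle_mean (radius k) (\<lambda>z. (norm (hfun v z) * (1 - norm (p z)))\<^sup>2) \<le> A k" .
    qed auto
    finally show "circle_mean (radius k) (defect p u v) \<le> norm u * sqrt (A k)" .
  qed
qed

lemma tcoeff_1: "tcoeff f 1 = deriv f 0"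
  by (simp add: tcoeff_def)

text \<open>The left side is a lower bound for \<open>|D'(0)|\<close>, and
  \<open>2 + 6 * \<epsilon>\<close> is an upper bound for \<open>|K'(0)|\<close>, where
  \<open>D = p K\<close>. The error is kept explicit so that \<open>\<epsilon>\<close> can tend to 0
  while \<open>p\<close> stays fixed.\<close>

lemma even_inner_value_at_0:
  fixes p :: "complex \<Rightarrow> complex"
  assumes p: "inner_fn p" and even: "\<And>z. z \<in> disc \<Longrightarrow> p (- z) = p z"
    and \<epsilon>: "0 < \<epsilon>" "\<epsilon> \<le> 1"
    and F: "norm (F - hone) \<le> \<epsilon>" "F = hmul (even_poly N c) X + hmul p h"
    and G: "norm (G - hshift hone) \<le> \<epsilon>" "G = hmul (even_poly N' c') X + hmul p k"
  shows "2 - 6 * \<epsilon> \<le> norm (p 0) * (2 + 6 * \<epsilon>)"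
proof -
  have ph: "p \<in> hinf" and pn: "norm (hmul p f) = norm f" for f
    using p by (auto simp: inner_fn_hinf inner_fn_isometry)
  have pc: "continuous_on disc p" by (intro holomorphic_on_imp_continuous_on hinf_holo ph)
  have p1: "norm (p z) \<le> 1" if "z \<in> disc" for z by (rule isometry_norm_le_1[OF ph pn that])
  \<comment> \<open>The parts of \<open>G\<close> and of its reflection that come from
    \<open>X\<close>. With them the quotient of \<open>D\<close> by \<open>p\<close> is written down
    as four products of Hardy functions, which avoids dividing by \<open>p\<close>.\<close>
  define V W where "V = G - hmul p k" and "W = href G - hmul p (href k)"
  define K where "K z = hfun F z * hfun (href k) z + hfun h z * hfun W z
      - hfun (href F) z * hfun k z - hfun (href h) z * hfun V z" for z
  define D where "D z = hfun F z * hfun (href G) z - hfun (href F) z * hfun G z" for z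
  have DK: "D z = p z * K z" if z: "z \<in> disc" for z
    unfolding D_def K_def V_def W_def hfun_minus hfun_href hfun_hmul[OF ph]
    unfolding F(2) G(2) hfun_plus using z even[OF z]
    by (simp add: hfun_hmul hfun_href even_poly_minus ph) (simp add: algebra_simps)
  have Kh: "K holomorphic_on disc" unfolding K_def by (intro holomorphic_intros hfun_holo)
  have Dh: "D holomorphic_on disc" unfolding D_def by (intro holomorphic_intros hfun_holo)
  have Kc: "continuous_on disc K" and Dc: "continuous_on disc D"
    using Kh Dh by (auto intro: holomorphic_on_imp_continuous_on)
  define a b where "a = F - hone" and "b = G - hshift hone"
  have Fa: "hfun F z = 1 + hfun a z" and Gb: "hfun G z = z + hfun b z" if "z \<in> disc" for z
    using that by (auto simp: a_def b_def hfun_simps hfun_hone hfun_hmul)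
  \<comment> \<open>Substituting \<open>F = 1 + a\<close> and \<open>G = z + b\<close> turns
    \<open>D + 2 z\<close> into six error terms. Each has mean at most \<open>\<epsilon>\<close>,
    the products because \<open>\<epsilon> \<le> 1\<close>; hence the constant 6.\<close>
  define E where "E z = norm (hfun (href b) z) + norm (hfun a z) + norm (hfun a z) * norm (hfun (href b) z)
      + norm (hfun b z) + norm (hfun (href a) z) + norm (hfun (href a) z) * norm (hfun b z)" for z
  have Ec: "continuous_on disc E" unfolding E_def by (intro continuous_intros hfun_cont)
  have DE: "norm (D z + 2 * z) \<le> E z" if z: "z \<in> disc" for z
  proof -
    have mz: "- z \<in> disc" using z by simp
    have "D z + 2 * z = hfun (href b) z - hfun a z * z + hfun a z * hfun (href b) z
        - hfun b z - hfun (href a) z * z - hfun (href a) z * hfun b z"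
      unfolding D_def hfun_href Fa[OF z] Fa[OF mz] Gb[OF z] Gb[OF mz] by (simp add: algebra_simps)
    also have "norm \<dots> \<le> norm (hfun (href b) z) + norm (hfun a z * z) + norm (hfun a z * hfun (href b) z)
        + norm (hfun b z) + norm (hfun (href a) z * z) + norm (hfun (href a) z * hfun b z)"
      by (intro order_trans[OF norm_triangle_ineq4] order_trans[OF norm_triangle_ineq] add_mono order_refl)
    also have "\<dots> \<le> E z"
      using z unfolding E_def norm_mult by (intro add_mono order_refl mult_left_le) auto
    finally show ?thesis .
  qed
  have Em: "circle_mean r E \<le> 6 * \<epsilon>" if r: "0 \<le> r" "r < 1" for r
  proof -
    have "circle_mean r E = circle_mean r (\<lambda>z. norm (hfun (href b) z)) + circle_mean r (\<lambda>z. norm (hfun a z))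
        + circle_mean r (\<lambda>z. norm (hfun a z) * norm (hfun (href b) z)) + circle_mean r (\<lambda>z. norm (hfun b z))
        + circle_mean r (\<lambda>z. norm (hfun (href a) z)) + circle_mean r (\<lambda>z. norm (hfun (href a) z) * norm (hfun b z))"
      unfolding E_def by (subst circle_mean_add; (intro continuous_intros hfun_cont r)?)+ simp
    also have "\<dots> \<le> norm b + norm a + norm a * norm b + norm b + norm a + norm a * norm b"
      using circle_mean_hfun_le[OF r, of "href b"] circle_mean_hfun_le[OF r, of "href a"]
        circle_mean_product_le[OF r, of a "href b"] circle_mean_product_le[OF r, of "href a" b]
        circle_mean_hfun_le[OF r, of b] circle_mean_hfun_le[OF r, of a]
      by (intro add_mono) auto
    also have "\<dots> \<le> \<epsilon> + \<epsilon> + 1 * \<epsilon> + \<epsilon> + \<epsilon> + 1 * \<epsilon>"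
      using F(1) G(1) \<epsilon> unfolding a_def[symmetric] b_def[symmetric] by (intro add_mono mult_mono) auto
    finally show ?thesis by simp
  qed
  have Dm: "circle_mean r (\<lambda>z. norm (D z)) \<le> 2 + 6 * \<epsilon>" if r: "0 \<le> r" "r < 1" for r
  proof -
    have "circle_mean r (\<lambda>z. norm (D z)) \<le> circle_mean r (\<lambda>z. 2 + E z)"
    proof (intro circle_mean_mono continuous_intros Dc Ec r)
      fix z assume z: "z \<in> disc"
      have "norm (D z) \<le> norm (D z + 2 * z) + norm (2 * z)" using norm_triangle_ineq4[of "D z + 2 * z" "2 * z"] by simp
      then show "norm (D z) \<le> 2 + E z" using DE[OF z] z by (simp add: norm_mult)
    qed
    also have "\<dots> = 2 + circle_mean r E"
      by (subst circle_mean_add) (auto intro!: Ec r simp: circle_mean_const)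
    finally show ?thesis using Em[OF r] by linarith
  qed
  define w where "w u v n = circle_mean (radius n) (defect p u v)" for u v n
  have wlim: "w u v \<longlonglongrightarrow> 0" for u v unfolding w_def by (rule circle_mean_defect_tendsto[OF p])
  \<comment> \<open>\<open>|K| = |D| + |K| (1 - |p|)\<close>, and the last term is at most four
    defects, one for each product in \<open>K\<close>; their means disappear as the radius tends to
    1.\<close>
  have Kbound: "norm (tcoeff K 1) * radius n \<le> 2 + 6 * \<epsilon> + (w F (href k) n + w h W n + w (href F) k n + w (href h) V n)" for n
  proof -
    note r = radius_bounds(1,3)[of n]
    have "norm (tcoeff K 1) * radius n ^ 1 \<le> circle_mean (radius n) (\<lambda>z. norm (K z))"
      by (rule norm_tcoeff_le_circle_mean[OF Kh r])
    also have "\<dots> \<le> circle_mean (radius n) (\<lambda>z. norm (D z) + (defect p F (href k) z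
       + defect p h W z + defect p (href F) k z
       + defect p (href h) V z))"
    proof (intro circle_mean_mono continuous_intros Kc Dc hfun_cont pc r)
      fix z assume z: "z \<in> disc"
      have "norm (K z) \<le> norm (hfun F z * hfun (href k) z) + norm (hfun h z * hfun W z)
          + norm (hfun (href F) z * hfun k z) + norm (hfun (href h) z * hfun V z)"
        unfolding K_def
        by (intro order_trans[OF norm_triangle_ineq4] order_trans[OF norm_triangle_ineq] add_mono order_refl)
      then have "norm (K z) * (1 - norm (p z)) \<le> (norm (hfun F z * hfun (href k) z) + norm (hfun h z * hfun W z)
          + norm (hfun (href F) z * hfun k z) + norm (hfun (href h) z * hfun V z)) * (1 - norm (p z))"
        using p1[OF z] by (intro mult_right_mono) auto
      moreover have "norm (K z) = norm (D z) + norm (K z) * (1 - norm (p z))"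
        unfolding DK[OF z] norm_mult by (simp add: algebra_simps)
      ultimately show "norm (K z) \<le> norm (D z) + (defect p F (href k) z
       + defect p h W z + defect p (href F) k z
       + defect p (href h) V z)"
        unfolding norm_mult distrib_right by linarith
    qed
    also have "\<dots> = circle_mean (radius n) (\<lambda>z. norm (D z)) + (w F (href k) n + w h W n + w (href F) k n + w (href h) V n)"
      unfolding w_def by (subst circle_mean_add; (intro continuous_intros Dc hfun_cont pc r)?)+ simp
    finally show ?thesis using Dm[OF r] by simp
  qed
  have K1: "norm (tcoeff K 1) \<le> 2 + 6 * \<epsilon>"
  proof (rule LIMSEQ_le)
    show "(\<lambda>n. norm (tcoeff K 1) * radius n) \<longlonglongrightarrow> norm (tcoeff K 1)"
      using tendsto_mult[OF tendsto_const radius_tendsto] by simp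
    have "(\<lambda>n. 2 + 6 * \<epsilon> + (w F (href k) n + w h W n + w (href F) k n + w (href h) V n)) \<longlonglongrightarrow> 2 + 6 * \<epsilon> + (0 + 0 + 0 + 0)"
      by (intro tendsto_intros wlim)
    then show "(\<lambda>n. 2 + 6 * \<epsilon> + (w F (href k) n + w h W n + w (href F) k n + w (href h) V n)) \<longlonglongrightarrow> 2 + 6 * \<epsilon>" by simp
  qed (use Kbound in blast)
  have D1: "tcoeff D 1 = p 0 * tcoeff K 1"
  proof -
    \<comment> \<open>At 0 a function agrees with its reflection, and \<open>V\<close> with
      \<open>W\<close>, so the four products cancel in pairs. This removes the term with
      \<open>deriv p 0\<close> from the product rule.\<close>
    have K0: "K 0 = 0" by (simp add: K_def V_def W_def hfun_minus hfun_href hfun_hmul ph)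
    have "(p has_field_derivative deriv p 0) (at 0)" "(K has_field_derivative deriv K 0) (at 0)"
      by (auto intro!: holomorphic_derivI[of _ disc] hinf_holo ph Kh)
    then have "((\<lambda>z. p z * K z) has_field_derivative (deriv p 0 * K 0 + deriv K 0 * p 0)) (at 0)"
      by (rule DERIV_mult)
    then have "tcoeff (\<lambda>z. p z * K z) 1 = p 0 * tcoeff K 1"
      unfolding tcoeff_1 using K0 by (simp add: DERIV_imp_deriv mult.commute)
    moreover have "tcoeff D 1 = tcoeff (\<lambda>z. p z * K z) 1" by (rule tcoeff_cong[OF Dh DK])
    ultimately show ?thesis by simp
  qed
  have "norm (tcoeff D 1 + 2) \<le> 6 * \<epsilon>"
  proof -
    have h: "(\<lambda>z. D z + 2 * z) holomorphic_on disc" by (intro holomorphic_intros Dh)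
    have "(D has_field_derivative deriv D 0) (at 0)" by (auto intro!: holomorphic_derivI[of _ disc] Dh)
    then have "((\<lambda>z. D z + 2 * z) has_field_derivative (deriv D 0 + 2)) (at 0)" by (auto intro!: derivative_eq_intros)
    then have t: "tcoeff (\<lambda>z. D z + 2 * z) 1 = tcoeff D 1 + 2" unfolding tcoeff_1 by (rule DERIV_imp_deriv)
    have "norm (tcoeff D 1 + 2) * radius n \<le> 6 * \<epsilon>" for n
    proof -
      note r = radius_bounds(1,3)[of n]
      have "norm (tcoeff (\<lambda>z. D z + 2 * z) 1) * radius n ^ 1 \<le> circle_mean (radius n) (\<lambda>z. norm (D z + 2 * z))"
        by (rule norm_tcoeff_le_circle_mean[OF h r])
      also have "\<dots> \<le> circle_mean (radius n) E"
        by (intro circle_mean_mono continuous_intros Dc Ec r DE)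
      also have "\<dots> \<le> 6 * \<epsilon>" by (rule Em[OF r])
      finally show ?thesis unfolding t by simp
    qed
    moreover have "(\<lambda>n. norm (tcoeff D 1 + 2) * radius n) \<longlonglongrightarrow> norm (tcoeff D 1 + 2)"
      using tendsto_mult[OF tendsto_const radius_tendsto] by simp
    ultimately show ?thesis by (intro LIMSEQ_le_const2) auto
  qed
  then have "2 - 6 * \<epsilon> \<le> norm (tcoeff D 1)"
    using norm_triangle_ineq4[of "tcoeff D 1 + 2" "tcoeff D 1"] by simp
  also have "\<dots> \<le> norm (p 0) * (2 + 6 * \<epsilon>)"
    unfolding D1 norm_mult using K1 by (intro mult_left_mono) auto
  finally show ?thesis .
qed

text \<open>Multiples of \<open>m\<close> are multiples of \<open>p\<close>, so the density given by
  cyclicity holds modulo \<open>p\<close>, with one \<open>X\<close> for both targets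
  \<open>1\<close> and \<open>z\<close>. In the limit \<open>|p 0| \<ge> 1\<close>, and the maximum
  modulus principle applies as \<open>|p| \<le> 1\<close>.\<close>

lemma even_inner_divisor_constant:
  assumes m: "inner_fn m" and mf: "multiplicity_free (model_space m) (compressed_shift m ^^ 2)"
    and p: "inner_divisor p m" and even: "\<And>z. z \<in> disc \<Longrightarrow> p z = p (- z)"
  shows "\<exists>c. \<forall>z\<in>disc. p z = c"
proof -
  have pi: "inner_fn p" using p by (simp add: inner_divisor_def)
  obtain q where q: "q \<in> hinf" "\<And>z. z \<in> disc \<Longrightarrow> m z = p z * q z" using p by (auto simp: inner_divisor_def)
  have ph: "p \<in> hinf" and pn: "norm (hmul p f) = norm f" for f
    using pi by (auto simp: inner_fn_hinf inner_fn_isometry)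
  have mq: "hmul m g = hmul p (hmul q g)" for g
    by (simp add: hmul_hmul ph q(1)) (rule hmul_cong, rule q(2))
  obtain X where X: "\<And>u e. e > 0 \<Longrightarrow> \<exists>N c g. norm (u - hmul (even_poly N c) X - hmul m g) < e"
    using mf unfolding multiplicity_free_iff[OF m] by blast
  have ap: "\<exists>N c h. norm (hmul (even_poly N c) X + hmul p h - u) \<le> e" if "e > 0" for u e
  proof -
    obtain N c g where "norm (u - hmul (even_poly N c) X - hmul m g) < e" using X[OF \<open>e > 0\<close>] by blast
    then have "norm (hmul (even_poly N c) X + hmul p (hmul q g) - u) \<le> e"
      by (simp add: mq norm_minus_commute diff_diff_eq)
    then show ?thesis by blast
  qed
  have bound: "2 - 6 * \<epsilon> \<le> norm (p 0) * (2 + 6 * \<epsilon>)" if \<epsilon>: "0 < \<epsilon>" "\<epsilon> \<le> 1" for \<epsilon>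
  proof -
    obtain N c h where 1: "norm (hmul (even_poly N c) X + hmul p h - hone) \<le> \<epsilon>" using ap[OF \<epsilon>(1)] by blast
    obtain N' c' k where 2: "norm (hmul (even_poly N' c') X + hmul p k - hshift hone) \<le> \<epsilon>" using ap[OF \<epsilon>(1)] by blast
    show ?thesis by (rule even_inner_value_at_0[OF pi even[symmetric] \<epsilon> 1 refl 2 refl])
  qed
  have "2 \<le> norm (p 0) * 2"
  proof (rule LIMSEQ_le)
    show "(\<lambda>n. 2 - 6 * inverse (real (Suc n))) \<longlonglongrightarrow> 2"
      by (rule tendsto_eq_intros LIMSEQ_inverse_real_of_nat refl)+ simp
    show "(\<lambda>n. norm (p 0) * (2 + 6 * inverse (real (Suc n)))) \<longlonglongrightarrow> norm (p 0) * 2"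
      by (rule tendsto_eq_intros LIMSEQ_inverse_real_of_nat refl)+ simp
    show "\<exists>N. \<forall>n\<ge>N. 2 - 6 * inverse (real (Suc n)) \<le> norm (p 0) * (2 + 6 * inverse (real (Suc n)))"
      by (intro exI allI impI bound) (auto simp: field_simps)
  qed
  then have "norm (p z) \<le> norm (p 0)" if "z \<in> disc" for z
    using isometry_norm_le_1[OF ph pn that] by linarith
  then have "p constant_on disc"
    by (intro maximum_modulus_principle[of p disc disc 0] hinf_holo ph) auto
  then show ?thesis by (simp add: constant_on_def)
qed

section \<open>Odd parts and Beurling's theorem\<close>

lemma href_add: "href (f + g) = href f + href g"
  and href_diff: "href (f - g) = href f - href g"
  and href_scaleR: "href (r *\<^sub>R f) = r *\<^sub>R href f"
  and href_href [simp]: "href (href f) = f"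
  by (rule h2_eqI; simp add: hfun_href hfun_simps)+

lemma bounded_linear_href: "bounded_linear href"
  by (rule bounded_linear_intro[of _ 1]) (auto simp: href_add href_scaleR)

lemma continuous_on_href [continuous_intros]: "continuous_on S f \<Longrightarrow> continuous_on S (\<lambda>x. href (f x))"
  by (rule bounded_linear.continuous_on[OF bounded_linear_href])

lemma inner_href: "inner (href f) (href g) = inner f g"
  by (simp add: dot_norm href_add[symmetric])

lemma href_hmul_even:
  assumes "\<psi> \<in> hinf" "\<And>z. z \<in> disc \<Longrightarrow> \<psi> (- z) = \<psi> z"
  shows "href (hmul \<psi> f) = hmul \<psi> (href f)"
  by (rule h2_eqI) (use assms in \<open>simp add: hfun_href hfun_hmul\<close>)

lemma href_hmul_odd:
  assumes "\<psi> \<in> hinf" "\<And>z. z \<in> disc \<Longrightarrow> \<psi> (- z) = - \<psi> z"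
  shows "href (hmul \<psi> f) = - hmul \<psi> (href f)"
  by (rule h2_eqI) (use assms in \<open>simp add: hfun_href hfun_hmul hfun_uminus\<close>)

definition odd_part :: "h2 \<Rightarrow> h2" where "odd_part f = (1/2) *\<^sub>R (f - href f)"
definition even_part :: "h2 \<Rightarrow> h2" where "even_part f = (1/2) *\<^sub>R (f + href f)"

lemma even_add_odd: "even_part f + odd_part f = f"
  by (rule h2_eqI) (simp add: even_part_def odd_part_def hfun_simps field_simps)

lemma odd_part_add: "odd_part (f + g) = odd_part f + odd_part g"
  and odd_part_diff: "odd_part (f - g) = odd_part f - odd_part g"
  and odd_part_scaleR: "odd_part (r *\<^sub>R f) = r *\<^sub>R odd_part f"
  by (simp_all add: odd_part_def href_add href_diff href_scaleR algebra_simps)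

lemma odd_part_hmul_even:
  assumes "\<psi> \<in> hinf" "\<And>z. z \<in> disc \<Longrightarrow> \<psi> (- z) = \<psi> z"
  shows "odd_part (hmul \<psi> f) = hmul \<psi> (odd_part f)"
proof -
  have "href (hmul \<psi> f) = hmul \<psi> (href f)" using assms by (rule href_hmul_even)
  then show ?thesis by (simp add: odd_part_def hmul_scaleR hmul_diff assms(1))
qed

lemma href_odd_part: "href (odd_part f) = - odd_part f"
  by (simp add: odd_part_def href_scaleR href_diff scaleR_right_diff_distrib)

lemma continuous_on_odd_part [continuous_intros]: "continuous_on S f \<Longrightarrow> continuous_on S (\<lambda>x. odd_part (f x))"
  unfolding odd_part_def by (intro continuous_intros)

lemma continuous_on_even_part [continuous_intros]: "continuous_on S f \<Longrightarrow> continuous_on S (\<lambda>x. even_part (f x))"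
  unfolding even_part_def by (intro continuous_intros)

lemma h2_split:
  obtains g where "f = hmul (\<lambda>z. hfun f 0) hone + hshift g"
proof -
  have "hfun (f - hmul (\<lambda>z. hfun f 0) hone) 0 = 0"
    by (simp add: hfun_minus hfun_hmul hfun_hone)
  then obtain g where "f - hmul (\<lambda>z. hfun f 0) hone = hshift g" by (rule shift_exists)
  then show ?thesis using that[of g] by (simp add: algebra_simps)
qed

lemma hco_hmul_power: "hco (hmul (\<lambda>z. z ^ j) f) n = (if j \<le> n then hco f (n - j) else 0)"
proof (induction j arbitrary: n)
  case (Suc j)
  have "hmul (\<lambda>z. z ^ Suc j) f = hshift (hmul (\<lambda>z. z ^ j) f)" by (simp add: hmul_hmul)
  then show ?case by (auto simp: hco_shift Suc split: nat.splits)
qed simp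

lemma inner_monomial: "inner (hpoly (monom 1 k)) f = Re (hco f k)"
proof -
  have "inner (hpoly (monom 1 k)) f = inner f (hpoly (monom 1 k))" by (rule inner_commute)
  also have "\<dots> = Re (\<Sum>n. hco f n * cnj (if n = k then 1 else 0))"
    unfolding inner_h2_def hco_hpoly coeff_monom by (simp only: eq_commute[of k])
  also have "(\<Sum>n. hco f n * cnj (if n = k then 1 else 0)) = hco f k"
    using suminf_finite[of "{k}" "\<lambda>n. hco f n * cnj (if n = k then 1 else 0)"] by simp
  finally show ?thesis .
qed

lemma inner_hone_right: "inner f hone = Re (hfun f 0)"
proof -
  have "poly (monom 1 0) = (\<lambda>z. 1 :: complex)" by (auto simp: poly_monom)
  then show ?thesis using inner_monomial[of 0 f] by (simp add: hco_0 inner_commute)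
qed

section \<open>Wandering vectors and Beurling's argument\<close>

lemma norm_hmul_pCons:
  assumes f: "norm f = 1" and orth: "\<And>P. inner (hmul (\<lambda>z. z * poly P z) f) f = 0"
  shows "(norm (hmul (poly (pCons a P)) f))\<^sup>2 = (norm a)\<^sup>2 + (norm (hmul (poly P) f))\<^sup>2"
proof -
  have eq: "hmul (poly (pCons a P)) f = hmul (\<lambda>z. a) f + hshift (hmul (poly P) f)"
    by (rule h2_eqI) (simp add: hfun_hmul hfun_simps algebra_simps)
  have "inner (hshift (hmul (poly P) f)) (hmul (\<lambda>z. a) f) = inner (hmul (\<lambda>z. cnj a) (hshift (hmul (poly P) f))) f"
    by (simp add: inner_const)
  also have "hmul (\<lambda>z. cnj a) (hshift (hmul (poly P) f)) = hmul (\<lambda>z. z * poly (smult (cnj a) P) z) f"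
    by (rule h2_eqI) (simp add: hfun_hmul)
  also have "inner \<dots> f = 0" by (rule orth)
  finally have "inner (hmul (\<lambda>z. a) f) (hshift (hmul (poly P) f)) = 0" by (simp add: inner_commute)
  then have "(norm (hmul (poly (pCons a P)) f))\<^sup>2 = (norm (hmul (\<lambda>z. a) f))\<^sup>2 + (norm (hshift (hmul (poly P) f)))\<^sup>2"
    unfolding eq power2_norm_eq_inner inner_add_left inner_add_right by (simp add: inner_commute)
  then show ?thesis by (simp add: norm_const norm_shift f)
qed

text \<open>Peeling off constant terms by Pythagoras gives the same recursion for \<open>f\<close>
  and for \<open>hone\<close>, which satisfies both hypotheses too, so the two norms agree for every
  polynomial.\<close>

lemma isometry_if_wandering:
  assumes f: "norm f = 1" and orth: "\<And>P. inner (hmul (\<lambda>z. z * poly P z) f) f = 0"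
  shows "norm (hmul (poly P) f) = norm (hpoly P)"
proof -
  have "(norm (hmul (poly P) f))\<^sup>2 = (norm (hpoly P))\<^sup>2"
  proof (induction P)
    case 0
    have "poly 0 = (\<lambda>z. 0 :: complex)" by auto
    then show ?case by simp
  next
    case (pCons a P)
    have o: "inner (hmul (\<lambda>z. z * poly P z) hone) hone = 0" for P
      by (simp add: inner_hone_right hfun_hmul)
    show ?case unfolding norm_hmul_pCons[OF f orth] norm_hmul_pCons[OF norm_hone o] pCons.IH ..
  qed
  then show ?thesis by (simp add: power2_eq_iff_nonneg)
qed

text \<open>On the boundary \<open>g\<close> times the conjugate of \<open>\<phi>\<close> has vanishing Fourier coefficients.
  To conclude, pair \<open>\<phi> g\<close> with itself.\<close>
lemma orthogonal_to_inner_orbits: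
  assumes \<phi>: "\<phi> \<in> hinf" "\<And>f. norm (hmul \<phi> f) = norm f"
    and 1: "\<And>f. inner g (hmul \<phi> f) = 0"
    and 2: "\<And>P. inner (hmul (\<lambda>z. z * poly P z) g) (hmul \<phi> hone) = 0"
  shows "g = 0"
proof -
  have P: "inner (hmul (poly P) g) (hmul \<phi> f) = 0" for P f
  proof (induction P arbitrary: f)
    case 0
    have "poly 0 = (\<lambda>z. 0 :: complex)" by auto
    then show ?case by simp
  next
    case (pCons a P)
    have eq: "hmul (poly (pCons a P)) g = hmul (\<lambda>z. a) g + hshift (hmul (poly P) g)"
      by (rule h2_eqI) (simp add: hfun_hmul hfun_simps algebra_simps)
    have "inner (hmul (\<lambda>z. a) g) (hmul \<phi> f) = inner g (hmul \<phi> (hmul (\<lambda>z. cnj a) f))"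
      by (simp add: inner_const hmul_commute[OF hinf_const \<phi>(1)])
    also have "\<dots> = 0" by (rule 1)
    finally have a: "inner (hmul (\<lambda>z. a) g) (hmul \<phi> f) = 0" .
    \<comment> \<open>After splitting off the value at 0, hypothesis 2 deals with the constant. In
      the rest a factor \<open>z\<close> on both sides cancels, which leads back to the induction
      hypothesis. Complex scalars cross the real inner product as conjugates.\<close>
    obtain f' where f': "f = hmul (\<lambda>z. hfun f 0) hone + hshift f'" by (rule h2_split)
    define c where "c = hfun f 0"
    have "inner (hshift (hmul (poly P) g)) (hmul \<phi> (hmul (\<lambda>z. c) hone)) =
        inner (hmul (\<lambda>z. cnj c) (hshift (hmul (poly P) g))) (hmul \<phi> hone)"
      by (simp add: inner_const hmul_commute[OF hinf_const \<phi>(1)])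
    also have "hmul (\<lambda>z. cnj c) (hshift (hmul (poly P) g)) = hmul (\<lambda>z. z * poly (smult (cnj c) P) z) g"
      by (rule h2_eqI) (simp add: hfun_hmul)
    also have "inner \<dots> (hmul \<phi> hone) = 0" by (rule 2)
    finally have b: "inner (hshift (hmul (poly P) g)) (hmul \<phi> (hmul (\<lambda>z. c) hone)) = 0" .
    have "inner (hshift (hmul (poly P) g)) (hmul \<phi> (hshift f')) = 0"
      unfolding hmul_commute[OF \<phi>(1) hinf_ident] inner_shift by (rule pCons.IH)
    moreover have "hmul \<phi> f = hmul \<phi> (hmul (\<lambda>z. c) hone) + hmul \<phi> (hshift f')"
      using f' unfolding c_def by (metis hmul_add \<phi>(1))
    ultimately have "inner (hshift (hmul (poly P) g)) (hmul \<phi> f) = 0" using b by (simp add: inner_add_right)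
    then show ?case unfolding eq using a by (simp add: inner_add_left)
  qed
  \<comment> \<open>\<open>hmul \<phi> g\<close> is a limit of polynomial multiples of
    \<open>g\<close>, hence orthogonal to itself.\<close>
  have "closure (range (\<lambda>P. hmul (poly P) g)) \<subseteq> {x. inner x (hmul \<phi> g) = 0}"
  proof (rule closure_minimal)
    show "closed {x. inner x (hmul \<phi> g) = 0}" by (intro closed_Collect_eq continuous_intros)
  qed (use P in auto)
  then have "inner (hmul \<phi> g) (hmul \<phi> g) = 0" using hmul_in_closure_poly[OF \<phi>(1), of g] by blast
  then have "norm g = 0" using \<phi>(2)[of g] by (simp add: norm_eq_sqrt_inner)
  then show ?thesis by simp
qed

text \<open>The generator is the normalised projection of \<open>z\<^sup>k\<close>, where \<open>k\<close> is the least order of vanishing in \<open>M\<close>.\<close>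
lemma beurling_odd:
  fixes M :: "h2 set"
  assumes sub: "subspace M" and cl: "closed M" and ne: "g0 \<in> M" "g0 \<noteq> 0"
    and inv: "\<And>\<psi> g. \<lbrakk>\<psi> \<in> hinf; \<And>z. z \<in> disc \<Longrightarrow> \<psi> (- z) = \<psi> z; g \<in> M\<rbrakk> \<Longrightarrow> hmul \<psi> g \<in> M"
    and odd: "\<And>g. g \<in> M \<Longrightarrow> href g = - g"
  obtains \<phi> where "\<phi> \<in> M" "\<And>P. norm (hmul (poly P) \<phi>) = norm (hpoly P)"
    "\<And>g. g \<in> M \<Longrightarrow> \<exists>f. g = hmul (hfun \<phi>) f"
proof -
  have "\<exists>n. hco g0 n \<noteq> 0" using ne(2) h2_coeff_eqI[of g0 0] by (auto simp: hco_zero)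
  then have ex: "\<exists>n. \<exists>g\<in>M. hco g n \<noteq> 0" using ne(1) by blast
  define k where "k = (LEAST n. \<exists>g\<in>M. hco g n \<noteq> 0)"
  obtain g1 where g1: "g1 \<in> M" "hco g1 k \<noteq> 0" using LeastI_ex[OF ex] unfolding k_def by blast
  have low: "hco g n = 0" if "g \<in> M" "n < k" for g n using that not_less_Least unfolding k_def by blast
  obtain \<phi>0 where \<phi>0: "\<phi>0 \<in> M" "\<And>y. y \<in> M \<Longrightarrow> inner (hpoly (monom 1 k) - \<phi>0) y = 0"
    using orthogonal_projection_exists[OF sub cl] by metis
  \<comment> \<open>Within \<open>M\<close>, pairing with \<open>\<phi>0\<close> reads off the real
    part of coefficient \<open>k\<close>.\<close>
  have in0: "inner \<phi>0 y = Re (hco y k)" if "y \<in> M" for y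
    using \<phi>0(2)[OF that] by (simp add: inner_diff_left inner_monomial)
  have "\<phi>0 \<noteq> 0"
  proof
    assume "\<phi>0 = 0"
    \<comment> \<open>The scalar makes coefficient \<open>k\<close> real and positive.\<close>
    define y where "y = hmul (\<lambda>z. cnj (hco g1 k)) g1"
    have "y \<in> M" unfolding y_def by (rule inv) (auto simp: g1)
    then have "Re (hco y k) = 0" using in0[of y] \<open>\<phi>0 = 0\<close> by simp
    moreover have "hco y k = of_real ((norm (hco g1 k))\<^sup>2)"
      unfolding complex_norm_square by (simp add: y_def hco_const mult.commute)
    ultimately show False using g1(2) by simp
  qed
  define \<phi> where "\<phi> = (1 / norm \<phi>0) *\<^sub>R \<phi>0"
  have \<phi>M: "\<phi> \<in> M" unfolding \<phi>_def using \<phi>0(1) sub by (intro subspace_scale)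
  have \<phi>1: "norm \<phi> = 1" using \<open>\<phi>0 \<noteq> 0\<close> by (simp add: \<phi>_def)
  \<comment> \<open>For even \<open>j\<close> the product stays in \<open>M\<close> and vanishes to
    an order above \<open>k\<close>. For odd \<open>j\<close> it need not lie in \<open>M\<close>,
    but it is even while \<open>\<phi>\<close> is odd.\<close>
  have orth: "inner (hmul (\<lambda>z. c * z ^ j) g) \<phi> = 0" if g: "g \<in> M" and j: "j \<ge> 1" for g c j
  proof (cases "even j")
    case True
    have M: "hmul (\<lambda>z. c * z ^ j) g \<in> M" by (rule inv) (use True g in auto)
    have "hmul (\<lambda>z. c * z ^ j) g = hmul (\<lambda>z. c) (hmul (\<lambda>z. z ^ j) g)" by (simp add: hmul_hmul)
    then have "hco (hmul (\<lambda>z. c * z ^ j) g) k = 0"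
      using low[OF g, of "k - j"] j by (simp add: hco_const hco_hmul_power)
    then have "inner \<phi>0 (hmul (\<lambda>z. c * z ^ j) g) = 0" using in0[OF M] by simp
    then show ?thesis by (simp add: \<phi>_def inner_commute)
  next
    case False
    have "href (hmul (\<lambda>z. c * z ^ j) g) = hmul (\<lambda>z. c * z ^ j) g"
      using False odd[OF g] by (subst href_hmul_odd) (auto intro!: h2_eqI simp: hfun_simps hfun_hmul)
    then have "inner (hmul (\<lambda>z. c * z ^ j) g) \<phi> = - inner (hmul (\<lambda>z. c * z ^ j) g) \<phi>"
      using inner_href[of "hmul (\<lambda>z. c * z ^ j) g" \<phi>] odd[OF \<phi>M] by simp
    then show ?thesis by simp
  qed
  have orthP: "inner (hmul (\<lambda>z. z ^ j * poly P z) g) \<phi> = 0" if g: "g \<in> M" and "j \<ge> 1" for g P j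
    using \<open>j \<ge> 1\<close>
  proof (induction P arbitrary: j)
    case (pCons a P)
    have "hmul (\<lambda>z. z ^ j * poly (pCons a P) z) g = hmul (\<lambda>z. a * z ^ j) g + hmul (\<lambda>z. z ^ Suc j * poly P z) g"
      by (rule h2_eqI) (simp add: hfun_hmul hfun_simps algebra_simps)
    then show ?case using pCons.IH[of "Suc j"] orth[OF g pCons.prems] by (simp add: inner_add_left)
  qed simp
  have orth1: "inner (hmul (\<lambda>z. z * poly P z) g) \<phi> = 0" if "g \<in> M" for g P
    using orthP[OF that, of 1 P] by simp
  have iso: "norm (hmul (poly P) \<phi>) = norm (hpoly P)" for P
    by (rule isometry_if_wandering[OF \<phi>1 orth1[OF \<phi>M]])
  have \<phi>h: "hfun \<phi> \<in> hinf"
    by (rule hinf_hfun[of _ 1], rule multiplier_bounded) (use iso in auto)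
  have \<phi>one: "hmul (hfun \<phi>) hone = \<phi>" by (rule h2_eqI) (simp add: hfun_hmul \<phi>h hfun_hone)
  have \<phi>n: "norm (hmul (hfun \<phi>) f) = norm f" for f
    by (rule hmul_isometry_if_poly[OF \<phi>h]) (simp add: hmul_commute[OF \<phi>h hinf_poly] \<phi>one iso)
  have "\<exists>f. g = hmul (hfun \<phi>) f" if g: "g \<in> M" for g
  proof -
    obtain q where q: "q \<in> range (hmul (hfun \<phi>))" "\<And>y. y \<in> range (hmul (hfun \<phi>)) \<Longrightarrow> inner (g - q) y = 0"
      using orthogonal_projection_exists[OF isometry_range[OF \<phi>h \<phi>n]] by metis
    then obtain f where f: "q = hmul (hfun \<phi>) f" by blast
    have "g - q = 0"
    \<comment> \<open>The second condition splits: the part from \<open>g\<close> is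
      \<open>orth1\<close>, and for \<open>q = \<phi> f\<close> the isometry reduces it to the value
      at 0 of a multiple of \<open>z\<close>.\<close>
    proof (rule orthogonal_to_inner_orbits[OF \<phi>h \<phi>n])
      show "inner (g - q) (hmul (hfun \<phi>) f) = 0" for f using q(2) by blast
      show "inner (hmul (\<lambda>z. z * poly P z) (g - q)) (hmul (hfun \<phi>) hone) = 0" for P
      proof -
        have zP: "(\<lambda>z. z * poly P z) \<in> hinf" by simp
        have "inner (hmul (\<lambda>z. z * poly P z) q) (hmul (hfun \<phi>) hone) = inner (hmul (\<lambda>z. z * poly P z) f) hone"
          unfolding f hmul_commute[OF zP \<phi>h] by (rule isometry_inner[OF \<phi>h \<phi>n])
        also have "\<dots> = 0" by (simp add: inner_hone_right hfun_hmul)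
        finally show ?thesis using orth1[OF g, of P] by (simp add: hmul_diff[OF zP] inner_diff_left \<phi>one)
      qed
    qed
    then show ?thesis using f by auto
  qed
  with \<phi>M iso that show thesis by blast
qed

section \<open>Approximation among even and among odd functions\<close>

lemma subspace_closure:
  fixes A :: "'a::real_normed_vector set"
  assumes "subspace A"
  shows "subspace (closure A)"
  unfolding subspace_def
proof (intro conjI allI ballI)
  show "0 \<in> closure A" using subspace_0[OF assms] closure_subset by blast
next
  fix x y assume "x \<in> closure A" "y \<in> closure A"
  then obtain X Y where X: "\<And>n. X n \<in> A" "X \<longlonglongrightarrow> x" and Y: "\<And>n. Y n \<in> A" "Y \<longlonglongrightarrow> y"
    unfolding closure_sequential by blast
  have "\<forall>n. X n + Y n \<in> A" using X Y subspace_add[OF assms] by blast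
  then show "x + y \<in> closure A" using tendsto_add[OF X(2) Y(2)]
    unfolding closure_sequential by (intro exI[of _ "\<lambda>n. X n + Y n"]) simp
next
  fix c x assume "x \<in> closure A"
  then obtain X where X: "\<And>n. X n \<in> A" "X \<longlonglongrightarrow> x" unfolding closure_sequential by blast
  have "\<forall>n. c *\<^sub>R X n \<in> A" using X subspace_scale[OF assms] by blast
  then show "c *\<^sub>R x \<in> closure A" using tendsto_scaleR[OF tendsto_const X(2)]
    unfolding closure_sequential by (intro exI[of _ "\<lambda>n. c *\<^sub>R X n"]) simp
qed

abbreviation even_polys :: "h2 set" where
  "even_polys \<equiv> {hmul (even_poly N c) hone | N c. True}"

lemma even_part_in_closure: "even_part f \<in> closure even_polys"
proof -
  have "f \<in> {f. even_part f \<in> closure even_polys}"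
  proof (rule h2_closed_dense)
    have "closed (even_part -` closure even_polys)"
      by (intro closed_vimage closed_closure continuous_intros)
    then show "closed {f. even_part f \<in> closure even_polys}" by (simp add: vimage_def)
    fix P :: "complex poly"
    \<comment> \<open>Coefficients with \<open>2 * k\<close> beyond the degree are zero, so
      \<open>Suc (degree P)\<close> terms are enough.\<close>
    define N c where "N = Suc (degree P)" and "c k = coeff P (2 * k)" for k
    have ep: "even_poly N c = poly (\<Sum>k<N. monom (c k) (2 * k))"
      by (rule ext) (simp add: even_poly_def poly_sum poly_monom)
    have "even_part (hpoly P) = hmul (even_poly N c) hone"
    proof (rule h2_coeff_eqI)
      fix n
      have "hco (hmul (even_poly N c) hone) n = (\<Sum>k<N. if 2 * k = n then c k else 0)"
        unfolding ep hco_hpoly by (simp add: coeff_sum)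
      also have "\<dots> = (if even n then coeff P n else 0)"
      proof (cases "even n")
        case True
        then obtain l where l: "n = 2 * l" by blast
        have "(\<Sum>k<N. if 2 * k = n then c k else 0) = (\<Sum>k<N. if k = l then c k else 0)"
          by (intro sum.cong) (auto simp: l)
        also have "\<dots> = (if l < N then c l else 0)" by simp
        also have "\<dots> = coeff P n" by (auto simp: l c_def N_def coeff_eq_0)
        finally show ?thesis using True by simp
      qed (auto intro!: sum.neutral)
      also have "\<dots> = hco (even_part (hpoly P)) n"
        by (cases "even n") (auto simp: even_part_def hco_scaleR hco_plus hco_href hco_hpoly)
      finally show "hco (even_part (hpoly P)) n = hco (hmul (even_poly N c) hone) n" by simp
    qed
    then have "even_part (hpoly P) \<in> even_polys" by blast
    then have "even_part (hpoly P) \<in> closure even_polys"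
      by (rule subsetD[OF closure_subset])
    then show "hpoly P \<in> {f. even_part f \<in> closure even_polys}" by (rule CollectI)
  qed
  then show ?thesis by simp
qed

definition odd_range :: "(complex \<Rightarrow> complex) \<Rightarrow> h2 set" where
  "odd_range m = closure (range (\<lambda>g. odd_part (hmul m g)))"

lemma odd_range_all_if_no_even_divisor:
  assumes m: "inner_fn m"
    and div: "\<And>p. \<lbrakk>inner_divisor p m; \<And>z. z \<in> disc \<Longrightarrow> p z = p (- z)\<rbrakk> \<Longrightarrow> \<exists>c. \<forall>z\<in>disc. p z = c"
  shows "odd_part u \<in> odd_range m"
proof -
  define M where "M = odd_range m"
  have mh: "m \<in> hinf" and mn: "norm (hmul m f) = norm f" for f
    using m by (auto simp: inner_fn_hinf inner_fn_isometry)
  have "linear (\<lambda>g. odd_part (hmul m g))"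
    by (rule linearI) (simp_all add: hmul_add hmul_scaleR mh odd_part_add odd_part_scaleR)
  then have sub: "subspace M"
    unfolding M_def odd_range_def by (intro subspace_closure linear_subspace_image) auto
  have cl: "closed M" by (simp add: M_def odd_range_def)
  have inM: "odd_part (hmul m g) \<in> M" for g
    unfolding M_def odd_range_def by (rule subsetD[OF closure_subset rangeI])
  \<comment> \<open>Taking odd parts commutes with even multipliers, and continuity carries the
    invariance over to the closure.\<close>
  have inv: "hmul \<psi> g \<in> M" if \<psi>: "\<psi> \<in> hinf" "\<And>z. z \<in> disc \<Longrightarrow> \<psi> (- z) = \<psi> z" and g: "g \<in> M" for \<psi> g
  proof -
    have "hmul \<psi> ` closure (range (\<lambda>g. odd_part (hmul m g))) \<subseteq> M"
    proof (rule image_closure_subset[OF _ cl])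
      show "continuous_on (closure (range (\<lambda>g. odd_part (hmul m g)))) (hmul \<psi>)"
        using continuous_on_hmul[OF \<psi>(1) continuous_on_id] by simp
      show "hmul \<psi> ` range (\<lambda>g. odd_part (hmul m g)) \<subseteq> M"
      proof (clarify)
        fix g
        have "hmul \<psi> (odd_part (hmul m g)) = odd_part (hmul m (hmul \<psi> g))"
          unfolding hmul_commute[OF mh \<psi>(1)] by (rule odd_part_hmul_even[OF \<psi>, symmetric])
        then show "hmul \<psi> (odd_part (hmul m g)) \<in> M" using inM by simp
      qed
    qed
    then show ?thesis using g by (auto simp: M_def odd_range_def)
  qed
  have odd: "href g = - g" if "g \<in> M" for g
  proof -
    have "closure (range (\<lambda>g. odd_part (hmul m g))) \<subseteq> {g. href g = - g}"
      by (rule closure_minimal) (auto simp: href_odd_part intro!: closed_Collect_eq continuous_intros)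
    then show ?thesis using that by (auto simp: M_def odd_range_def)
  qed
  define v where "v = hmul m hone"
  have vn: "norm v = 1" by (simp add: v_def mn norm_hone)
  \<comment> \<open>The odd part of \<open>z v\<close> is \<open>z\<close> times the even part of
    \<open>v\<close>, so \<open>M\<close> sees both parities of \<open>v\<close>.\<close>
  have zv: "hshift v = odd_part (hshift v) + hshift (odd_part v)"
    by (rule h2_eqI) (simp add: odd_part_def hfun_simps hfun_href hfun_hmul field_simps)
  have oM: "odd_part v \<in> M" unfolding v_def by (rule inM)
  have ozM: "odd_part (hshift v) \<in> M"
    unfolding v_def hmul_commute[OF hinf_ident mh] by (rule inM)
  have "\<exists>g0\<in>M. g0 \<noteq> 0"
  proof (rule ccontr)
    assume "\<not> (\<exists>g0\<in>M. g0 \<noteq> 0)"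
    then have "odd_part v = 0" "odd_part (hshift v) = 0" using oM ozM by auto
    then have "hshift v = 0" by (subst zv) simp
    then show False using norm_shift[of v] vn by simp
  qed
  then obtain g0 where g0: "g0 \<in> M" "g0 \<noteq> 0" by blast
  obtain \<phi> where \<phi>M: "\<phi> \<in> M" and iso: "\<And>P. norm (hmul (poly P) \<phi>) = norm (hpoly P)"
    and gen: "\<And>g. g \<in> M \<Longrightarrow> \<exists>f. g = hmul (hfun \<phi>) f"
    using beurling_odd[OF sub cl g0 inv odd] by blast
  have \<phi>h: "hfun \<phi> \<in> hinf"
    by (rule hinf_hfun[of _ 1], rule multiplier_bounded) (use iso in auto)
  have \<phi>odd: "hfun \<phi> (- z) = - hfun \<phi> z" for z
    using odd[OF \<phi>M] by (metis hfun_href hfun_uminus)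
  have "hfun \<phi> 0 = 0" using \<phi>odd[of 0] by simp
  then obtain \<theta> where \<theta>: "\<phi> = hshift \<theta>" by (rule shift_exists)
  \<comment> \<open>The shift is isometric, so removing the factor \<open>z\<close> keeps the
    isometry on polynomials that \<open>inner_fnI\<close> asks for.\<close>
  have iso\<theta>: "norm (hmul (poly P) \<theta>) = norm (hpoly P)" for P
  proof -
    have "hmul (poly P) \<phi> = hshift (hmul (poly P) \<theta>)"
      unfolding \<theta> by (rule hmul_commute) auto
    then show ?thesis using iso[of P] norm_shift by metis
  qed
  have \<theta>i: "inner_fn (hfun \<theta>)" by (rule inner_fnI[OF iso\<theta>])
  have \<theta>h: "hfun \<theta> \<in> hinf" and \<theta>n: "norm (hmul (hfun \<theta>) f) = norm f" for f
    using \<theta>i by (auto simp: inner_fn_hinf inner_fn_isometry)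
  have \<phi>\<theta>: "hfun \<phi> z = z * hfun \<theta> z" if "z \<in> disc" for z
    using that by (simp add: \<theta> hfun_hmul)
  obtain f0 f1 where f01: "odd_part (hshift v) = hmul (hfun \<phi>) f0" "odd_part v = hmul (hfun \<phi>) f1"
    using gen[OF oM] gen[OF ozM] by blast
  \<comment> \<open>Both summands of \<open>z v\<close> are multiples of \<open>\<phi>\<close>, so
    \<open>z v = \<phi> q = z \<theta> q\<close>, and cancelling \<open>z\<close> leaves
    \<open>m = \<theta> q\<close>.\<close>
  define q where "q = f0 + hshift f1"
  have "hshift v = hmul (hfun \<phi>) q"
    unfolding q_def hmul_add[OF \<phi>h] hmul_commute[OF \<phi>h hinf_ident] using zv f01 by simp
  also have "\<dots> = hshift (hmul (hfun \<theta>) q)"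
    unfolding hmul_hmul[OF hinf_ident \<theta>h] by (rule hmul_cong) (rule \<phi>\<theta>)
  finally have vq: "v = hmul (hfun \<theta>) q" by (simp add: shift_eq_iff)
  \<comment> \<open>A priori \<open>q\<close> is only in \<open>hardy2\<close>. Multiplications by
    \<open>\<theta>\<close> and by \<open>m\<close> are both isometric, so polynomials times
    \<open>q\<close> keep their norm and \<open>q\<close> is bounded by 1.\<close>
  have qb: "norm (hfun q z) \<le> 1" if "z \<in> disc" for z
  proof (rule multiplier_bounded[OF _ that])
    fix P
    have "norm (hmul (poly P) q) = norm (hmul (poly P) v)"
      unfolding vq hmul_commute[OF hinf_poly \<theta>h] by (simp add: \<theta>n)
    also have "\<dots> = norm (hpoly P)"
      unfolding v_def hmul_commute[OF hinf_poly mh] by (rule mn)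
    finally show "norm (hmul (poly P) q) \<le> 1 * norm (hpoly P)" by simp
  qed
  have "inner_divisor (hfun \<theta>) m"
    unfolding inner_divisor_def
  proof (intro conjI \<theta>i bexI ballI)
    show "hfun q \<in> hinf" by (rule hinf_hfun[OF qb])
    fix z assume z: "z \<in> disc"
    have "hfun v z = hfun \<theta> z * hfun q z" unfolding vq using z by (simp add: hfun_hmul \<theta>h)
    moreover have "hfun v z = m z" unfolding v_def using z by (simp add: hfun_hmul mh hfun_hone)
    ultimately show "m z = hfun \<theta> z * hfun q z" by metis
  qed
  moreover have "hfun \<theta> z = hfun \<theta> (- z)" if z: "z \<in> disc" for z
  proof (cases "z = 0")
    case False
    have "- z \<in> disc" using z by simp
    then have "- z * hfun \<theta> (- z) = - (z * hfun \<theta> z)" using \<phi>odd[of z] \<phi>\<theta> z by metis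
    then show ?thesis using False by simp
  qed simp
  ultimately have "\<exists>c. \<forall>z\<in>disc. hfun \<theta> z = c" by (rule div)
  then obtain c where c: "\<And>z. z \<in> disc \<Longrightarrow> hfun \<theta> z = c" by blast
  have "c \<noteq> 0"
  proof
    assume "c = 0"
    then have "\<theta> = 0" using c by (intro h2_eqI) (simp add: hfun_zero)
    then have "v = 0" by (simp add: vq hfun_zero)
    then show False using vn by simp
  qed
  \<comment> \<open>Here \<open>\<phi> = c z\<close>; it is essential that the generator itself lies
    in \<open>M\<close>.\<close>
  have "hmul (\<lambda>z. 1 / c) \<phi> \<in> M" by (rule inv) (auto simp: \<phi>M)
  also have "hmul (\<lambda>z. 1 / c) \<phi> = hshift hone"
    by (rule h2_eqI) (use \<open>c \<noteq> 0\<close> in \<open>simp add: hfun_hmul hfun_hone \<phi>\<theta> c\<close>)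
  finally have zM: "hshift hone \<in> M" .
  have "f \<in> {f. odd_part (hshift f) \<in> M}" for f
  proof (rule h2_closed_dense)
    have "closed ((\<lambda>f. odd_part (hshift f)) -` M)"
      by (intro closed_vimage cl continuous_intros) auto
    then show "closed {f. odd_part (hshift f) \<in> M}" by (simp add: vimage_def)
    fix P :: "complex poly"
    \<comment> \<open>The even part of \<open>P\<close>; the odd part of \<open>z P\<close> is
      \<open>z\<close> times it.\<close>
    define \<psi> where "\<psi> z = 1/2 * (poly P z + poly (pcompose P [:0, -1:]) z)" for z
    have \<psi>h: "\<psi> \<in> hinf" unfolding \<psi>_def [abs_def] by (intro hinf_mult hinf_const hinf_add hinf_poly)
    have "hmul \<psi> (hshift hone) \<in> M"
      by (rule inv[OF \<psi>h _ zM]) (simp add: \<psi>_def poly_pcompose add.commute)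
    also have "hmul \<psi> (hshift hone) = odd_part (hshift (hpoly P))"
      by (rule h2_eqI) (simp add: odd_part_def hfun_simps hfun_href hfun_hmul hfun_hone \<psi>h,
          simp add: \<psi>_def poly_pcompose algebra_simps)
    finally show "hpoly P \<in> {f. odd_part (hshift f) \<in> M}" by simp
  qed
  then have all: "odd_part (hshift f) \<in> M" for f by blast
  \<comment> \<open>Constants have no odd part, so only the multiple of \<open>z\<close> in
    \<open>u\<close> counts.\<close>
  define a where "a = hfun u 0"
  obtain f where f: "u = hmul (\<lambda>z. a) hone + hshift f" unfolding a_def by (rule h2_split)
  have "odd_part (hmul (\<lambda>z. a) hone) = 0"
    by (rule h2_eqI) (simp add: odd_part_def hfun_simps hfun_href hfun_hmul hfun_hone)
  then have "odd_part u = odd_part (hshift f)" unfolding f odd_part_add by simp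
  then show ?thesis using all by (simp add: M_def)
qed

theorem theorem2:
  fixes m :: "complex \<Rightarrow> complex"
  assumes "inner_fn m"
    and "\<not> (\<exists>f0. model_space m \<subseteq> {(\<lambda>z. c * f0 z) | c. True})"
  shows "multiplicity_free (model_space m) (compressed_shift m ^^ 2)
     \<longleftrightarrow> \<not> (\<exists>p. inner_divisor p m \<and> \<not> (\<exists>c. \<forall>z\<in>disc. p z = c)
                  \<and> (\<forall>z\<in>disc. p z = p (-z)))"
proof
  assume mf: "multiplicity_free (model_space m) (compressed_shift m ^^ 2)"
  show "\<not> (\<exists>p. inner_divisor p m \<and> \<not> (\<exists>c. \<forall>z\<in>disc. p z = c) \<and> (\<forall>z\<in>disc. p z = p (-z)))"
  proof (rule notI, elim exE conjE)
    fix p assume p: "inner_divisor p m" "\<not> (\<exists>c. \<forall>z\<in>disc. p z = c)" "\<forall>z\<in>disc. p z = p (-z)"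
    have "\<exists>c. \<forall>z\<in>disc. p z = c"
      by (rule even_inner_divisor_constant[OF assms(1) mf p(1)], rule bspec[OF p(3)])
    then show False using p(2) by contradiction
  qed
next
  assume no: "\<not> (\<exists>p. inner_divisor p m \<and> \<not> (\<exists>c. \<forall>z\<in>disc. p z = c) \<and> (\<forall>z\<in>disc. p z = p (-z)))"
  have div: "\<exists>c. \<forall>z\<in>disc. p z = c" if "inner_divisor p m" "\<And>z. z \<in> disc \<Longrightarrow> p z = p (- z)" for p
  proof (rule ccontr)
    assume nc: "\<nexists>c. \<forall>z\<in>disc. p z = c"
    show False by (rule notE[OF no], intro exI[of _ p] conjI ballI that nc)
  qed
  show "multiplicity_free (model_space m) (compressed_shift m ^^ 2)"
    unfolding multiplicity_free_iff[OF assms(1)]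
  \<comment> \<open>With \<open>X = 1\<close> the multiples \<open>f X\<close> are the even
    polynomials. So \<open>m g\<close> has to supply the odd part of \<open>u\<close>, and an even
    polynomial then matches the even part of \<open>u - m g\<close>; each step costs
    \<open>e / 2\<close>.\<close>
  proof (rule exI[of _ hone], intro allI impI)
    fix u and e :: real assume e: "e > 0"
    obtain g where g: "norm (odd_part (hmul m g) - odd_part u) < e / 2"
    proof -
      have "odd_part u \<in> closure (range (\<lambda>g. odd_part (hmul m g)))"
        unfolding odd_range_def[symmetric] by (rule odd_range_all_if_no_even_divisor[OF assms(1) div])
      then have "\<exists>y\<in>range (\<lambda>g. odd_part (hmul m g)). dist y (odd_part u) < e / 2"
        using half_gt_zero[OF e] unfolding closure_approachable by (elim allE[of _ "e / 2"] impE)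
      then show thesis using that by (auto simp: dist_norm)
    qed
    define w where "w = u - hmul m g"
    obtain N c where Nc: "norm (hmul (even_poly N c) hone - even_part w) < e / 2"
    proof -
      have "\<exists>y\<in>even_polys. dist y (even_part w) < e / 2"
        using even_part_in_closure[of w] half_gt_zero[OF e]
        unfolding closure_approachable by (elim allE[of _ "e / 2"] impE)
      then show thesis using that by (auto simp: dist_norm)
    qed
    have eq: "u - hmul (even_poly N c) hone - hmul m g = (even_part w - hmul (even_poly N c) hone) + odd_part w"
      using even_add_odd[of w] unfolding w_def by (simp add: algebra_simps)
    have "norm (odd_part w) < e / 2"
      using g by (simp add: w_def odd_part_diff norm_minus_commute)
    then have "norm (u - hmul (even_poly N c) hone - hmul m g) < e"
      unfolding eq using Nc norm_triangle_ineq[of "even_part w - hmul (even_poly N c) hone" "odd_part w"]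
        norm_minus_commute[of "even_part w" "hmul (even_poly N c) hone"] by linarith
    then show "\<exists>N c g. norm (u - hmul (even_poly N c) hone - hmul m g) < e" by blast
  qed
qed

end
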